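(* There is a critical value $\beta_0=\pi$ such that $$\sigma(-A_\beta)=\sigma_c(-A_\beta)=(-\infty,0],\qquad \sigma_p(-A_\beta)=\emptyset$$ for $\beta\in[0,\beta_0)$. There is a further critical value $\beta_1>\beta_0$, whose value can be determined explicitly as $\beta_1=\frac{3\pi}{\sqrt2}e^{3\pi/4}$, such that for any $\beta\in(\beta_0,\beta_1)$ the continuous spectrum remains unchanged, i.e. $\sigma_c(-A_\beta)=(-\infty,0]$, whereas the point spectrum is genuinely complex, $$\sigma_p(-A_\beta)=\{\lambda_{1,\beta},\dots,\lambda_{n_\beta,\beta}\}\subset\mathbb{C}\setminus\mathbb{R},$$ and varies with $\beta\in(\beta_0,\beta_1)$. The point spectrum is never empty for $\beta\in(\beta_0,\beta_1)$ and consists of finitely many, genuinely complex, isolated eigenvalues that form conjugate pairs in the interior of the left complex half-plane. For $\beta=\beta_1$, a first pair of complex conjugate eigenvalues reaches the imaginary axis. The pair crosses into the right complex half-plane for $\beta>\beta_1$, yet never reaches the positive real axis as $\beta\to\infty$. As $\beta$ increases beyond $\beta_1$, additional pairs of complex conjugate eigenvalues are ejected from the real continuous spectrum into the left complex half-plane and migrate towards the imaginary axis, eventually crossing it, pair after pair. For any finite $\beta>0$, there is only a finite number of conjugate eigenvalue pairs. None of the pairs ever reunites on the positive real axis as $\beta\to\infty$.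
   Context: Let $x_0>0$. $\mathrm{H}^1=\mathrm{H}^1(\mathbb{R})$ and $\mathrm{H}^{-1}$ is its dual; $A:\mathrm{H}^1\subset\mathrm{H}^{-1}\to\mathrm{H}^{-1}$ is the operator induced by the Dirichlet form, $\langle Au,v\rangle=\int_{\mathbb{R}}u_xv_x\,dx$ (i.e. $-\partial_{xx}$). For $\beta\in\mathbb{R}$, $A_\beta=A+\beta\,\delta_0\delta_{x_0}^\top$, i.e. $A_\beta u=Au+\beta u(x_0)\delta_0$, with domain $\mathrm{H}^1$, where $\delta_0$ is the Dirac distribution at $0$ and $\delta_{x_0}^\top$ denotes evaluation at $x_0$. $\sigma$, $\sigma_p$, $\sigma_c$ denote the spectrum, point spectrum and continuous spectrum.
   Formalization: For general x_0>0 the critical values are taken as β_0=π/x_0 and β_1=(3π/√2)e^{3π/4}/x_0, since the stated values are correct only for x_0=1 (for x_0=2, β=2<π there is already a complex pair of eigenvalues). *)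

theory Defs
  imports "HOL-Analysis.Analysis"
begin

section \<open>The Sobolev space \<open>H\<^sup>1(\<real>)\<close>\<close>

definition square_integrable :: "(real \<Rightarrow> complex) set" where
  "square_integrable = {f \<in> borel_measurable lborel. integrable lborel (\<lambda>x. (norm (f x))\<^sup>2)}"

text \<open>
  Testing against \<open>C\<^sup>1\<close> functions of compact support gives the same weak derivatives as testing
  against smooth ones.
\<close>

definition test_function :: "(real \<Rightarrow> real) \<Rightarrow> bool" where
  "test_function \<phi> \<longleftrightarrow> \<phi> C1_differentiable_on UNIV \<and> compact (closure {x. \<phi> x \<noteq> 0})"

definition has_weak_derivative :: "(real \<Rightarrow> complex) \<Rightarrow> (real \<Rightarrow> complex) \<Rightarrow> bool" where
  "has_weak_derivative u g \<longleftrightarrow>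
     (\<forall>\<phi>. test_function \<phi> \<longrightarrow>
        (LINT x|lborel. deriv \<phi> x *\<^sub>R u x) = - (LINT x|lborel. \<phi> x *\<^sub>R g x))"

text \<open>
  Every class in \<open>H\<^sup>1(\<real>)\<close> has exactly one continuous representative, and point evaluation refers to
  that representative; the type consists of these representatives.
\<close>

typedef h1 = "{u. continuous_on UNIV u \<and> u \<in> square_integrable \<and>
                  (\<exists>g \<in> square_integrable. has_weak_derivative u g)}"
  morphisms h1_fun Abs_h1
proof -
  have "(\<lambda>x. 0) \<in> square_integrable"
    by (simp add: square_integrable_def)
  moreover have "has_weak_derivative (\<lambda>x. 0) (\<lambda>x. 0)"
    by (simp add: has_weak_derivative_def)
  ultimately show ?thesis
    by (intro exI[of _ "\<lambda>x. 0"]) auto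
qed

setup_lifting type_definition_h1

text \<open>The weak derivative, determined up to a null set (see \<open>weak_deriv_unique\<close> below).\<close>

definition h1_deriv :: "h1 \<Rightarrow> real \<Rightarrow> complex" where
  "h1_deriv u = (SOME g. g \<in> square_integrable \<and> has_weak_derivative (h1_fun u) g)"

lemma h1_continuous: "continuous_on UNIV (h1_fun u)"
  and h1_square_integrable: "h1_fun u \<in> square_integrable"
  using h1_fun[of u] by auto

lemma h1_deriv_square_integrable: "h1_deriv u \<in> square_integrable"
  and h1_deriv_weak: "has_weak_derivative (h1_fun u) (h1_deriv u)"
proof -
  have "\<exists>g. g \<in> square_integrable \<and> has_weak_derivative (h1_fun u) g"
    using h1_fun[of u] by auto
  from someI_ex[OF this]
  show "h1_deriv u \<in> square_integrable" "has_weak_derivative (h1_fun u) (h1_deriv u)"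
    by (auto simp: h1_deriv_def)
qed

subsection \<open>Square-integrable functions\<close>

lemma sq_int_measurable: "f \<in> square_integrable \<Longrightarrow> f \<in> borel_measurable borel"
  by (simp add: square_integrable_def)

lemma sq_int_integrable: "f \<in> square_integrable \<Longrightarrow> integrable lborel (\<lambda>x. (norm (f x))\<^sup>2)"
  by (simp add: square_integrable_def)

lemma sq_int_norm_mult:
  assumes "f \<in> square_integrable" "g \<in> square_integrable"
  shows "integrable lborel (\<lambda>x. norm (f x) * norm (g x))"
proof (rule Bochner_Integration.integrable_bound)
  show "integrable lborel (\<lambda>x. (norm (f x))\<^sup>2 + (norm (g x))\<^sup>2)"
    using assms by (intro Bochner_Integration.integrable_add sq_int_integrable)
  show "(\<lambda>x. norm (f x) * norm (g x)) \<in> borel_measurable lborel"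
    using assms[THEN sq_int_measurable] by simp
  have "a * b \<le> a\<^sup>2 + b\<^sup>2" if "a \<ge> 0" "b \<ge> 0" for a b :: real
  proof -
    have "0 \<le> (a - b)\<^sup>2" "0 \<le> a * b"
      using that by auto
    thus ?thesis
      unfolding power2_diff by linarith
  qed
  thus "AE x in lborel. norm (norm (f x) * norm (g x)) \<le> norm ((norm (f x))\<^sup>2 + (norm (g x))\<^sup>2)"
    by (intro AE_I2) simp
qed

lemma sq_int_mult:
  assumes "f \<in> square_integrable" "g \<in> square_integrable"
  shows "integrable lborel (\<lambda>x. f x * g x)"
  using assms[THEN sq_int_measurable]
  by (intro Bochner_Integration.integrable_bound[OF sq_int_norm_mult[OF assms]])
     (auto simp: norm_mult)

lemma sq_int_inner:
  assumes "f \<in> square_integrable" "g \<in> square_integrable"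
  shows "integrable lborel (\<lambda>x. f x \<bullet> g x)"
  using assms[THEN sq_int_measurable]
  by (intro Bochner_Integration.integrable_bound[OF sq_int_norm_mult[OF assms]])
     (auto simp: Cauchy_Schwarz_ineq2)

lemma sq_int_add:
  assumes "f \<in> square_integrable" "g \<in> square_integrable"
  shows "(\<lambda>x. f x + g x) \<in> square_integrable"
proof -
  have "integrable lborel (\<lambda>x. (norm (f x))\<^sup>2 + 2 * (f x \<bullet> g x) + (norm (g x))\<^sup>2)"
    using assms by (intro Bochner_Integration.integrable_add sq_int_integrable
        integrable_mult_right sq_int_inner)
  also have "(\<lambda>x. (norm (f x))\<^sup>2 + 2 * (f x \<bullet> g x) + (norm (g x))\<^sup>2) = (\<lambda>x. (norm (f x + g x))\<^sup>2)"
    by (auto simp: power2_norm_eq_inner inner_add_left inner_add_right inner_commute)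
  finally show ?thesis
    using assms[THEN sq_int_measurable] by (simp add: square_integrable_def)
qed

lemma sq_int_cmult:
  assumes "f \<in> square_integrable"
  shows "(\<lambda>x. c * f x) \<in> square_integrable"
  using sq_int_measurable[OF assms] sq_int_integrable[OF assms]
  by (auto simp: square_integrable_def norm_mult power_mult_distrib)

lemma sq_int_indicator: "(\<lambda>x. indicator {a..b} x :: complex) \<in> square_integrable"
proof -
  have "(\<lambda>x. (norm (indicator {a..b} x :: complex))\<^sup>2) = (indicator {a..b} :: real \<Rightarrow> real)"
    by (auto simp: indicator_def)
  thus ?thesis
    by (simp add: square_integrable_def integrable_indicator_iff emeasure_lborel_Icc_eq)
qed

lemma sq_int_integrable_on_Icc:
  assumes "f \<in> square_integrable"
  shows "integrable lborel (\<lambda>x. indicator {a..b} x *\<^sub>R f x)"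
proof -
  have "(\<lambda>x. indicator {a..b} x *\<^sub>R f x) = (\<lambda>x. indicator {a..b} x * f x)"
    by (auto simp: indicator_def)
  thus ?thesis
    using sq_int_mult[OF sq_int_indicator assms] by simp
qed

lemma sq_int_Cauchy_Schwarz:
  assumes "f \<in> square_integrable" "g \<in> square_integrable"
  shows "(LINT x|lborel. norm (f x) * norm (g x)) \<le>
           sqrt (LINT x|lborel. (norm (f x))\<^sup>2) * sqrt (LINT x|lborel. (norm (g x))\<^sup>2)"
proof -
  note [measurable] = assms[THEN sq_int_measurable]
  let ?F = "LINT x|lborel. (norm (f x))\<^sup>2" and ?G = "LINT x|lborel. (norm (g x))\<^sup>2"
    and ?P = "LINT x|lborel. norm (f x) * norm (g x)"
  have nn: "0 \<le> ?F" "0 \<le> ?G" "0 \<le> ?P"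
    by auto
  have "(\<integral>\<^sup>+x. ennreal (norm (f x)) * ennreal (norm (g x)) \<partial>lborel)\<^sup>2 \<le>
        (\<integral>\<^sup>+x. ennreal (norm (f x)) ^ 2 \<partial>lborel) * (\<integral>\<^sup>+x. ennreal (norm (g x)) ^ 2 \<partial>lborel)"
    by (rule Cauchy_Schwarz_nn_integral) auto
  also have "(\<integral>\<^sup>+x. ennreal (norm (f x)) ^ 2 \<partial>lborel) = ennreal ?F"
    using nn_integral_eq_integral[OF sq_int_integrable[OF assms(1)]] by (simp add: ennreal_power)
  also have "(\<integral>\<^sup>+x. ennreal (norm (g x)) ^ 2 \<partial>lborel) = ennreal ?G"
    using nn_integral_eq_integral[OF sq_int_integrable[OF assms(2)]] by (simp add: ennreal_power)
  also have "(\<integral>\<^sup>+x. ennreal (norm (f x)) * ennreal (norm (g x)) \<partial>lborel) = ennreal ?P"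
    using nn_integral_eq_integral[OF sq_int_norm_mult[OF assms]] by (simp add: ennreal_mult')
  finally have "ennreal (?P\<^sup>2) \<le> ennreal (?F * ?G)"
    using nn by (simp add: ennreal_power ennreal_mult')
  hence "?P\<^sup>2 \<le> ?F * ?G"
    using nn by (simp add: ennreal_le_iff)
  thus ?thesis
    using nn by (metis real_le_rsqrt real_sqrt_mult)
qed

subsection \<open>Weak derivatives are derivatives in the sense of the fundamental theorem\<close>

lemma integrable_continuous_compact:
  fixes f :: "real \<Rightarrow> 'b::{banach, second_countable_topology}"
  assumes "continuous_on UNIV f" and "\<And>x. x \<notin> {l..r} \<Longrightarrow> f x = 0"
  shows "integrable lborel f"
proof -
  have "integrable lborel (\<lambda>x. indicator {l..r} x *\<^sub>R f x)"
    using borel_integrable_compact[of "{l..r}" f] assms(1) continuous_on_subset by blast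
  also have "(\<lambda>x. indicator {l..r} x *\<^sub>R f x) = f"
    using assms(2) by (force simp: indicator_def)
  finally show ?thesis .
qed

text \<open>A \<open>C\<^sup>1\<close> step of width \<open>2e\<close> rising from 0 to 1, and its derivative.\<close>

definition pstep :: "real \<Rightarrow> real \<Rightarrow> real" where
  "pstep e t = ((max 0 t)\<^sup>2 - 2 * (max 0 (t - e))\<^sup>2 + (max 0 (t - 2 * e))\<^sup>2) / (2 * e\<^sup>2)"

definition ptent :: "real \<Rightarrow> real \<Rightarrow> real" where
  "ptent e t = (max 0 t - 2 * max 0 (t - e) + max 0 (t - 2 * e)) / e\<^sup>2"

lemma DERIV_pos_part_sq: "((\<lambda>t::real. (max 0 t)\<^sup>2) has_real_derivative 2 * max 0 t) (at t)"
proof -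
  consider "t > 0" | "t < 0" | "t = 0" by linarith
  thus ?thesis
  proof cases
    case 1
    have "((\<lambda>t::real. t\<^sup>2) has_real_derivative 2 * t) (at t)"
      by (auto intro!: derivative_eq_intros)
    hence "((\<lambda>t::real. (max 0 t)\<^sup>2) has_real_derivative 2 * t) (at t)"
      by (rule has_field_derivative_transform_within_open[where S = "{0<..}"]) (use 1 in auto)
    thus ?thesis using 1 by (simp add: max_def)
  next
    case 2
    have "((\<lambda>t::real. 0) has_real_derivative 0) (at t)"
      by simp
    hence "((\<lambda>t::real. (max 0 t)\<^sup>2) has_real_derivative 0) (at t)"
      by (rule has_field_derivative_transform_within_open[where S = "{..<0}"]) (use 2 in auto)
    thus ?thesis using 2 by simp
  next
    case 3
    have "((\<lambda>y::real. (max 0 y)\<^sup>2 / y) \<longlongrightarrow> 0) (at 0)"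
    proof (rule Lim_null_comparison)
      show "\<forall>\<^sub>F y::real in at 0. norm ((max 0 y)\<^sup>2 / y) \<le> \<bar>y\<bar>"
        by (intro always_eventually allI) (auto simp: max_def power2_eq_square)
      show "((\<lambda>y::real. \<bar>y\<bar>) \<longlongrightarrow> 0) (at 0)"
        by (intro tendsto_rabs_zero) (rule tendsto_ident_at)
    qed
    thus ?thesis using 3 by (simp add: has_field_derivative_iff)
  qed
qed

lemma DERIV_pos_part_sq_shift:
  "((\<lambda>t::real. (max 0 (t - c))\<^sup>2) has_real_derivative 2 * max 0 (t - c)) (at t)"
proof -
  have "((\<lambda>t. t - c) has_real_derivative 1) (at t)"
    by (auto intro!: derivative_eq_intros)
  from DERIV_chain2[OF DERIV_pos_part_sq this] show ?thesis
    by simp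
qed

lemma DERIV_pstep: "e > 0 \<Longrightarrow> (pstep e has_real_derivative ptent e t) (at t)"
  unfolding pstep_def[abs_def] ptent_def
  by (rule DERIV_cong[OF DERIV_cdivide[OF DERIV_add[OF DERIV_diff[OF DERIV_pos_part_sq
        DERIV_cmult[OF DERIV_pos_part_sq_shift]] DERIV_pos_part_sq_shift]]])
     (simp add: field_simps)

lemma DERIV_pstep_shift: "e > 0 \<Longrightarrow> ((\<lambda>x. pstep e (x - a)) has_real_derivative ptent e (x - a)) (at x)"
proof -
  assume "e > 0"
  have "((\<lambda>t. t - a) has_real_derivative 1) (at x)"
    by (auto intro!: derivative_eq_intros)
  from DERIV_chain2[OF DERIV_pstep[OF \<open>e > 0\<close>] this] show ?thesis
    by simp
qed

lemma continuous_ptent: "continuous_on UNIV (\<lambda>x. ptent e (x - a))"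
  unfolding ptent_def by (cases "e = 0") (auto intro!: continuous_intros)

lemma continuous_pstep: "continuous_on UNIV (\<lambda>x. pstep e (x - a))"
  unfolding pstep_def by (cases "e = 0") (auto intro!: continuous_intros)

lemma pstep_left: "e > 0 \<Longrightarrow> t \<le> 0 \<Longrightarrow> pstep e t = 0"
  by (simp add: pstep_def)

lemma pstep_right: "e > 0 \<Longrightarrow> t \<ge> 2 * e \<Longrightarrow> pstep e t = 1"
  by (simp add: pstep_def field_simps power2_eq_square)

lemma ptent_outside: "e > 0 \<Longrightarrow> t \<notin> {0..2 * e} \<Longrightarrow> ptent e t = 0"
  by (auto simp: ptent_def max_def)

lemma ptent_outside_shift: "e > 0 \<Longrightarrow> x \<notin> {a..a + 2 * e} \<Longrightarrow> ptent e (x - a) = 0"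
  by (rule ptent_outside) auto

lemma ptent_nonneg: "e > 0 \<Longrightarrow> ptent e t \<ge> 0"
  unfolding ptent_def by (intro divide_nonneg_nonneg) (auto simp: max_def)

lemma pstep_range:
  assumes "e > 0"
  shows "pstep e t \<in> {0..1}"
proof -
  have mono: "pstep e s \<le> pstep e t" if "s \<le> t" for s t
    by (rule DERIV_nonneg_imp_nondecreasing[OF that])
       (use DERIV_pstep ptent_nonneg assms in blast)
  have "pstep e (min t 0) \<le> pstep e t" "pstep e t \<le> pstep e (max t (2 * e))"
    by (auto intro: mono)
  thus ?thesis
    using assms pstep_left[of e "min t 0"] pstep_right[of e "max t (2 * e)"] by auto
qed

lemma integrable_ptent_scaleR:
  fixes u :: "real \<Rightarrow> complex"
  assumes "e > 0" "continuous_on UNIV u"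
  shows "integrable lborel (\<lambda>x. ptent e (x - a) *\<^sub>R u x)"
proof (rule integrable_continuous_compact[where l = a and r = "a + 2 * e"])
  show "continuous_on UNIV (\<lambda>x. ptent e (x - a) *\<^sub>R u x)"
    by (intro continuous_on_scaleR continuous_ptent assms)
  show "ptent e (x - a) *\<^sub>R u x = 0" if "x \<notin> {a..a + 2 * e}" for x
    using ptent_outside_shift[OF assms(1) that] by simp
qed

lemma integrable_ptent: "e > 0 \<Longrightarrow> integrable lborel (\<lambda>x. ptent e (x - a))"
  by (rule integrable_continuous_compact[where l = a and r = "a + 2 * e"])
     (simp_all add: continuous_ptent ptent_outside_shift del: atLeastAtMost_iff)

lemma integral_ptent:
  assumes "e > 0"
  shows "(LINT x|lborel. ptent e (x - a)) = 1"
proof -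
  have "(LINT x|lborel. ptent e (x - a)) =
        (LINT x|lborel. indicator {a..a + 2 * e} x *\<^sub>R ptent e (x - a))"
    by (rule Bochner_Integration.integral_cong)
       (use ptent_outside_shift[OF assms] in \<open>auto simp: indicator_def simp del: atLeastAtMost_iff\<close>)
  also have "\<dots> = pstep e (a + 2 * e - a) - pstep e (a - a)"
  proof (rule integral_FTC_atLeastAtMost)
    show "a \<le> a + 2 * e"
      using assms by simp
    show "((\<lambda>x. pstep e (x - a)) has_vector_derivative ptent e (x - a)) (at x within {a..a + 2 * e})" for x
      using DERIV_pstep_shift[OF assms, of a x]
      by (simp add: has_real_derivative_iff_has_vector_derivative has_vector_derivative_at_within)
    show "continuous_on {a..a + 2 * e} (\<lambda>x. ptent e (x - a))"
      using continuous_ptent continuous_on_subset by blast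
  qed
  also have "\<dots> = 1"
    using pstep_left[OF assms, of 0] pstep_right[OF assms, of "2 * e"] by simp
  finally show ?thesis .
qed

lemma ptent_approx:
  fixes u :: "real \<Rightarrow> complex"
  assumes "continuous_on UNIV u"
  shows "(\<lambda>n. LINT x|lborel. ptent (1 / Suc n) (x - a) *\<^sub>R u x) \<longlonglongrightarrow> u a"
proof (rule metric_LIMSEQ_I)
  fix r :: real
  assume "r > 0"
  have "isCont u a"
    using assms by (simp add: continuous_on_eq_continuous_at)
  then obtain d where d: "d > 0" "\<And>x. dist x a < d \<Longrightarrow> dist (u x) (u a) < r / 2"
    unfolding continuous_at_eps_delta using \<open>r > 0\<close> by (metis half_gt_zero)
  obtain N :: nat where N: "2 / d < real N"
    using reals_Archimedean2 by blast
  show "\<exists>N. \<forall>n\<ge>N. dist (LINT x|lborel. ptent (1 / Suc n) (x - a) *\<^sub>R u x) (u a) < r"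
  proof (intro exI[of _ N] allI impI)
    fix n :: nat
    assume "n \<ge> N"
    define e where "e = 1 / real (Suc n)"
    have e: "e > 0" "2 * e < d"
    proof -
      have "2 / d < real (Suc n)"
        using N \<open>n \<ge> N\<close> by linarith
      thus "2 * e < d"
        using d(1) by (simp add: e_def field_simps)
    qed (simp add: e_def)
    have i: "integrable lborel (\<lambda>x. ptent e (x - a) *\<^sub>R (u x - u a))"
      by (rule integrable_ptent_scaleR) (use e assms in \<open>auto intro!: continuous_intros\<close>)
    have "u a = (LINT x|lborel. ptent e (x - a) *\<^sub>R u a)"
      using integral_ptent[OF e(1), of a] by (simp add: integrable_ptent e)
    hence "(LINT x|lborel. ptent e (x - a) *\<^sub>R u x) - u a =
        (LINT x|lborel. ptent e (x - a) *\<^sub>R u x) - (LINT x|lborel. ptent e (x - a) *\<^sub>R u a)"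
      by simp
    also have "\<dots> = (LINT x|lborel. ptent e (x - a) *\<^sub>R (u x - u a))"
      by (subst Bochner_Integration.integral_diff[symmetric])
         (auto simp: scaleR_diff_right integrable_ptent_scaleR[OF e(1) assms]
            integrable_ptent_scaleR[OF e(1) continuous_on_const])
    finally have "norm ((LINT x|lborel. ptent e (x - a) *\<^sub>R u x) - u a) \<le>
        (LINT x|lborel. norm (ptent e (x - a) *\<^sub>R (u x - u a)))"
      by (simp only: integral_norm_bound)
    also have "\<dots> \<le> (LINT x|lborel. ptent e (x - a) * (r / 2))"
    proof (rule integral_mono)
      show "integrable lborel (\<lambda>x. norm (ptent e (x - a) *\<^sub>R (u x - u a)))"
        using i by (rule integrable_norm)
      show "integrable lborel (\<lambda>x. ptent e (x - a) * (r / 2))"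
        using integrable_ptent[OF e(1)] by simp
      show "norm (ptent e (x - a) *\<^sub>R (u x - u a)) \<le> ptent e (x - a) * (r / 2)" for x
      proof (cases "x - a \<in> {0..2 * e}")
        case True
        hence "dist x a < d"
          using e by (auto simp: dist_real_def)
        hence "norm (u x - u a) \<le> r / 2"
          using d(2)[of x] by (simp add: dist_norm)
        thus ?thesis
          using ptent_nonneg[OF e(1), of "x - a"] by (simp add: mult_left_mono del: times_divide_eq_right)
      qed (use ptent_outside[OF e(1)] in auto)
    qed
    also have "\<dots> = r / 2"
      using integral_ptent[OF e(1)] by simp
    finally show "dist (LINT x|lborel. ptent (1 / Suc n) (x - a) *\<^sub>R u x) (u a) < r"
      using \<open>r > 0\<close> by (simp add: dist_norm e_def)
  qed
qed

lemma weak_derivative_FTC: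
  assumes u: "continuous_on UNIV u" and g: "g \<in> square_integrable"
    and w: "has_weak_derivative u g" and ab: "a \<le> b"
  shows "u b - u a = (LINT x|lborel. indicator {a<..b} x *\<^sub>R g x)"
proof -
  define e where "e n = 1 / real (Suc n)" for n
  have e: "e n > 0" "e n \<le> 1" for n
    by (auto simp: e_def)
  define \<phi> where "\<phi> n x = pstep (e n) (x - a) - pstep (e n) (x - b)" for n x
  have D: "(\<phi> n has_real_derivative ptent (e n) (x - a) - ptent (e n) (x - b)) (at x)" for n x
    unfolding \<phi>_def by (intro DERIV_diff DERIV_pstep_shift e)
  have supp: "\<phi> n x = 0" if "x \<notin> {a..b + 2}" for n x
  proof -
    have "x < a \<or> x > b + 2" using that by auto
    thus ?thesis
      using e[of n] ab by (auto simp: \<phi>_def pstep_left pstep_right)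
  qed
  have test: "test_function (\<phi> n)" for n
    unfolding test_function_def
  proof
    show "\<phi> n C1_differentiable_on UNIV"
      unfolding C1_differentiable_on_def
      by (rule exI[of _ "\<lambda>x. ptent (e n) (x - a) - ptent (e n) (x - b)"])
         (use D in \<open>auto simp: has_real_derivative_iff_has_vector_derivative
              intro!: continuous_on_diff continuous_ptent\<close>)
    have "closure {x. \<phi> n x \<noteq> 0} \<subseteq> {a..b + 2}"
      by (rule closure_minimal) (use supp in \<open>auto simp del: atLeastAtMost_iff\<close>)
    thus "compact (closure {x. \<phi> n x \<noteq> 0})"
      by (meson bounded_closed_interval bounded_subset closed_closure compact_eq_bounded_closed)
  qed
  have "(\<lambda>n. (LINT x|lborel. ptent (e n) (x - a) *\<^sub>R u x) - (LINT x|lborel. ptent (e n) (x - b) *\<^sub>R u x))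
          \<longlonglongrightarrow> u a - u b"
    unfolding e_def by (intro tendsto_diff ptent_approx u)
  also have "(\<lambda>n. (LINT x|lborel. ptent (e n) (x - a) *\<^sub>R u x) - (LINT x|lborel. ptent (e n) (x - b) *\<^sub>R u x))
      = (\<lambda>n. - (LINT x|lborel. \<phi> n x *\<^sub>R g x))"
  proof
    fix n
    have "deriv (\<phi> n) x = ptent (e n) (x - a) - ptent (e n) (x - b)" for x
      using D by (rule DERIV_imp_deriv)
    hence "(LINT x|lborel. deriv (\<phi> n) x *\<^sub>R u x) =
        (LINT x|lborel. ptent (e n) (x - a) *\<^sub>R u x) - (LINT x|lborel. ptent (e n) (x - b) *\<^sub>R u x)"
      by (subst Bochner_Integration.integral_diff[symmetric])
         (auto simp: scaleR_diff_left integrable_ptent_scaleR u e)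
    thus "(LINT x|lborel. ptent (e n) (x - a) *\<^sub>R u x) - (LINT x|lborel. ptent (e n) (x - b) *\<^sub>R u x)
        = - (LINT x|lborel. \<phi> n x *\<^sub>R g x)"
      using w test[of n] by (auto simp: has_weak_derivative_def)
  qed
  finally have lim1: "(\<lambda>n. - (LINT x|lborel. \<phi> n x *\<^sub>R g x)) \<longlonglongrightarrow> u a - u b" .
  have "(\<lambda>n. LINT x|lborel. \<phi> n x *\<^sub>R g x) \<longlonglongrightarrow> (LINT x|lborel. indicator {a<..b} x *\<^sub>R g x)"
  proof (rule integral_dominated_convergence)
    note [measurable] = sq_int_measurable[OF g]
    show "(\<lambda>x. indicator {a<..b} x *\<^sub>R g x) \<in> borel_measurable lborel"
      by measurable
    have [measurable]: "\<phi> n \<in> borel_measurable borel" for n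
      by (rule borel_measurable_continuous_onI)
         (auto simp: \<phi>_def[abs_def] intro!: continuous_on_diff continuous_pstep)
    show "(\<lambda>x. \<phi> n x *\<^sub>R g x) \<in> borel_measurable lborel" for n
      by measurable
    show "integrable lborel (\<lambda>x. norm (indicator {a..b + 2} x *\<^sub>R g x))"
      by (intro integrable_norm sq_int_integrable_on_Icc g)
    show "AE x in lborel. norm (\<phi> n x *\<^sub>R g x) \<le> norm (indicator {a..b + 2} x *\<^sub>R g x)" for n
    proof (rule AE_I2)
      fix x
      have "\<bar>\<phi> n x\<bar> \<le> 1"
        using pstep_range[OF e(1)[of n], of "x - a"] pstep_range[OF e(1)[of n], of "x - b"]
        by (auto simp: \<phi>_def abs_le_iff)
      hence "\<bar>\<phi> n x\<bar> * norm (g x) \<le> 1 * norm (g x)"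
        by (intro mult_right_mono) auto
      thus "norm (\<phi> n x *\<^sub>R g x) \<le> norm (indicator {a..b + 2} x *\<^sub>R g x)"
        using supp[of x n] by (cases "x \<in> {a..b + 2}") auto
    qed
    show "AE x in lborel. (\<lambda>n. \<phi> n x *\<^sub>R g x) \<longlonglongrightarrow> indicator {a<..b} x *\<^sub>R g x"
    proof (intro AE_I2 tendsto_scaleR tendsto_const)
      fix x
      have ps: "\<forall>\<^sub>F n in sequentially. pstep (e n) (x - c) = indicator {c<..} x" for c
      proof (cases "x \<le> c")
        case True
        thus ?thesis using e by (auto simp: pstep_left)
      next
        case False
        hence "(x - c) / 2 > 0" by simp
        moreover have "e \<longlonglongrightarrow> 0"
          unfolding e_def by (rule LIMSEQ_Suc[OF lim_1_over_n])
        ultimately have "\<forall>\<^sub>F n in sequentially. e n < (x - c) / 2"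
          by (rule order_tendstoD(2)[rotated])
        thus ?thesis
          by eventually_elim (use False e in \<open>auto intro!: pstep_right simp: field_simps\<close>)
      qed
      have "\<forall>\<^sub>F n in sequentially. \<phi> n x = indicator {a<..b} x"
        using ps[of a] ps[of b]
        by eventually_elim (use ab in \<open>auto simp: \<phi>_def indicator_def\<close>)
      thus "(\<lambda>n. \<phi> n x) \<longlonglongrightarrow> indicator {a<..b} x"
        by (rule tendsto_eventually)
    qed
  qed
  hence "(\<lambda>n. - (LINT x|lborel. \<phi> n x *\<^sub>R g x)) \<longlonglongrightarrow> - (LINT x|lborel. indicator {a<..b} x *\<^sub>R g x)"
    by (rule tendsto_minus)
  from LIMSEQ_unique[OF lim1 this] show ?thesis
    by (metis minus_diff_eq minus_minus)
qed

lemma AE_zero_of_Ioc_integrals: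
  fixes f :: "real \<Rightarrow> complex"
  assumes int: "integrable lborel f"
    and zero: "\<And>a b. (LINT x|lborel. indicator {a<..b} x *\<^sub>R f x) = 0"
  shows "AE x in lborel. f x = 0"
proof (rule sigma_finite_measure.density_zero[OF sigma_finite_lborel int])
  have meas: "B \<in> sigma_sets UNIV (range (\<lambda>(a, b). {a<..b::real})) \<longleftrightarrow> B \<in> sets lborel" for B
    by (simp add: borel_sigma_sets_Ioc)
  have set_int: "set_integrable lborel B f" if "B \<in> sets lborel" for B
    unfolding set_integrable_def by (rule integrable_mult_indicator[OF that int])
  have total: "(LINT x|lborel. f x) = 0"
  proof -
    have "(\<lambda>n. LINT x|lborel. indicator {- real n<..real n} x *\<^sub>R f x) \<longlonglongrightarrow> (LINT x|lborel. f x)"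
    proof (rule integral_dominated_convergence)
      note [measurable] = borel_measurable_integrable[OF int]
      show "f \<in> borel_measurable lborel" "(\<lambda>x. indicator {- real n<..real n} x *\<^sub>R f x) \<in> borel_measurable lborel" for n
        by measurable
      show "integrable lborel (\<lambda>x. norm (f x))"
        using int by simp
      show "AE x in lborel. norm (indicator {- real n<..real n} x *\<^sub>R f x) \<le> norm (f x)" for n
        by (intro AE_I2) (auto simp: indicator_def)
      show "AE x in lborel. (\<lambda>n. indicator {- real n<..real n} x *\<^sub>R f x) \<longlonglongrightarrow> f x"
      proof (intro AE_I2 tendsto_eventually)
        fix x :: real
        have "\<forall>\<^sub>F n :: nat in sequentially. real n > \<bar>x\<bar>"
          using filterlim_real_sequentially by (auto simp: filterlim_at_top_dense)
        thus "\<forall>\<^sub>F n :: nat in sequentially. indicator {- real n<..real n} x *\<^sub>R f x = f x"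
          by eventually_elim (auto simp: indicator_def)
      qed
    qed
    hence "(\<lambda>n :: nat. 0) \<longlonglongrightarrow> (LINT x|lborel. f x)"
      by (simp add: zero)
    thus ?thesis
      by (simp add: LIMSEQ_const_iff)
  qed
  fix A :: "real set"
  assume "A \<in> sets lborel"
  hence A: "A \<in> sigma_sets UNIV (range (\<lambda>(a, b). {a<..b::real}))"
    by (simp add: meas)
  have "Int_stable (range (\<lambda>(a, b). {a<..b::real}))"
    by (auto simp: Int_stable_def)
  moreover have "range (\<lambda>(a, b). {a<..b::real}) \<subseteq> Pow UNIV"
    by simp
  ultimately show "set_lebesgue_integral lborel A f = 0"
    using A
  proof (induction rule: sigma_sets_induct_disjoint)
    case (basic B)
    thus ?case by (auto simp: set_lebesgue_integral_def zero)
  next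
    case empty
    show ?case by (simp add: set_lebesgue_integral_def)
  next
    case (compl B)
    hence "B \<in> sets lborel" by (simp add: meas)
    hence "set_lebesgue_integral lborel (B \<union> (UNIV - B)) f =
        set_lebesgue_integral lborel B f + set_lebesgue_integral lborel (UNIV - B) f"
      by (intro set_integral_Un set_int) auto
    moreover have "B \<union> (UNIV - B) = UNIV" by blast
    ultimately show ?case
      using compl.IH total by (simp add: set_lebesgue_integral_def)
  next
    case (union B)
    hence B: "B i \<in> sets lborel" for i
      using meas by blast
    have "set_lebesgue_integral lborel (\<Union>i. B i) f = (\<Sum>i. set_lebesgue_integral lborel (B i) f)"
      by (rule lebesgue_integral_countable_add)
         (use B union.hyps in \<open>auto simp: disjoint_family_on_def intro!: set_int\<close>)
    thus ?case
      using union.IH by simp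
  qed
qed

lemma weak_deriv_unique:
  assumes u: "continuous_on UNIV u"
    and g: "g \<in> square_integrable" "has_weak_derivative u g"
    and h: "h \<in> square_integrable" "has_weak_derivative u h"
  shows "AE x in lborel. g x = h x"
proof -
  define f where "f x = g x - h x" for x
  have f: "f \<in> square_integrable"
    using sq_int_add[OF g(1) sq_int_cmult[OF h(1), of "-1"]] by (simp add: f_def[abs_def])
  have int: "integrable lborel (\<lambda>x. indicator {a<..b} x *\<^sub>R k x)" if "k \<in> square_integrable" for a b k
  proof -
    have "integrable lborel (\<lambda>x. indicator {a<..b} x *\<^sub>R (indicator {a..b} x *\<^sub>R k x))"
      by (intro integrable_mult_indicator sq_int_integrable_on_Icc that) simp
    also have "(\<lambda>x. indicator {a<..b} x *\<^sub>R (indicator {a..b} x *\<^sub>R k x)) = (\<lambda>x. indicator {a<..b} x *\<^sub>R k x)"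
      by (auto simp: indicator_def)
    finally show ?thesis .
  qed
  have zero: "(LINT x|lborel. indicator {a<..b} x *\<^sub>R f x) = 0" for a b
  proof (cases "a \<le> b")
    case True
    have "(LINT x|lborel. indicator {a<..b} x *\<^sub>R f x) =
        (LINT x|lborel. indicator {a<..b} x *\<^sub>R g x) - (LINT x|lborel. indicator {a<..b} x *\<^sub>R h x)"
      by (subst Bochner_Integration.integral_diff[symmetric])
         (auto simp: f_def scaleR_diff_right int g h)
    thus ?thesis
      using weak_derivative_FTC[OF u g True] weak_derivative_FTC[OF u h True] by simp
  qed simp
  have "AE x in lborel. indicator {- real n<..real n} x *\<^sub>R f x = 0" for n
  proof (rule AE_zero_of_Ioc_integrals)
    show "integrable lborel (\<lambda>x. indicator {- real n<..real n} x *\<^sub>R f x)"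
      by (rule int[OF f])
    fix a b :: real
    have "(\<lambda>x. indicator {a<..b} x *\<^sub>R indicator {- real n<..real n} x *\<^sub>R f x) =
        (\<lambda>x. indicator {max a (- real n)<..min b (real n)} x *\<^sub>R f x)"
      by (auto simp: indicator_def)
    thus "(LINT x|lborel. indicator {a<..b} x *\<^sub>R indicator {- real n<..real n} x *\<^sub>R f x) = 0"
      by (simp only: zero)
  qed
  hence "AE x in lborel. \<forall>n. indicator {- real n<..real n} x *\<^sub>R f x = 0"
    by (simp only: AE_all_countable) blast
  thus ?thesis
  proof (rule AE_mp, intro AE_I2 impI)
    fix x :: real
    assume *: "\<forall>n. indicator {- real n<..real n} x *\<^sub>R f x = 0"
    obtain n :: nat where "\<bar>x\<bar> < real n"
      using reals_Archimedean2 by blast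
    hence "indicator {- real n<..real n} x = (1 :: real)"
      by (auto simp: indicator_def)
    thus "g x = h x"
      using *[rule_format, of n] by (simp add: f_def)
  qed
qed

subsection \<open>Linear structure\<close>

lemma test_function_sq_int:
  assumes "test_function \<phi>"
  shows "(\<lambda>x. complex_of_real (\<phi> x)) \<in> square_integrable"
    and "(\<lambda>x. complex_of_real (deriv \<phi> x)) \<in> square_integrable"
proof -
  obtain D where D: "\<And>x. (\<phi> has_vector_derivative D x) (at x)" "continuous_on UNIV D"
    using assms unfolding test_function_def C1_differentiable_on_def by blast
  have D': "(\<phi> has_real_derivative D x) (at x)" for x
    using D(1)[of x] by (simp only: has_real_derivative_iff_has_vector_derivative)
  hence deriv: "deriv \<phi> = D"
    by (intro ext DERIV_imp_deriv)
  have cont: "continuous_on UNIV \<phi>"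
    by (intro continuous_at_imp_continuous_on ballI DERIV_isCont[OF D'])
  let ?K = "closure {x. \<phi> x \<noteq> 0}"
  have "bounded ?K"
    using assms by (simp add: test_function_def compact_imp_bounded)
  then obtain r where "\<forall>x \<in> ?K. \<bar>x\<bar> \<le> r"
    unfolding bounded_real by blast
  hence r: "?K \<subseteq> {-r..r}"
    by (simp only: subset_iff Ball_def atLeastAtMost_iff abs_le_iff minus_le_iff) simp
  have out: "\<phi> x = 0" if "x \<notin> {-r..r}" for x
  proof (rule ccontr)
    assume "\<phi> x \<noteq> 0"
    hence "x \<in> ?K"
      by (intro subsetD[OF closure_subset] CollectI)
    with r that show False
      by blast
  qed
  have out': "D x = 0" if "x \<notin> {-r..r}" for x
  proof -
    have "(\<phi> has_real_derivative 0) (at x)"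
    proof (rule has_field_derivative_transform_within_open)
      show "((\<lambda>_. 0) has_real_derivative 0) (at x)"
        by (rule DERIV_const)
      show "open (- {-r..r})"
        by (intro open_Compl closed_atLeastAtMost)
      show "x \<in> - {-r..r}"
        using that by blast
      show "0 = \<phi> y" if "y \<in> - {-r..r}" for y
        using out[of y] that by fastforce
    qed
    from DERIV_unique[OF D' this] show ?thesis .
  qed
  have *: "(\<lambda>x. complex_of_real (f x)) \<in> square_integrable"
    if "continuous_on UNIV f" "\<And>x. x \<notin> {-r..r} \<Longrightarrow> f x = 0" for f
  proof -
    have cont_f: "continuous_on UNIV (\<lambda>x. complex_of_real (f x))"
      using that(1) by (rule continuous_on_of_real)
    have "integrable lborel (\<lambda>x. (norm (complex_of_real (f x)))\<^sup>2)"
    proof (rule integrable_continuous_compact)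
      show "continuous_on UNIV (\<lambda>x. (norm (complex_of_real (f x)))\<^sup>2)"
        by (rule continuous_on_power[OF continuous_on_norm[OF cont_f]])
      show "(norm (complex_of_real (f x)))\<^sup>2 = 0" if "x \<notin> {-r..r}" for x
        by (simp add: \<open>\<And>x. x \<notin> {-r..r} \<Longrightarrow> f x = 0\<close>[OF that])
    qed
    moreover have "(\<lambda>x. complex_of_real (f x)) \<in> borel_measurable borel"
      by (rule borel_measurable_continuous_onI[OF cont_f])
    ultimately show ?thesis
      by (simp add: square_integrable_def)
  qed
  show "(\<lambda>x. complex_of_real (\<phi> x)) \<in> square_integrable"
    using cont out by (rule *)
  show "(\<lambda>x. complex_of_real (deriv \<phi> x)) \<in> square_integrable"
    unfolding deriv using D(2) out' by (rule *)
qed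

lemma test_function_integrable:
  assumes "test_function \<phi>" "f \<in> square_integrable"
  shows "integrable lborel (\<lambda>x. \<phi> x *\<^sub>R f x)" "integrable lborel (\<lambda>x. deriv \<phi> x *\<^sub>R f x)"
  using sq_int_mult[OF test_function_sq_int(1)[OF assms(1)] assms(2)]
    sq_int_mult[OF test_function_sq_int(2)[OF assms(1)] assms(2)]
  by (simp_all add: scaleR_conv_of_real)

lemma has_weak_derivative_add:
  assumes w: "has_weak_derivative u g" "has_weak_derivative v h"
    and "u \<in> square_integrable" "g \<in> square_integrable" "v \<in> square_integrable" "h \<in> square_integrable"
  shows "has_weak_derivative (\<lambda>x. u x + v x) (\<lambda>x. g x + h x)"
  unfolding has_weak_derivative_def
proof (intro allI impI)
  fix \<phi>
  assume \<phi>: "test_function \<phi>"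
  have "(LINT x|lborel. deriv \<phi> x *\<^sub>R (u x + v x)) =
      (LINT x|lborel. deriv \<phi> x *\<^sub>R u x) + (LINT x|lborel. deriv \<phi> x *\<^sub>R v x)"
    unfolding scaleR_add_right
    by (intro Bochner_Integration.integral_add test_function_integrable \<phi> assms)
  also have "\<dots> = - ((LINT x|lborel. \<phi> x *\<^sub>R g x) + (LINT x|lborel. \<phi> x *\<^sub>R h x))"
    using w[unfolded has_weak_derivative_def, rule_format, OF \<phi>] by (simp only: minus_add_distrib)
  also have "(LINT x|lborel. \<phi> x *\<^sub>R g x) + (LINT x|lborel. \<phi> x *\<^sub>R h x) =
      (LINT x|lborel. \<phi> x *\<^sub>R (g x + h x))"
    unfolding scaleR_add_right
    by (intro Bochner_Integration.integral_add[symmetric] test_function_integrable \<phi> assms)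
  finally show "(LINT x|lborel. deriv \<phi> x *\<^sub>R (u x + v x)) = - (LINT x|lborel. \<phi> x *\<^sub>R (g x + h x))" .
qed

lemma has_weak_derivative_cmult:
  assumes w: "has_weak_derivative u g"
  shows "has_weak_derivative (\<lambda>x. c * u x) (\<lambda>x. c * g x)"
  unfolding has_weak_derivative_def
proof (intro allI impI)
  fix \<phi>
  assume \<phi>: "test_function \<phi>"
  have "(LINT x|lborel. deriv \<phi> x *\<^sub>R (c * u x)) = c * (LINT x|lborel. deriv \<phi> x *\<^sub>R u x)"
    by (subst integral_mult_right_zero[symmetric]) (simp only: mult_scaleR_right)
  also have "\<dots> = - (c * (LINT x|lborel. \<phi> x *\<^sub>R g x))"
    using w[unfolded has_weak_derivative_def, rule_format, OF \<phi>] by (simp only: mult_minus_right)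
  also have "c * (LINT x|lborel. \<phi> x *\<^sub>R g x) = (LINT x|lborel. \<phi> x *\<^sub>R (c * g x))"
    by (subst integral_mult_right_zero[symmetric]) (simp only: mult_scaleR_right)
  finally show "(LINT x|lborel. deriv \<phi> x *\<^sub>R (c * u x)) = - (LINT x|lborel. \<phi> x *\<^sub>R (c * g x))" .
qed

class complex_normed_vector = real_normed_vector +
  fixes scaleC :: "complex \<Rightarrow> 'a \<Rightarrow> 'a" (infixr "*\<^sub>C" 75)
  assumes scaleC_add_right: "c *\<^sub>C (x + y) = c *\<^sub>C x + c *\<^sub>C y"
    and scaleC_add_left: "(c + d) *\<^sub>C x = c *\<^sub>C x + d *\<^sub>C x"
    and scaleC_scaleC: "c *\<^sub>C d *\<^sub>C x = (c * d) *\<^sub>C x"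
    and scaleR_eq_scaleC: "r *\<^sub>R x = complex_of_real r *\<^sub>C x"
    and norm_scaleC: "norm (c *\<^sub>C x) = norm c * norm x"

lemma h1_cmult_closed:
  "continuous_on UNIV (\<lambda>x. c * h1_fun u x) \<and> (\<lambda>x. c * h1_fun u x) \<in> square_integrable \<and>
   (\<exists>g \<in> square_integrable. has_weak_derivative (\<lambda>x. c * h1_fun u x) g)"
  using h1_continuous[of u] h1_square_integrable[of u] h1_deriv_square_integrable[of u] h1_deriv_weak[of u]
  by (auto intro!: sq_int_cmult has_weak_derivative_cmult bexI[of _ "\<lambda>x. c * h1_deriv u x"]
      continuous_intros)

lemma h1_add_closed:
  "continuous_on UNIV (\<lambda>x. h1_fun u x + h1_fun v x) \<and>
   (\<lambda>x. h1_fun u x + h1_fun v x) \<in> square_integrable \<and>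
   (\<exists>g \<in> square_integrable. has_weak_derivative (\<lambda>x. h1_fun u x + h1_fun v x) g)"
  using h1_continuous h1_square_integrable h1_deriv_square_integrable h1_deriv_weak
  by (auto intro!: sq_int_add has_weak_derivative_add bexI[of _ "\<lambda>x. h1_deriv u x + h1_deriv v x"]
      continuous_intros)

instantiation h1 :: real_vector
begin

definition zero_h1 :: h1 where "0 = Abs_h1 (\<lambda>x. 0)"
definition plus_h1 :: "h1 \<Rightarrow> h1 \<Rightarrow> h1" where "u + v = Abs_h1 (\<lambda>x. h1_fun u x + h1_fun v x)"
definition uminus_h1 :: "h1 \<Rightarrow> h1" where "- u = Abs_h1 (\<lambda>x. (-1) * h1_fun u x)"
definition minus_h1 :: "h1 \<Rightarrow> h1 \<Rightarrow> h1" where "u - v = u + (- v :: h1)"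
definition scaleR_h1 :: "real \<Rightarrow> h1 \<Rightarrow> h1" where
  "r *\<^sub>R u = Abs_h1 (\<lambda>x. complex_of_real r * h1_fun u x)"

lemma h1_fun_add [simp]: "h1_fun (u + v) x = h1_fun u x + h1_fun v x"
  using h1_add_closed[of u v] by (simp add: plus_h1_def Abs_h1_inverse)

lemma h1_fun_zero [simp]: "h1_fun 0 x = 0"
  using h1_cmult_closed[of 0] by (simp add: zero_h1_def Abs_h1_inverse)

lemma h1_fun_uminus [simp]: "h1_fun (- u) x = - h1_fun u x"
  using h1_cmult_closed[of "-1" u] by (simp add: uminus_h1_def Abs_h1_inverse)

lemma h1_fun_minus [simp]: "h1_fun (u - v) x = h1_fun u x - h1_fun v x"
  by (simp add: minus_h1_def)

lemma h1_fun_scaleR [simp]: "h1_fun (r *\<^sub>R u) x = complex_of_real r * h1_fun u x"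
  using h1_cmult_closed[of "complex_of_real r" u] by (simp add: scaleR_h1_def Abs_h1_inverse)

instance
  by standard (auto simp: h1_fun_inject[symmetric] fun_eq_iff algebra_simps)

end

lemma h1_eqI: "(\<And>x. h1_fun u x = h1_fun v x) \<Longrightarrow> u = v"
  by (auto simp: h1_fun_inject[symmetric] fun_eq_iff)

lemma h1_deriv_AE_eq:
  assumes "g \<in> square_integrable" "has_weak_derivative (h1_fun u) g"
  shows "AE x in lborel. h1_deriv u x = g x"
  by (rule weak_deriv_unique[OF h1_continuous h1_deriv_square_integrable h1_deriv_weak assms])

lemma h1_deriv_add: "AE x in lborel. h1_deriv (u + v) x = h1_deriv u x + h1_deriv v x"
proof (rule h1_deriv_AE_eq)
  have eq: "h1_fun (u + v) = (\<lambda>x. h1_fun u x + h1_fun v x)"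
    by (rule ext) simp
  show "has_weak_derivative (h1_fun (u + v)) (\<lambda>x. h1_deriv u x + h1_deriv v x)"
    unfolding eq
    by (rule has_weak_derivative_add)
       (rule h1_deriv_weak h1_square_integrable h1_deriv_square_integrable)+
qed (rule sq_int_add[OF h1_deriv_square_integrable h1_deriv_square_integrable])

lemma h1_deriv_cmult:
  assumes "\<And>x. h1_fun v x = c * h1_fun u x"
  shows "AE x in lborel. h1_deriv v x = c * h1_deriv u x"
proof (rule h1_deriv_AE_eq)
  have eq: "h1_fun v = (\<lambda>x. c * h1_fun u x)"
    using assms by (intro ext)
  show "has_weak_derivative (h1_fun v) (\<lambda>x. c * h1_deriv u x)"
    unfolding eq by (intro has_weak_derivative_cmult h1_deriv_weak)
qed (rule sq_int_cmult[OF h1_deriv_square_integrable])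

lemma h1_deriv_measurable [measurable]: "h1_deriv u \<in> borel_measurable borel"
  and h1_fun_measurable [measurable]: "h1_fun u \<in> borel_measurable borel"
  by (intro sq_int_measurable h1_deriv_square_integrable h1_square_integrable)+

subsection \<open>Norm\<close>

text \<open>The real inner product below is the real part of the Hermitian one; both induce the same norm.\<close>

definition h1_inner :: "h1 \<Rightarrow> h1 \<Rightarrow> real" where
  "h1_inner u v =
     (LINT x|lborel. h1_fun u x \<bullet> h1_fun v x) + (LINT x|lborel. h1_deriv u x \<bullet> h1_deriv v x)"

lemma h1_inner_commute: "h1_inner u v = h1_inner v u"
  by (simp add: h1_inner_def inner_commute)

lemma h1_inner_add: "h1_inner (u + v) w = h1_inner u w + h1_inner v w"
proof -
  have "(LINT x|lborel. h1_deriv (u + v) x \<bullet> h1_deriv w x) =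
      (LINT x|lborel. h1_deriv u x \<bullet> h1_deriv w x + h1_deriv v x \<bullet> h1_deriv w x)"
    using h1_deriv_add[of u v] by (intro integral_cong_AE) (measurable, auto simp: inner_add_left)
  thus ?thesis
    by (simp add: h1_inner_def inner_add_left Bochner_Integration.integral_add sq_int_inner
        h1_square_integrable h1_deriv_square_integrable)
qed

lemma h1_inner_scaleR: "h1_inner (r *\<^sub>R u) w = r * h1_inner u w"
proof -
  have "AE x in lborel. h1_deriv (r *\<^sub>R u) x = complex_of_real r * h1_deriv u x"
    by (rule h1_deriv_cmult) simp
  hence "(LINT x|lborel. h1_deriv (r *\<^sub>R u) x \<bullet> h1_deriv w x) =
      (LINT x|lborel. r * (h1_deriv u x \<bullet> h1_deriv w x))"
    by (intro integral_cong_AE) (measurable, auto simp: scaleR_conv_of_real[symmetric])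
  thus ?thesis
    by (simp add: h1_inner_def scaleR_conv_of_real[symmetric] distrib_left)
qed

lemma h1_inner_nonneg: "h1_inner u u \<ge> 0"
  by (simp add: h1_inner_def)

lemma h1_inner_eq_0: "h1_inner u u = 0 \<longleftrightarrow> u = 0"
proof
  assume "h1_inner u u = 0"
  hence "(LINT x|lborel. h1_fun u x \<bullet> h1_fun u x) = 0"
    unfolding h1_inner_def
    using Bochner_Integration.integral_nonneg[of lborel "\<lambda>x. h1_fun u x \<bullet> h1_fun u x"]
      Bochner_Integration.integral_nonneg[of lborel "\<lambda>x. h1_deriv u x \<bullet> h1_deriv u x"]
    by (simp add: add_nonneg_eq_0_iff)
  hence "AE x in lborel. h1_fun u x \<bullet> h1_fun u x = 0"
    by (subst (asm) integral_nonneg_eq_0_iff_AE)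
       (auto intro!: sq_int_inner h1_square_integrable)
  hence "{x \<in> space lborel. \<not> h1_fun u x = 0} \<in> null_sets lborel"
    by (subst (asm) AE_iff_null) auto
  hence "negligible {x. h1_fun u x \<noteq> 0}"
    by (simp add: negligible_iff_null_sets null_sets_completionI)
  moreover have "open {x. h1_fun u x \<noteq> 0}"
    by (intro open_Collect_neq h1_continuous continuous_on_const)
  ultimately have "{x. h1_fun u x \<noteq> 0} = {}"
    using open_not_negligible by blast
  thus "u = 0"
    by (intro h1_eqI) auto
next
  assume "u = 0"
  thus "h1_inner u u = 0"
    using h1_inner_scaleR[of 0 0 0] by simp
qed

instantiation h1 :: real_inner
begin

definition inner_h1 :: "h1 \<Rightarrow> h1 \<Rightarrow> real" where
  "inner_h1 = h1_inner"
definition norm_h1 :: "h1 \<Rightarrow> real" where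
  "norm_h1 u = sqrt ((LINT x|lborel. (norm (h1_fun u x))\<^sup>2) + (LINT x|lborel. (norm (h1_deriv u x))\<^sup>2))"
definition dist_h1 :: "h1 \<Rightarrow> h1 \<Rightarrow> real" where
  "dist_h1 u v = norm (u - v)"
definition sgn_h1 :: "h1 \<Rightarrow> h1" where
  "sgn_h1 u = u /\<^sub>R norm u"
definition uniformity_h1 :: "(h1 \<times> h1) filter" where
  "uniformity_h1 = (INF e\<in>{0 <..}. principal {(u, v). dist u v < e})"
definition open_h1 :: "h1 set \<Rightarrow> bool" where
  "open_h1 U = (\<forall>u\<in>U. \<forall>\<^sub>F (u', v) in uniformity. u' = u \<longrightarrow> v \<in> U)"

instance
proof
  fix u v w :: h1 and r :: real
  show "u \<bullet> v = v \<bullet> u" "(u + v) \<bullet> w = u \<bullet> w + v \<bullet> w" "(r *\<^sub>R u) \<bullet> v = r * (u \<bullet> v)"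
    "0 \<le> u \<bullet> u" "u \<bullet> u = 0 \<longleftrightarrow> u = 0"
    unfolding inner_h1_def
    by (rule h1_inner_commute h1_inner_add h1_inner_scaleR h1_inner_nonneg h1_inner_eq_0)+
  show "norm u = sqrt (u \<bullet> u)"
    by (simp add: norm_h1_def inner_h1_def h1_inner_def power2_norm_eq_inner)
qed (rule dist_h1_def sgn_h1_def uniformity_h1_def open_h1_def)+

end

instantiation h1 :: complex_normed_vector
begin

definition scaleC_h1 :: "complex \<Rightarrow> h1 \<Rightarrow> h1" where
  "c *\<^sub>C u = Abs_h1 (\<lambda>x. c * h1_fun u x)"

lemma h1_fun_scaleC [simp]: "h1_fun (c *\<^sub>C u) x = c * h1_fun u x"
  using h1_cmult_closed[of c u] by (simp add: scaleC_h1_def Abs_h1_inverse)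

instance
proof
  fix c d :: complex and u v :: h1 and r :: real
  show "c *\<^sub>C (u + v) = c *\<^sub>C u + c *\<^sub>C v" "(c + d) *\<^sub>C u = c *\<^sub>C u + d *\<^sub>C u"
    "c *\<^sub>C d *\<^sub>C u = (c * d) *\<^sub>C u" "r *\<^sub>R u = complex_of_real r *\<^sub>C u"
    by (auto intro!: h1_eqI simp: algebra_simps)
  have "AE x in lborel. h1_deriv (c *\<^sub>C u) x = c * h1_deriv u x"
    by (rule h1_deriv_cmult) simp
  hence "(LINT x|lborel. (norm (h1_deriv (c *\<^sub>C u) x))\<^sup>2) =
      (LINT x|lborel. (norm c)\<^sup>2 * (norm (h1_deriv u x))\<^sup>2)"
    by (intro integral_cong_AE) (measurable, auto simp: norm_mult power_mult_distrib)
  hence "norm (c *\<^sub>C u) = sqrt ((norm c)\<^sup>2 *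
      ((LINT x|lborel. (norm (h1_fun u x))\<^sup>2) + (LINT x|lborel. (norm (h1_deriv u x))\<^sup>2)))"
    by (simp add: norm_h1_def norm_mult power_mult_distrib distrib_left)
  thus "norm (c *\<^sub>C u) = norm c * norm u"
    by (simp add: norm_h1_def real_sqrt_mult)
qed

end

section \<open>The dual space \<open>H\<^sup>-\<^sup>1\<close>\<close>

typedef (overloaded) 'a cdual =
  "{F :: ('a :: complex_normed_vector) \<Rightarrow>\<^sub>L complex. \<forall>c u. blinfun_apply F (c *\<^sub>C u) = c * blinfun_apply F u}"
  by (rule exI[of _ 0]) simp

setup_lifting type_definition_cdual

lift_definition cdual_apply :: "'a :: complex_normed_vector cdual \<Rightarrow> 'a \<Rightarrow> complex" is blinfun_apply .

instantiation cdual :: (complex_normed_vector) real_vector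
begin

lift_definition zero_cdual :: "'a cdual" is 0 by simp
lift_definition plus_cdual :: "'a cdual \<Rightarrow> 'a cdual \<Rightarrow> 'a cdual" is "(+)"
  by (simp add: blinfun.add_left distrib_left)
lift_definition uminus_cdual :: "'a cdual \<Rightarrow> 'a cdual" is uminus
  by (simp add: blinfun.minus_left)
lift_definition minus_cdual :: "'a cdual \<Rightarrow> 'a cdual \<Rightarrow> 'a cdual" is "(-)"
  by (simp add: blinfun.diff_left right_diff_distrib)
lift_definition scaleR_cdual :: "real \<Rightarrow> 'a cdual \<Rightarrow> 'a cdual" is "(*\<^sub>R)"
  by (simp add: blinfun.scaleR_left)

instance
  by standard (transfer; simp add: algebra_simps)+

end

text \<open>The operator norm of a complex-linear functional is the same over the real and the complex
  scalars.\<close>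

instantiation cdual :: (complex_normed_vector) real_normed_vector
begin

lift_definition norm_cdual :: "'a cdual \<Rightarrow> real" is norm .

definition dist_cdual :: "'a cdual \<Rightarrow> 'a cdual \<Rightarrow> real" where
  "dist_cdual F G = norm (F - G)"
definition sgn_cdual :: "'a cdual \<Rightarrow> 'a cdual" where
  "sgn_cdual F = F /\<^sub>R norm F"
definition uniformity_cdual :: "('a cdual \<times> 'a cdual) filter" where
  "uniformity_cdual = (INF e\<in>{0 <..}. principal {(F, G). dist F G < e})"
definition open_cdual :: "'a cdual set \<Rightarrow> bool" where
  "open_cdual U = (\<forall>F\<in>U. \<forall>\<^sub>F (F', G) in uniformity. F' = F \<longrightarrow> G \<in> U)"

instance
proof
  fix F G :: "'a cdual" and r :: real
  show "norm F = 0 \<longleftrightarrow> F = 0" "norm (F + G) \<le> norm F + norm G" "norm (r *\<^sub>R F) = \<bar>r\<bar> * norm F"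
    by (transfer; simp add: norm_triangle_ineq)+
qed (rule dist_cdual_def sgn_cdual_def uniformity_cdual_def open_cdual_def)+

end

instantiation cdual :: (complex_normed_vector) complex_normed_vector
begin

lift_definition scaleC_cdual :: "complex \<Rightarrow> 'a cdual \<Rightarrow> 'a cdual" is
  "\<lambda>c F. blinfun_compose (blinfun_mult_right c) F"
  by simp

instance
proof
  fix F G :: "'a cdual" and c d :: complex and r :: real
  show "c *\<^sub>C (F + G) = c *\<^sub>C F + c *\<^sub>C G" "(c + d) *\<^sub>C F = c *\<^sub>C F + d *\<^sub>C F"
    "c *\<^sub>C d *\<^sub>C F = (c * d) *\<^sub>C F" "r *\<^sub>R F = complex_of_real r *\<^sub>C F"
    by (transfer, rule blinfun_eqI, simp add: blinfun.bilinear_simps algebra_simps scaleR_conv_of_real)+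
  show "norm (c *\<^sub>C F) = norm c * norm F"
  proof transfer
    fix c :: complex and F :: "'a \<Rightarrow>\<^sub>L complex"
    have *: "norm (blinfun_compose (blinfun_mult_right c) F) \<le> norm c * norm F"
      for c :: complex and F :: "'a \<Rightarrow>\<^sub>L complex"
      by (rule norm_blinfun_bound)
         (auto simp: norm_mult mult.assoc intro!: mult_left_mono norm_blinfun)
    show "norm (blinfun_compose (blinfun_mult_right c) F) = norm c * norm F"
    proof (cases "c = 0")
      case True
      thus ?thesis
        using *[of c F] by simp
    next
      case False
      have "F = blinfun_compose (blinfun_mult_right (inverse c)) (blinfun_compose (blinfun_mult_right c) F)"
        using False by (intro blinfun_eqI) simp
      hence "norm F \<le> norm (inverse c) * norm (blinfun_compose (blinfun_mult_right c) F)"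
        using *[of "inverse c" "blinfun_compose (blinfun_mult_right c) F"] by simp
      hence "norm c * norm F \<le> norm (blinfun_compose (blinfun_mult_right c) F)"
        using False by (simp add: norm_divide norm_inverse field_simps)
      thus ?thesis
        using *[of c F] by linarith
    qed
  qed
qed

end

lemma cdual_apply_simps [simp]:
  "cdual_apply 0 u = 0" "cdual_apply (F + G) u = cdual_apply F u + cdual_apply G u"
  "cdual_apply (- F) u = - cdual_apply F u" "cdual_apply (F - G) u = cdual_apply F u - cdual_apply G u"
  "cdual_apply (c *\<^sub>C F) u = c * cdual_apply F u"
  by (transfer; simp add: blinfun.bilinear_simps)+

text \<open>The functional given by a bounded complex-linear function; meaningless for other functions.\<close>

definition cdual_of :: "('a :: complex_normed_vector \<Rightarrow> complex) \<Rightarrow> 'a cdual" where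
  "cdual_of f = Abs_cdual (Blinfun f)"

lemma cdual_apply_of:
  assumes add: "\<And>u v. f (u + v) = f u + f v" and scale: "\<And>c u. f (c *\<^sub>C u) = c * f u"
    and bound: "\<And>u. norm (f u) \<le> K * norm u"
  shows "cdual_apply (cdual_of f) = f"
proof -
  have "bounded_linear f"
    by (rule bounded_linear_intro[of f K])
       (use assms in \<open>auto simp: scaleR_eq_scaleC scaleR_conv_of_real mult.commute\<close>)
  thus ?thesis
    by (simp add: cdual_of_def cdual_apply.rep_eq Abs_cdual_inverse bounded_linear_Blinfun_apply scale)
qed

type_synonym hm1 = "h1 cdual"

lemma h1_L2_le_norm: "sqrt (LINT x|lborel. (norm (h1_fun u x))\<^sup>2) \<le> norm u"
  and h1_deriv_L2_le_norm: "sqrt (LINT x|lborel. (norm (h1_deriv u x))\<^sup>2) \<le> norm u"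
  by (auto simp: norm_h1_def)

lemma L2_product_bound:
  assumes "f \<in> square_integrable" "g \<in> square_integrable"
    and "sqrt (LINT x|lborel. (norm (f x))\<^sup>2) \<le> A" "sqrt (LINT x|lborel. (norm (g x))\<^sup>2) \<le> B"
  shows "norm (LINT x|lborel. f x * g x) \<le> A * B"
proof -
  have "norm (LINT x|lborel. f x * g x) \<le> (LINT x|lborel. norm (f x * g x))"
    by (rule integral_norm_bound)
  also have "\<dots> \<le> sqrt (LINT x|lborel. (norm (f x))\<^sup>2) * sqrt (LINT x|lborel. (norm (g x))\<^sup>2)"
    using sq_int_Cauchy_Schwarz[OF assms(1,2)] by (simp add: norm_mult)
  also have "\<dots> \<le> A * B"
    by (intro mult_mono assms order_trans[OF _ assms(3)]) auto
  finally show ?thesis .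
qed

text \<open>The inclusion \<open>H\<^sup>1 \<subset> H\<^sup>-\<^sup>1\<close> and the pairing \<open>\<langle>F, v\<rangle>\<close> are bilinear, as for distributions.\<close>

definition h1_embed :: "h1 \<Rightarrow> hm1" where
  "h1_embed u = cdual_of (\<lambda>v. LINT x|lborel. h1_fun u x * h1_fun v x)"

definition dirichlet_op :: "h1 \<Rightarrow> hm1" where
  "dirichlet_op u = cdual_of (\<lambda>v. LINT x|lborel. h1_deriv u x * h1_deriv v x)"

definition dirac :: "real \<Rightarrow> hm1" where
  "dirac a = cdual_of (\<lambda>v. h1_fun v a)"

lemma h1_embed_apply: "cdual_apply (h1_embed u) v = (LINT x|lborel. h1_fun u x * h1_fun v x)"
proof -
  have "cdual_apply (h1_embed u) = (\<lambda>v. LINT x|lborel. h1_fun u x * h1_fun v x)"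
    unfolding h1_embed_def
  proof (rule cdual_apply_of[where K = "norm u"])
    show "norm (LINT x|lborel. h1_fun u x * h1_fun v x) \<le> norm u * norm v" for v
      by (intro L2_product_bound h1_square_integrable h1_L2_le_norm)
  qed (simp_all add: distrib_left mult.left_commute Bochner_Integration.integral_add sq_int_mult h1_square_integrable)
  thus ?thesis by simp
qed

lemma dirichlet_op_apply: "cdual_apply (dirichlet_op u) v = (LINT x|lborel. h1_deriv u x * h1_deriv v x)"
proof -
  have "cdual_apply (dirichlet_op u) = (\<lambda>v. LINT x|lborel. h1_deriv u x * h1_deriv v x)"
    unfolding dirichlet_op_def
  proof (rule cdual_apply_of[where K = "norm u"])
    show "norm (LINT x|lborel. h1_deriv u x * h1_deriv v x) \<le> norm u * norm v" for v
      by (intro L2_product_bound h1_deriv_square_integrable h1_deriv_L2_le_norm)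
  next
    fix v w
    have "(LINT x|lborel. h1_deriv u x * h1_deriv (v + w) x) =
        (LINT x|lborel. h1_deriv u x * h1_deriv v x + h1_deriv u x * h1_deriv w x)"
      using h1_deriv_add[of v w] by (intro integral_cong_AE) (measurable, auto simp: distrib_left)
    thus "(LINT x|lborel. h1_deriv u x * h1_deriv (v + w) x) =
        (LINT x|lborel. h1_deriv u x * h1_deriv v x) + (LINT x|lborel. h1_deriv u x * h1_deriv w x)"
      by (simp add: Bochner_Integration.integral_add sq_int_mult h1_deriv_square_integrable)
  next
    fix c v
    have "AE x in lborel. h1_deriv (c *\<^sub>C v) x = c * h1_deriv v x"
      by (rule h1_deriv_cmult) simp
    hence "(LINT x|lborel. h1_deriv u x * h1_deriv (c *\<^sub>C v) x) =
        (LINT x|lborel. c * (h1_deriv u x * h1_deriv v x))"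
      by (intro integral_cong_AE) (measurable, auto simp: mult.left_commute)
    thus "(LINT x|lborel. h1_deriv u x * h1_deriv (c *\<^sub>C v) x) = c * (LINT x|lborel. h1_deriv u x * h1_deriv v x)"
      by simp
  qed
  thus ?thesis by simp
qed

lemma sobolev_pointwise: "norm (h1_fun u a) \<le> 2 * norm u"
proof -
  let ?I = "indicator {a..a + 1} :: real \<Rightarrow> complex"
  have I: "(LINT x|lborel. (norm (?I x))\<^sup>2) = 1"
  proof -
    have "(\<lambda>x. (norm (?I x))\<^sup>2) = indicat_real {a..a + 1}"
      by (auto simp: indicator_def)
    thus ?thesis by simp
  qed
  have int: "integrable lborel (\<lambda>x. norm (?I x) * norm (f x))" if "f \<in> square_integrable" for f
    by (intro sq_int_norm_mult sq_int_indicator that)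
  have le: "(LINT x|lborel. norm (?I x) * norm (f x)) \<le> K"
    if "f \<in> square_integrable" "sqrt (LINT x|lborel. (norm (f x))\<^sup>2) \<le> K" for f K
    using sq_int_Cauchy_Schwarz[OF sq_int_indicator[of a "a + 1"] that(1)] that(2)
    unfolding I by simp
  let ?G = "LINT x|lborel. norm (?I x) * norm (h1_deriv u x)"
  have pt: "norm (h1_fun u a) \<le> norm (h1_fun u x) + ?G" if "x \<in> {a..a + 1}" for x
  proof -
    have "norm (h1_fun u x - h1_fun u a) \<le> (LINT y|lborel. norm (indicat_real {a<..x} y *\<^sub>R h1_deriv u y))"
      using that weak_derivative_FTC[OF h1_continuous h1_deriv_square_integrable h1_deriv_weak, of a x u]
      by (simp only: integral_norm_bound atLeastAtMost_iff)
    also have "\<dots> \<le> ?G"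
    proof (rule integral_mono')
      show "integrable lborel (\<lambda>x. norm (?I x) * norm (h1_deriv u x))"
        by (rule int[OF h1_deriv_square_integrable])
    qed (use that in \<open>auto simp: indicator_def\<close>)
    finally show ?thesis
      using norm_triangle_sub[of "h1_fun u a" "h1_fun u x"] norm_minus_commute[of "h1_fun u a" "h1_fun u x"]
      by linarith
  qed
  have "norm (h1_fun u a) = (LINT x|lborel. indicat_real {a..a + 1} x * norm (h1_fun u a))"
    by simp
  also have "\<dots> \<le> (LINT x|lborel. norm (?I x) * norm (h1_fun u x) + indicat_real {a..a + 1} x * ?G)"
  proof (rule integral_mono)
    show "integrable lborel (\<lambda>x. indicat_real {a..a + 1} x * norm (h1_fun u a))"
      by simp
    show "integrable lborel (\<lambda>x. norm (?I x) * norm (h1_fun u x) + indicat_real {a..a + 1} x * ?G)"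
      by (intro Bochner_Integration.integrable_add int h1_square_integrable) simp
    show "indicat_real {a..a + 1} x * norm (h1_fun u a)
        \<le> norm (?I x) * norm (h1_fun u x) + indicat_real {a..a + 1} x * ?G" for x
      using pt[of x] by (cases "x \<in> {a..a + 1}") (auto simp del: atLeastAtMost_iff)
  qed
  also have "\<dots> = (LINT x|lborel. norm (?I x) * norm (h1_fun u x)) + ?G"
    by (subst Bochner_Integration.integral_add) (auto intro!: int h1_square_integrable)
  also have "\<dots> \<le> norm u + norm u"
    by (intro add_mono le h1_square_integrable h1_deriv_square_integrable h1_L2_le_norm h1_deriv_L2_le_norm)
  finally show ?thesis by simp
qed

lemma dirac_apply: "cdual_apply (dirac a) v = h1_fun v a"
proof -
  have "cdual_apply (dirac a) = (\<lambda>v. h1_fun v a)"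
    unfolding dirac_def by (rule cdual_apply_of[where K = 2]) (simp_all add: sobolev_pointwise)
  thus ?thesis by simp
qed

section \<open>Spectra of unbounded operators\<close>

text \<open>
  An operator in \<open>X\<close>, defined on a subspace of \<open>X\<close>, is represented by its graph
  \<open>{(x, T x) | x \<in> dom T}\<close>. The estimate in the resolvent set makes \<open>z - T\<close> injective and its
  inverse bounded.
\<close>

type_synonym 'a operator = "('a \<times> 'a) set"

definition resolvent_set :: "'a :: complex_normed_vector operator \<Rightarrow> complex set" where
  "resolvent_set T = {z. {z *\<^sub>C x - y | x y. (x, y) \<in> T} = UNIV \<and>
     (\<exists>C. \<forall>(x, y) \<in> T. norm x \<le> C * norm (z *\<^sub>C x - y))}"

definition spectrum :: "'a :: complex_normed_vector operator \<Rightarrow> complex set" where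
  "spectrum T = - resolvent_set T"

definition point_spectrum :: "'a :: complex_normed_vector operator \<Rightarrow> complex set" where
  "point_spectrum T = {z. \<exists>x. x \<noteq> 0 \<and> (x, z *\<^sub>C x) \<in> T}"

definition continuous_spectrum :: "'a :: complex_normed_vector operator \<Rightarrow> complex set" where
  "continuous_spectrum T = {z \<in> spectrum T - point_spectrum T.
     closure {z *\<^sub>C x - y | x y. (x, y) \<in> T} = UNIV}"

section \<open>The operators \<open>A\<^sub>\<beta>\<close>\<close>

definition A_op :: "real \<Rightarrow> real \<Rightarrow> h1 \<Rightarrow> hm1" where
  "A_op x0 \<beta> u = dirichlet_op u + (complex_of_real \<beta> * h1_fun u x0) *\<^sub>C dirac 0"

text \<open>
  Replacing \<open>x\<close> by \<open>x / x0\<close> turns the parameters \<open>(x0, \<beta>)\<close> into \<open>(1, \<beta> x0)\<close> and multiplies the spectrum by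
  \<open>x0\<^sup>2\<close>. Critical values of \<open>\<beta>\<close> therefore have the form \<open>b / x0\<close>, where \<open>b\<close> is the critical value for
  \<open>x0 = 1\<close>.
\<close>

definition neg_A :: "real \<Rightarrow> real \<Rightarrow> hm1 operator" where
  "neg_A x0 \<beta> = {(h1_embed u, - A_op x0 \<beta> u) | u. True}"

end

theory Submission
  imports Defs "HOL-Real_Asymp.Real_Asymp"
begin

text \<open>
  Off the half-line \<open>{..0}\<close> a spectral parameter can be written \<open>z = s\<^sup>2\<close> with \<open>Re s > 0\<close>. There the operator
  \<open>u \<mapsto> s\<^sup>2 u - u''\<close> from \<open>H\<^sup>1\<close> to its dual becomes coercive after multiplication by \<open>cnj s\<close>, hence is an isomorphism,
  and the preimage of \<open>\<delta>\<^sub>0\<close> is the Green function \<open>exp (- s \<bar>x\<bar>) / (2 s)\<close>. The term \<open>\<beta> u(x0) \<delta>\<^sub>0\<close> is a perturbation of rank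
  one, so \<open>s\<^sup>2\<close> is an eigenvalue if \<open>2 s + \<beta> exp (- s x0) = 0\<close> and lies in the resolvent set otherwise
  (\<open>eigenvalue_iff\<close>, \<open>resolvent_of_char_fun\<close>).
  
  On the half-line solutions of \<open>w'' = z w\<close> oscillate or are affine, so the equation \<open>z w - w'' = c \<delta>\<^sub>a\<close> has only the
  solution \<open>w = 0\<close> in \<open>H\<^sup>1\<close> (\<open>no_solution_nonpositive\<close>). Consequently there are no eigenvalues on it, \<open>\<delta>\<^sub>0\<close> is not in
  the range of \<open>z + A\<^sub>\<beta>\<close>, and the same fact for the adjoint equation makes this range dense. The half-line is thus
  the continuous spectrum for every \<open>\<beta>\<close> (\<open>continuous_spectrum_eq\<close>).
  
  What remains is the scalar equation. With \<open>t = s x0 = p + \<i> q\<close> and \<open>b = \<beta> x0\<close>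
  it reads \<open>2 t + b exp (- t) = 0\<close>. For positive \<open>b\<close>, \<open>p\<close> and
  \<open>q\<close> its real and imaginary parts say that \<open>sin q > 0\<close>, \<open>cos q < 0\<close>,
  \<open>p = - q cot q\<close> and \<open>b = (2 q / sin q) exp (- q cot q)\<close>. The sign conditions leave the
  intervals from \<open>(2 k + 1/2) \<pi>\<close> to \<open>(2 k + 1) \<pi>\<close>, and on each of them
  \<open>b\<close> increases from \<open>(4 k + 1) \<pi>\<close> to infinity. So for \<open>b > (4 k + 1)
  \<pi>\<close> there is exactly one \<open>k\<close>-th eigenvalue \<open>(t / x0)\<^sup>2\<close> in the upper
  half-plane, and it depends continuously on \<open>b\<close> (\<open>point_spectrum_branches\<close>). At the
  threshold \<open>p\<close> tends to 0, which puts
  the limit on the negative half-line. The real part has the sign of \<open>p - q\<close>; it vanishes exactly at \<open>q = (2 k + 3/4) \<pi>\<close>,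
  which gives the crossing couplings, and from there on \<open>p \<ge> q\<close> bounds the imaginary part from below.
\<close>

section \<open>Completeness and quadratic minimisation\<close>

text \<open>
  The minimiser of \<open>v \<bullet> v - 2 * f v\<close> over \<open>S\<close>, whose Euler equation is the asserted identity. For \<open>S = UNIV\<close> this
  is the Riesz representation of \<open>f\<close>; for \<open>f v = w \<bullet> v\<close> it is the orthogonal projection of \<open>w\<close> onto the closure
  of \<open>S\<close>.
\<close>

lemma variational_solution:
  fixes S :: "'a :: {real_inner, complete_space} set" and f :: "'a \<Rightarrow> real"
  assumes S: "subspace S" and f: "bounded_linear f"
  obtains u where "u \<in> closure S" "\<And>v. v \<in> S \<Longrightarrow> u \<bullet> v = f v"
proof -
  interpret f: bounded_linear f by (rule f)
  define J where "J v = v \<bullet> v - 2 * f v" for v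
  obtain K where K: "\<And>v. norm (f v) \<le> norm v * K"
    using f.bounded by blast
  have J_lower: "- K\<^sup>2 \<le> J v" for v
  proof -
    have "f v \<le> norm v * K" using K[of v] by auto
    moreover have "0 \<le> (norm v - K)\<^sup>2" by simp
    ultimately show ?thesis
      by (simp add: J_def dot_square_norm power2_diff)
  qed
  define m where "m = Inf (J ` S)"
  have m_le: "m \<le> J v" if "v \<in> S" for v
    unfolding m_def using that by (intro cInf_lower bdd_belowI2[of S "- K\<^sup>2" J] imageI J_lower)
  have "\<exists>v \<in> S. J v < m + e" if "e > 0" for e
  proof -
    have "S \<noteq> {}" using subspace_0[OF S] by blast
    hence "Inf (J ` S) < m + e" using that by (simp add: m_def)
    thus ?thesis
      using cInf_lessD[of "J ` S" "m + e"] \<open>S \<noteq> {}\<close> by auto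
  qed
  hence "\<forall>n :: nat. \<exists>v \<in> S. J v < m + inverse (Suc n)" by simp
  then obtain U where U: "\<And>n. U n \<in> S" "\<And>n. J (U n) < m + inverse (real (Suc n))"
    by metis
  \<comment> \<open>The parallelogram law turns almost minimality of two values into closeness of the points.\<close>
  have close: "(norm (v - w))\<^sup>2 \<le> 2 * (J v - m) + 2 * (J w - m)" if "v \<in> S" "w \<in> S" for v w
  proof -
    define c where "c = (1 / 2) *\<^sub>R (v + w)"
    have "c \<in> S"
      unfolding c_def using S that by (intro subspace_scale subspace_add)
    hence "m \<le> J c" by (rule m_le)
    moreover have "(norm (v - w))\<^sup>2 = 2 * J v + 2 * J w - 4 * J c"
      by (simp add: J_def c_def power2_norm_eq_inner inner_diff_left inner_diff_right inner_add_left
          inner_add_right f.add f.scaleR inner_commute[of w v] algebra_simps)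
    ultimately show ?thesis by (simp add: algebra_simps)
  qed
  have "Cauchy U"
  proof (rule metric_CauchyI)
    fix e :: real assume "e > 0"
    then obtain N :: nat where N: "inverse (real (Suc N)) < e\<^sup>2 / 4"
      using reals_Archimedean[of "e\<^sup>2 / 4"] by auto
    have *: "J (U n) - m < e\<^sup>2 / 4" if "n \<ge> N" for n
    proof -
      have "inverse (real (Suc n)) \<le> inverse (real (Suc N))"
        using that by (intro le_imp_inverse_le) auto
      thus ?thesis using U(2)[of n] N by linarith
    qed
    hence "(norm (U n - U k))\<^sup>2 < e\<^sup>2" if "n \<ge> N" "k \<ge> N" for n k
      using close[OF U(1) U(1), of n k] that(1)[THEN *] that(2)[THEN *] by (simp add: algebra_simps)
    thus "\<exists>N. \<forall>n\<ge>N. \<forall>k\<ge>N. dist (U n) (U k) < e"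
      using \<open>e > 0\<close> by (auto simp: dist_norm intro!: exI[of _ N] power2_less_imp_less[of _ e])
  qed
  then obtain u where u: "U \<longlonglongrightarrow> u"
    by (auto simp: Cauchy_convergent_iff convergent_def)
  have J_lim: "(\<lambda>n. J (U n + w)) \<longlonglongrightarrow> J (u + w)" for w
    unfolding J_def using u by (intro tendsto_intros f.tendsto)
  have "(\<lambda>n. m + inverse (real (Suc n))) \<longlonglongrightarrow> m + 0"
    by (intro tendsto_intros LIMSEQ_inverse_real_of_nat)
  hence J_u: "J u \<le> m"
    using J_lim[of 0] U(2) by (intro LIMSEQ_le[of "\<lambda>n. J (U n)" "J u"]) (auto intro: less_imp_le)
  show ?thesis
  proof
    show "u \<in> closure S"
      using u U(1) by (auto simp: closure_sequential)
    fix v assume v: "v \<in> S"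
    define d where "d = u \<bullet> v - f v"
    have ge: "0 \<le> 2 * t * d + t\<^sup>2 * (v \<bullet> v)" for t
    proof -
      have "m \<le> J (u + t *\<^sub>R v)"
      proof (rule LIMSEQ_le_const[OF J_lim], intro exI[of _ 0] allI impI)
        show "m \<le> J (U n + t *\<^sub>R v)" for n
          using S U(1) v by (intro m_le subspace_add subspace_scale)
      qed
      also have "J (u + t *\<^sub>R v) = J u + (2 * t * d + t\<^sup>2 * (v \<bullet> v))"
        by (simp add: J_def d_def inner_add_left inner_add_right f.add f.scaleR inner_commute[of v u]
            power2_eq_square algebra_simps)
      finally show ?thesis using J_u by linarith
    qed
    have "d = 0"
    proof (rule ccontr)
      assume "d \<noteq> 0"
      \<comment> \<open>With \<open>t = - r * d\<close> and \<open>r\<close> this small, the linear term of the expansion in \<open>t\<close> outweighs the quadratic one.\<close>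
      define r where "r = 1 / (1 + v \<bullet> v)"
      have r: "r > 0" "r * (v \<bullet> v) < 1"
        by (auto simp: r_def field_simps add_pos_nonneg intro!: divide_pos_pos add_pos_nonneg)
      have "2 * (- r * d) * d + (- r * d)\<^sup>2 * (v \<bullet> v) = (r * d\<^sup>2) * (r * (v \<bullet> v) - 2)"
        by (simp add: power2_eq_square algebra_simps)
      also have "\<dots> < 0"
        using r \<open>d \<noteq> 0\<close> by (intro mult_pos_neg) auto
      finally show False using ge[of "- r * d"] by linarith
    qed
    thus "u \<bullet> v = f v" by (simp add: d_def)
  qed
qed

lemma sq_int_minus:
  assumes "f \<in> square_integrable" "g \<in> square_integrable"
  shows "(\<lambda>x. f x - g x) \<in> square_integrable"
  using sq_int_add[OF assms(1) sq_int_cmult[OF assms(2), of "-1"]] by simp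

text \<open>
  The Riesz-Fischer theorem. Along a rapidly convergent subsequence the increments, squared and weighted
  by \<open>4 ^ k\<close>, have a finite total integral. Hence almost everywhere they are eventually below \<open>(1 / 2) ^ k\<close>,
  and the subsequence converges there. Fatou's lemma turns this into convergence in mean square.
\<close>

lemma square_integrable_complete:
  fixes f :: "nat \<Rightarrow> real \<Rightarrow> complex"
  assumes f: "\<And>n. f n \<in> square_integrable"
    and Cauchy: "\<And>e. e > 0 \<Longrightarrow>
      \<exists>N. \<forall>m\<ge>N. \<forall>n\<ge>N. (LINT x|lborel. (norm (f m x - f n x))\<^sup>2) < e"
  obtains g r where "g \<in> square_integrable" "strict_mono (r :: nat \<Rightarrow> nat)"
    "AE x in lborel. (\<lambda>n. f (r n) x) \<longlonglongrightarrow> g x"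
    "(\<lambda>n. LINT x|lborel. (norm (f n x - g x))\<^sup>2) \<longlonglongrightarrow> 0"
proof -
  have [measurable]: "f n \<in> borel_measurable borel" for n
    by (rule sq_int_measurable[OF f])
  define E where "E m n = (LINT x|lborel. (norm (f m x - f n x))\<^sup>2)" for m n
  have nn_E: "(\<integral>\<^sup>+x. ennreal ((norm (f m x - f n x))\<^sup>2) \<partial>lborel) = ennreal (E m n)" for m n
    unfolding E_def by (rule nn_integral_eq_integral[OF sq_int_integrable[OF sq_int_minus[OF f f]]]) simp
  have E_nonneg: "E m n \<ge> 0" for m n
    by (simp add: E_def)
  have "\<forall>k. \<exists>N. \<forall>m\<ge>N. \<forall>n\<ge>N. E m n < (1 / 8) ^ k"
    using Cauchy unfolding E_def by simp
  then obtain N where N: "\<And>k m n. m \<ge> N k \<Longrightarrow> n \<ge> N k \<Longrightarrow> E m n < (1 / 8) ^ k"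
    by metis
  \<comment> \<open>Dominates every \<open>N k\<close>; the summand \<open>k\<close> makes it strictly increasing.\<close>
  define r where "r k = (\<Sum>i\<le>k. N i) + k" for k
  have r_mono: "strict_mono r"
    by (rule strict_mono_Suc_iff[THEN iffD2]) (simp add: r_def)
  have r_ge: "N k \<le> r k" for k
  proof -
    have "N k \<le> (\<Sum>i\<le>k. N i)" by (rule member_le_sum) auto
    thus ?thesis by (simp add: r_def)
  qed
  define d where "d k x = norm (f (r (Suc k)) x - f (r k) x)" for k x
  have nn_d: "(\<integral>\<^sup>+x. ennreal (4 ^ k * (d k x)\<^sup>2) \<partial>lborel) \<le> ennreal ((1 / 2) ^ k)" for k
  proof -
    have "r k \<le> r (Suc k)" using r_mono by (simp add: strict_mono_Suc_iff less_imp_le)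
    hence "E (r (Suc k)) (r k) < (1 / 8) ^ k"
      using r_ge[of k] by (intro N) auto
    have "(\<integral>\<^sup>+x. ennreal (4 ^ k * (d k x)\<^sup>2) \<partial>lborel) =
        (\<integral>\<^sup>+x. ennreal (4 ^ k) * ennreal ((norm (f (r (Suc k)) x - f (r k) x))\<^sup>2) \<partial>lborel)"
      by (simp add: d_def ennreal_mult)
    also have "\<dots> = ennreal (4 ^ k) * ennreal (E (r (Suc k)) (r k))"
      by (subst nn_integral_cmult) (simp_all add: nn_E)
    also have "\<dots> = ennreal (4 ^ k * E (r (Suc k)) (r k))"
      by (simp add: ennreal_mult E_nonneg)
    also have "\<dots> \<le> ennreal (4 ^ k * (1 / 8) ^ k)"
      using \<open>E (r (Suc k)) (r k) < (1 / 8) ^ k\<close> by (intro ennreal_leI mult_left_mono) auto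
    also have "4 ^ k * (1 / 8) ^ k = (1 / 2 :: real) ^ k"
      by (simp add: power_mult_distrib[symmetric])
    finally show ?thesis .
  qed
  have "(\<integral>\<^sup>+x. (\<Sum>k. ennreal (4 ^ k * (d k x)\<^sup>2)) \<partial>lborel) =
      (\<Sum>k. \<integral>\<^sup>+x. ennreal (4 ^ k * (d k x)\<^sup>2) \<partial>lborel)"
    unfolding d_def by (rule nn_integral_suminf) measurable
  also have "\<dots> \<le> (\<Sum>k. ennreal ((1 / 2) ^ k))"
    by (intro suminf_le nn_d) auto
  also have "\<dots> = ennreal (\<Sum>k. (1 / 2) ^ k)"
    by (intro suminf_ennreal2 summable_geometric) auto
  also have "\<dots> < \<infinity>" by simp
  finally have "AE x in lborel. (\<Sum>k. ennreal (4 ^ k * (d k x)\<^sup>2)) \<noteq> \<infinity>"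
    unfolding d_def by (intro nn_integral_noteq_infinite) auto
  hence conv: "AE x in lborel. convergent (\<lambda>k. f (r k) x)"
  proof (eventually_elim)
    case (elim x)
    have *: "summable (\<lambda>k. 4 ^ k * (d k x)\<^sup>2)"
      using elim by (intro summable_suminf_not_top) auto
    hence "(\<lambda>k. 4 ^ k * (d k x)\<^sup>2) \<longlonglongrightarrow> 0"
      by (rule summable_LIMSEQ_zero)
    hence "\<forall>\<^sub>F k in sequentially. 4 ^ k * (d k x)\<^sup>2 < 1"
      by (rule order_tendstoD) simp
    hence "\<forall>\<^sub>F k in sequentially. norm (f (r (Suc k)) x - f (r k) x) \<le> (1 / 2) ^ k"
    proof eventually_elim
      case (elim k)
      have "(2 ^ k * d k x)\<^sup>2 = 4 ^ k * (d k x)\<^sup>2"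
        by (simp add: power_mult_distrib power_mult[symmetric] mult.commute[of k 2])
           (simp add: power_mult)
      hence "(2 ^ k * d k x)\<^sup>2 \<le> 1\<^sup>2" using elim by simp
      hence "2 ^ k * d k x \<le> 1" by (rule power2_le_imp_le) simp
      thus ?case by (simp add: d_def field_simps power_divide)
    qed
    hence "summable (\<lambda>k. f (r (Suc k)) x - f (r k) x)"
      by (rule summable_comparison_test_ev) (simp add: summable_geometric)
    hence "convergent (\<lambda>n. \<Sum>k<n. f (r (Suc k)) x - f (r k) x)"
      by (simp only: summable_iff_convergent)
    hence "convergent (\<lambda>n. f (r n) x - f (r 0) x)"
      using sum_lessThan_telescope[of "\<lambda>k. f (r k) x"] by simp
    hence "convergent (\<lambda>n. f (r n) x - f (r 0) x + f (r 0) x)"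
      by (intro convergent_add convergent_const)
    thus ?case by simp
  qed
  define g where "g x = lim (\<lambda>k. f (r k) x)" for x
  have [measurable]: "g \<in> borel_measurable borel"
    unfolding g_def by (rule borel_measurable_lim_metric) simp
  have lim: "AE x in lborel. (\<lambda>k. f (r k) x) \<longlonglongrightarrow> g x"
    using conv by eventually_elim (simp add: g_def convergent_LIMSEQ_iff)
  have fatou: "(\<integral>\<^sup>+x. ennreal ((norm (f n x - g x))\<^sup>2) \<partial>lborel) \<le> ennreal e"
    if e: "e > 0" "\<And>m. m \<ge> M \<Longrightarrow> E n m < e" for e n M
  proof -
    have "(\<integral>\<^sup>+x. ennreal ((norm (f n x - g x))\<^sup>2) \<partial>lborel) =
        (\<integral>\<^sup>+x. liminf (\<lambda>k. ennreal ((norm (f n x - f (r k) x))\<^sup>2)) \<partial>lborel)"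
    proof (rule nn_integral_cong_AE, use lim in eventually_elim)
      case (elim x)
      hence "(\<lambda>k. ennreal ((norm (f n x - f (r k) x))\<^sup>2)) \<longlonglongrightarrow> ennreal ((norm (f n x - g x))\<^sup>2)"
        by (intro tendsto_ennrealI tendsto_intros)
      thus ?case by (rule lim_imp_Liminf[symmetric, rotated]) simp
    qed
    also have "\<dots> \<le> liminf (\<lambda>k. \<integral>\<^sup>+x. ennreal ((norm (f n x - f (r k) x))\<^sup>2) \<partial>lborel)"
      by (rule nn_integral_liminf) measurable
    also have "\<dots> = liminf (\<lambda>k. ennreal (E n (r k)))"
      by (simp only: nn_E)
    also have "\<dots> \<le> ennreal e"
    proof (rule Liminf_le)
      show "\<forall>\<^sub>F k in sequentially. ennreal (E n (r k)) \<le> ennreal e"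
        using eventually_ge_at_top[of M]
      proof eventually_elim
        case (elim k)
        have "M \<le> r k" using elim strict_mono_imp_increasing[OF r_mono, of k] by linarith
        thus ?case using e(2)[of "r k"] by (intro ennreal_leI) simp
      qed
    qed simp
    finally show ?thesis .
  qed
  have sq: "(\<lambda>x. f n x - g x) \<in> square_integrable" "(LINT x|lborel. (norm (f n x - g x))\<^sup>2) \<le> e"
    if e: "e > 0" "\<And>m. m \<ge> M \<Longrightarrow> E n m < e" for e n M
  proof -
    note le = fatou[OF e]
    have i: "integrable lborel (\<lambda>x. (norm (f n x - g x))\<^sup>2)"
    proof (rule integrableI_bounded)
      show "(\<integral>\<^sup>+x. ennreal (norm ((norm (f n x - g x))\<^sup>2)) \<partial>lborel) < \<infinity>"
        using le_less_trans[OF le ennreal_less_top] by simp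
    qed measurable
    thus "(\<lambda>x. f n x - g x) \<in> square_integrable"
      by (simp add: square_integrable_def)
    have "ennreal (LINT x|lborel. (norm (f n x - g x))\<^sup>2) \<le> ennreal e"
      using le nn_integral_eq_integral[OF i] by simp
    thus "(LINT x|lborel. (norm (f n x - g x))\<^sup>2) \<le> e"
      using e(1) by (simp add: ennreal_le_iff)
  qed
  show ?thesis
  proof
    have "(\<lambda>x. f (N 0) x - (f (N 0) x - g x)) \<in> square_integrable"
      by (rule sq_int_minus[OF f sq(1)[of 1 "N 0"]]) (use N[of 0] in auto)
    thus "g \<in> square_integrable" by simp
    show "strict_mono r" by (rule r_mono)
    show "AE x in lborel. (\<lambda>n. f (r n) x) \<longlonglongrightarrow> g x" by (rule lim)
    show "(\<lambda>n. LINT x|lborel. (norm (f n x - g x))\<^sup>2) \<longlonglongrightarrow> 0"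
    proof (rule metric_LIMSEQ_I)
      fix e :: real assume "e > 0"
      then obtain M where M: "\<forall>m\<ge>M. \<forall>n\<ge>M. E m n < e / 2"
        using Cauchy[of "e / 2"] unfolding E_def by auto
      have "dist (LINT x|lborel. (norm (f n x - g x))\<^sup>2) 0 < e" if "n \<ge> M" for n
      proof -
        have "(LINT x|lborel. (norm (f n x - g x))\<^sup>2) \<le> e / 2"
          using \<open>e > 0\<close> M that by (intro sq(2)[of "e / 2" M]) auto
        thus ?thesis using \<open>e > 0\<close> by (simp add: abs_of_nonneg)
      qed
      thus "\<exists>M. \<forall>n\<ge>M. dist (LINT x|lborel. (norm (f n x - g x))\<^sup>2) 0 < e" by blast
    qed
  qed
qed

text \<open>
  This carries the identity that defines weak derivatives over to limits in mean square.
\<close>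

lemma sq_int_mult_tendsto:
  assumes f: "\<And>n. f n \<in> square_integrable" "g \<in> square_integrable" "h \<in> square_integrable"
    and lim: "(\<lambda>n. LINT x|lborel. (norm (f n x - g x))\<^sup>2) \<longlonglongrightarrow> 0"
  shows "(\<lambda>n. LINT x|lborel. h x * f n x) \<longlonglongrightarrow> (LINT x|lborel. h x * g x)"
proof (rule Lim_transform2[OF tendsto_const Lim_null_comparison], rule always_eventually, rule allI)
  fix n
  have "(LINT x|lborel. h x * g x) - (LINT x|lborel. h x * f n x) = - (LINT x|lborel. h x * (f n x - g x))"
    by (simp add: right_diff_distrib Bochner_Integration.integral_diff sq_int_mult f)
  hence "norm ((LINT x|lborel. h x * g x) - (LINT x|lborel. h x * f n x)) =
      norm (LINT x|lborel. h x * (f n x - g x))" by simp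
  also have "\<dots> \<le> sqrt (LINT x|lborel. (norm (h x))\<^sup>2) * sqrt (LINT x|lborel. (norm (f n x - g x))\<^sup>2)"
    by (rule L2_product_bound) (auto intro: f sq_int_minus)
  finally show "norm ((LINT x|lborel. h x * g x) - (LINT x|lborel. h x * f n x)) \<le>
      sqrt (LINT x|lborel. (norm (h x))\<^sup>2) * sqrt (LINT x|lborel. (norm (f n x - g x))\<^sup>2)" .
next
  show "(\<lambda>n. sqrt (LINT x|lborel. (norm (h x))\<^sup>2) * sqrt (LINT x|lborel. (norm (f n x - g x))\<^sup>2)) \<longlonglongrightarrow> 0"
    using tendsto_mult[OF tendsto_const tendsto_real_sqrt[OF lim]] by simp
qed

lemma norm_h1_diff_sq:
  "(norm (u - v))\<^sup>2 = (LINT x|lborel. (norm (h1_fun u x - h1_fun v x))\<^sup>2) +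
     (LINT x|lborel. (norm (h1_deriv u x - h1_deriv v x))\<^sup>2)"
proof -
  have "AE x in lborel. h1_deriv (- v) x = -1 * h1_deriv v x"
    by (rule h1_deriv_cmult) simp
  hence "AE x in lborel. h1_deriv (u - v) x = h1_deriv u x - h1_deriv v x"
    using h1_deriv_add[of u "- v"] by eventually_elim simp
  hence "(LINT x|lborel. (norm (h1_deriv (u - v) x))\<^sup>2) =
      (LINT x|lborel. (norm (h1_deriv u x - h1_deriv v x))\<^sup>2)"
    by (intro integral_cong_AE) (measurable, auto)
  thus ?thesis by (simp add: norm_h1_def)
qed

text \<open>The values of a Cauchy sequence converge uniformly, which provides the continuous representative
  of its limit.\<close>

instance h1 :: complete_space
proof
  fix U :: "nat \<Rightarrow> h1"
  assume U: "Cauchy U"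
  have close: "\<exists>N. \<forall>m\<ge>N. \<forall>n\<ge>N. (norm (U m - U n))\<^sup>2 < e" if e: "e > 0" for e
  proof -
    obtain N where N: "\<forall>m\<ge>N. \<forall>n\<ge>N. norm (U m - U n) < sqrt e"
      using metric_CauchyD[OF U, of "sqrt e"] e by (auto simp: dist_norm)
    hence "(norm (U m - U n))\<^sup>2 < e" if "m \<ge> N" "n \<ge> N" for m n
      using that power_strict_mono[of "norm (U m - U n)" "sqrt e" 2] e by simp
    thus ?thesis by (intro exI[of _ N]) simp
  qed
  have le: "(LINT x|lborel. (norm (h1_fun u x - h1_fun v x))\<^sup>2) \<le> (norm (u - v))\<^sup>2"
    "(LINT x|lborel. (norm (h1_deriv u x - h1_deriv v x))\<^sup>2) \<le> (norm (u - v))\<^sup>2" for u v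
    by (auto simp: norm_h1_diff_sq)
  have Cf: "\<exists>N. \<forall>m\<ge>N. \<forall>n\<ge>N. (LINT x|lborel. (norm (h1_fun (U m) x - h1_fun (U n) x))\<^sup>2) < e" if "e > 0" for e
    using close[OF that] order_le_less_trans[OF le(1)] by fast
  have Cd: "\<exists>N. \<forall>m\<ge>N. \<forall>n\<ge>N. (LINT x|lborel. (norm (h1_deriv (U m) x - h1_deriv (U n) x))\<^sup>2) < e" if "e > 0" for e
    using close[OF that] order_le_less_trans[OF le(2)] by fast
  obtain f r where f: "f \<in> square_integrable" and r: "strict_mono (r :: nat \<Rightarrow> nat)"
    and fr: "AE x in lborel. (\<lambda>n. h1_fun (U (r n)) x) \<longlonglongrightarrow> f x"
    and flim: "(\<lambda>n. LINT x|lborel. (norm (h1_fun (U n) x - f x))\<^sup>2) \<longlonglongrightarrow> 0"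
    using square_integrable_complete[where f = "\<lambda>n. h1_fun (U n)", OF h1_square_integrable Cf] by blast
  obtain g where g: "g \<in> square_integrable"
    and glim: "(\<lambda>n. LINT x|lborel. (norm (h1_deriv (U n) x - g x))\<^sup>2) \<longlonglongrightarrow> 0"
    using square_integrable_complete[where f = "\<lambda>n. h1_deriv (U n)", OF h1_deriv_square_integrable Cd] by blast
  have "uniformly_convergent_on UNIV (\<lambda>n. h1_fun (U n))"
  proof (rule Cauchy_uniformly_convergent, unfold uniformly_Cauchy_on_def, intro allI impI)
    fix e :: real assume "e > 0"
    then obtain N where N: "\<forall>m\<ge>N. \<forall>n\<ge>N. norm (U m - U n) < e / 2"
      using metric_CauchyD[OF U, of "e / 2"] by (auto simp: dist_norm)
    have "dist (h1_fun (U m) x) (h1_fun (U n) x) < e" if "m \<ge> N" "n \<ge> N" for m n x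
      using sobolev_pointwise[of "U m - U n" x] N that by (fastforce simp: dist_norm)
    thus "\<exists>N. \<forall>x\<in>UNIV. \<forall>m\<ge>N. \<forall>n\<ge>N. dist (h1_fun (U m) x) (h1_fun (U n) x) < e"
      by blast
  qed
  then obtain w where w: "uniform_limit UNIV (\<lambda>n. h1_fun (U n)) w sequentially"
    unfolding uniformly_convergent_on_def by blast
  have w_cont: "continuous_on UNIV w"
    by (rule uniform_limit_theorem[OF _ w]) (simp_all add: h1_continuous)
  have [measurable]: "w \<in> borel_measurable borel" "f \<in> borel_measurable borel" "g \<in> borel_measurable borel"
    by (auto intro: borel_measurable_continuous_onI w_cont sq_int_measurable f g)
  have wf: "AE x in lborel. w x = f x"
    using fr
  proof eventually_elim
    case (elim x)
    have "(\<lambda>n. h1_fun (U n) x) \<longlonglongrightarrow> w x"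
      using tendsto_uniform_limitI[OF w] by simp
    from LIMSEQ_subseq_LIMSEQ[OF this r] elim show ?case
      by (intro LIMSEQ_unique[of "\<lambda>n. h1_fun (U (r n)) x"]) (auto simp: o_def)
  qed
  have "integrable lborel (\<lambda>x. (norm (w x))\<^sup>2)"
    by (rule integrable_cong_AE_imp[OF sq_int_integrable[OF f]]) (use wf in auto)
  hence w_sq: "w \<in> square_integrable"
    by (simp add: square_integrable_def)
  have wlim: "(\<lambda>n. LINT x|lborel. (norm (h1_fun (U n) x - w x))\<^sup>2) \<longlonglongrightarrow> 0"
  proof -
    have "(LINT x|lborel. (norm (h1_fun (U n) x - w x))\<^sup>2) = (LINT x|lborel. (norm (h1_fun (U n) x - f x))\<^sup>2)" for n
      by (rule integral_cong_AE) (use wf in auto)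
    thus ?thesis using flim by simp
  qed
  have w_weak: "has_weak_derivative w g"
    unfolding has_weak_derivative_def
  proof (intro allI impI)
    fix \<phi> assume \<phi>: "test_function \<phi>"
    have "(\<lambda>n. LINT x|lborel. complex_of_real (deriv \<phi> x) * h1_fun (U n) x)
        \<longlonglongrightarrow> (LINT x|lborel. complex_of_real (deriv \<phi> x) * w x)"
      by (intro sq_int_mult_tendsto h1_square_integrable w_sq test_function_sq_int \<phi> wlim)
    moreover have "(\<lambda>n. - (LINT x|lborel. complex_of_real (\<phi> x) * h1_deriv (U n) x))
        \<longlonglongrightarrow> - (LINT x|lborel. complex_of_real (\<phi> x) * g x)"
      by (intro tendsto_minus sq_int_mult_tendsto h1_deriv_square_integrable g test_function_sq_int \<phi> glim)
    moreover have "(LINT x|lborel. complex_of_real (deriv \<phi> x) * h1_fun (U n) x) =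
        - (LINT x|lborel. complex_of_real (\<phi> x) * h1_deriv (U n) x)" for n
      using h1_deriv_weak[of "U n"] \<phi> by (simp add: has_weak_derivative_def scaleR_conv_of_real)
    ultimately show "(LINT x|lborel. deriv \<phi> x *\<^sub>R w x) = - (LINT x|lborel. \<phi> x *\<^sub>R g x)"
      by (simp add: scaleR_conv_of_real LIMSEQ_unique)
  qed
  define l where "l = Abs_h1 w"
  have l: "h1_fun l = w"
    unfolding l_def by (rule Abs_h1_inverse) (use w_cont w_sq g w_weak in auto)
  have l': "AE x in lborel. h1_deriv l x = g x"
    by (rule h1_deriv_AE_eq) (use g w_weak l in auto)
  have "(LINT x|lborel. (norm (h1_deriv (U n) x - h1_deriv l x))\<^sup>2) =
      (LINT x|lborel. (norm (h1_deriv (U n) x - g x))\<^sup>2)" for n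
    by (rule integral_cong_AE) (use l' in auto)
  hence "(\<lambda>n. (norm (U n - l))\<^sup>2) \<longlonglongrightarrow> 0 + 0"
    unfolding norm_h1_diff_sq l using wlim glim by (intro tendsto_add) simp_all
  hence "(\<lambda>n. sqrt ((norm (U n - l))\<^sup>2)) \<longlonglongrightarrow> sqrt 0"
    by (intro tendsto_real_sqrt) simp
  hence "(\<lambda>n. U n - l) \<longlonglongrightarrow> 0"
    by (simp add: tendsto_norm_zero_iff)
  hence "U \<longlonglongrightarrow> l" by (simp add: LIM_zero_iff)
  thus "convergent U" by (auto simp: convergent_def)
qed

section \<open>The Helmholtz operator between \<open>H\<^sup>1\<close> and its dual\<close>

lemma cdual_eqI: "(\<And>u. cdual_apply F u = cdual_apply G u) \<Longrightarrow> F = G"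
  by transfer (auto intro: blinfun_eqI)

lemma norm_cdual_apply: "norm (cdual_apply F u) \<le> norm F * norm u"
  by transfer (rule norm_blinfun)

lemma norm_cdual_le: "0 \<le> K \<Longrightarrow> (\<And>u. norm (cdual_apply F u) \<le> K * norm u) \<Longrightarrow> norm F \<le> K"
  by transfer (rule norm_blinfun_bound)

lemma cdual_apply_linear:
  "cdual_apply F (u + v) = cdual_apply F u + cdual_apply F v"
  "cdual_apply F (c *\<^sub>C u) = c * cdual_apply F u"
  "cdual_apply F (r *\<^sub>R u) = r * cdual_apply F u"
  by (transfer; simp add: blinfun.bilinear_simps scaleR_conv_of_real)+

text \<open>
  The pairing between \<open>H\<^sup>1\<close> and its dual is bilinear. Positivity therefore shows only when the second argument
  is conjugated.
\<close>

definition h1_cnj :: "h1 \<Rightarrow> h1" where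
  "h1_cnj u = Abs_h1 (\<lambda>x. cnj (h1_fun u x))"

lemma sq_int_cnj: "f \<in> square_integrable \<Longrightarrow> (\<lambda>x. cnj (f x)) \<in> square_integrable"
  by (auto simp: square_integrable_def intro: measurable_compose borel_measurable_continuous_onI
      intro!: continuous_intros)

lemma has_weak_derivative_cnj:
  assumes "has_weak_derivative u g"
  shows "has_weak_derivative (\<lambda>x. cnj (u x)) (\<lambda>x. cnj (g x))"
  unfolding has_weak_derivative_def
proof (intro allI impI)
  have cnj: "cnj (LINT x|lborel. a x *\<^sub>R f x) = (LINT x|lborel. a x *\<^sub>R cnj (f x))"
    for a :: "real \<Rightarrow> real" and f
    using Bochner_Integration.integral_cnj[of lborel "\<lambda>x. a x *\<^sub>R f x"] by simp
  fix \<phi> assume "test_function \<phi>"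
  hence "cnj (LINT x|lborel. deriv \<phi> x *\<^sub>R u x) = cnj (- (LINT x|lborel. \<phi> x *\<^sub>R g x))"
    using assms by (simp add: has_weak_derivative_def)
  thus "(LINT x|lborel. deriv \<phi> x *\<^sub>R cnj (u x)) = - (LINT x|lborel. \<phi> x *\<^sub>R cnj (g x))"
    by (simp only: complex_cnj_minus cnj)
qed

lemma h1_fun_cnj [simp]: "h1_fun (h1_cnj u) x = cnj (h1_fun u x)"
proof -
  have "(\<lambda>x. cnj (h1_fun u x)) \<in> {u. continuous_on UNIV u \<and> u \<in> square_integrable \<and>
      (\<exists>g \<in> square_integrable. has_weak_derivative u g)}"
    using h1_continuous[of u] h1_square_integrable[of u] h1_deriv_square_integrable[of u] h1_deriv_weak[of u]
    by (auto intro!: sq_int_cnj has_weak_derivative_cnj bexI[of _ "\<lambda>x. cnj (h1_deriv u x)"] continuous_intros)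
  thus ?thesis by (simp add: h1_cnj_def Abs_h1_inverse)
qed

lemma h1_deriv_cnj: "AE x in lborel. h1_deriv (h1_cnj u) x = cnj (h1_deriv u x)"
proof (rule h1_deriv_AE_eq)
  have "h1_fun (h1_cnj u) = (\<lambda>x. cnj (h1_fun u x))" by (rule ext) simp
  thus "has_weak_derivative (h1_fun (h1_cnj u)) (\<lambda>x. cnj (h1_deriv u x))"
    by (simp add: has_weak_derivative_cnj h1_deriv_weak)
qed (rule sq_int_cnj[OF h1_deriv_square_integrable])

lemma h1_cnj_cnj [simp]: "h1_cnj (h1_cnj u) = u"
  by (rule h1_eqI) simp

lemma h1_cnj_add: "h1_cnj (u + v) = h1_cnj u + h1_cnj v"
  and h1_cnj_scaleR: "h1_cnj (r *\<^sub>R u) = r *\<^sub>R h1_cnj u"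
  by (rule h1_eqI, simp)+

lemma norm_h1_cnj [simp]: "norm (h1_cnj u) = norm u"
proof -
  have "(LINT x|lborel. (norm (h1_deriv (h1_cnj u) x))\<^sup>2) = (LINT x|lborel. (norm (h1_deriv u x))\<^sup>2)"
    using h1_deriv_cnj[of u] by (intro integral_cong_AE) (measurable, auto)
  thus ?thesis by (simp add: norm_h1_def)
qed

text \<open>
  The weak form of \<open>u \<mapsto> z u - u''\<close>.
\<close>

definition helmholtz :: "complex \<Rightarrow> h1 \<Rightarrow> hm1" where
  "helmholtz z u = z *\<^sub>C h1_embed u + dirichlet_op u"

lemma helmholtz_apply:
  "cdual_apply (helmholtz z u) v =
     z * (LINT x|lborel. h1_fun u x * h1_fun v x) + (LINT x|lborel. h1_deriv u x * h1_deriv v x)"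
  by (simp add: helmholtz_def h1_embed_apply dirichlet_op_apply)

lemma helmholtz_commute: "cdual_apply (helmholtz z u) v = cdual_apply (helmholtz z v) u"
  by (simp add: helmholtz_apply mult.commute)

lemma helmholtz_linear:
  "helmholtz z (u + v) = helmholtz z u + helmholtz z v"
  "helmholtz z (c *\<^sub>C u) = c *\<^sub>C helmholtz z u"
  "helmholtz z (u - v) = helmholtz z u - helmholtz z v"
proof -
  show *: "helmholtz z (u + v) = helmholtz z u + helmholtz z v" for u v
    by (rule cdual_eqI) (simp add: helmholtz_commute[of z _ x for x] cdual_apply_linear)
  show **: "helmholtz z (c *\<^sub>C u) = c *\<^sub>C helmholtz z u" for u c
    by (rule cdual_eqI) (simp add: helmholtz_commute[of z _ x for x] cdual_apply_linear)
  show "helmholtz z (u - v) = helmholtz z u - helmholtz z v"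
    using *[of "u - v" v] by (simp add: algebra_simps)
qed

lemma norm_h1_embed_le: "norm (h1_embed u) \<le> norm u"
proof (rule norm_cdual_le)
  show "norm (cdual_apply (h1_embed u) v) \<le> norm u * norm v" for v
    unfolding h1_embed_apply by (intro L2_product_bound h1_square_integrable h1_L2_le_norm)
qed simp

lemma norm_dirichlet_op_le: "norm (dirichlet_op u) \<le> norm u"
proof (rule norm_cdual_le)
  show "norm (cdual_apply (dirichlet_op u) v) \<le> norm u * norm v" for v
    unfolding dirichlet_op_apply by (intro L2_product_bound h1_deriv_square_integrable h1_deriv_L2_le_norm)
qed simp

lemma norm_helmholtz_le: "norm (helmholtz z u) \<le> (norm z + 1) * norm u"
proof -
  have "norm (helmholtz z u) \<le> norm (z *\<^sub>C h1_embed u) + norm (dirichlet_op u)"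
    unfolding helmholtz_def by (rule norm_triangle_ineq)
  also have "\<dots> \<le> norm z * norm u + norm u"
    by (intro add_mono norm_dirichlet_op_le) (simp add: norm_scaleC mult_left_mono norm_h1_embed_le)
  finally show ?thesis by (simp add: distrib_right)
qed

lemma tendsto_helmholtz:
  assumes "X \<longlonglongrightarrow> l"
  shows "(\<lambda>n. helmholtz z (X n)) \<longlonglongrightarrow> helmholtz z l"
proof -
  have "(\<lambda>n. (norm z + 1) * norm (X n - l)) \<longlonglongrightarrow> (norm z + 1) * 0"
    using assms by (intro tendsto_intros) (simp add: LIM_zero_iff tendsto_norm_zero)
  moreover have "norm (helmholtz z (X n) - helmholtz z l) \<le> (norm z + 1) * norm (X n - l)" for n
    using norm_helmholtz_le[of z "X n - l"] by (simp only: helmholtz_linear)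
  ultimately have "(\<lambda>n. helmholtz z (X n) - helmholtz z l) \<longlonglongrightarrow> 0"
    using Lim_null_comparison[OF always_eventually] by (metis (no_types, lifting) mult_zero_right)
  thus ?thesis by (rule LIM_zero_cancel)
qed

lemma helmholtz_cnj:
  "cdual_apply (helmholtz z u) (h1_cnj u) =
     z * complex_of_real (LINT x|lborel. (norm (h1_fun u x))\<^sup>2) +
     complex_of_real (LINT x|lborel. (norm (h1_deriv u x))\<^sup>2)"
proof -
  have "(LINT x|lborel. h1_deriv u x * h1_deriv (h1_cnj u) x) =
      (LINT x|lborel. complex_of_real ((norm (h1_deriv u x))\<^sup>2))"
    using h1_deriv_cnj[of u] by (intro integral_cong_AE) (measurable, auto simp: complex_norm_square[symmetric])
  moreover have "(LINT x|lborel. h1_fun u x * h1_fun (h1_cnj u) x) =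
      (LINT x|lborel. complex_of_real ((norm (h1_fun u x))\<^sup>2))"
    by (simp add: complex_norm_square[symmetric])
  ultimately show ?thesis by (simp add: helmholtz_apply del: of_real_power)
qed

text \<open>
  The link between the real Hilbert space \<open>H\<^sup>1\<close>, where the variational argument takes place, and its
  complex dual.
\<close>

lemma inner_h1_eq: "u \<bullet> v = Re (cdual_apply (helmholtz 1 u) (h1_cnj v))"
proof -
  have *: "a \<bullet> b = Re (a * cnj b)" for a b :: complex
    by (simp add: inner_complex_def)
  have "(LINT x|lborel. h1_deriv u x * h1_deriv (h1_cnj v) x) = (LINT x|lborel. h1_deriv u x * cnj (h1_deriv v x))"
    using h1_deriv_cnj[of v] sq_int_measurable[OF sq_int_cnj[OF h1_deriv_square_integrable]]
    by (intro integral_cong_AE) auto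
  moreover have "Re (LINT x|lborel. f x * cnj (g x)) = (LINT x|lborel. f x \<bullet> g x)"
    if "f \<in> square_integrable" "g \<in> square_integrable" for f g
    unfolding * by (rule integral_Re[symmetric, OF sq_int_mult[OF that(1) sq_int_cnj[OF that(2)]]])
  ultimately show ?thesis
    by (simp add: inner_h1_def h1_inner_def helmholtz_apply h1_square_integrable h1_deriv_square_integrable)
qed

text \<open>
  The imaginary part of \<open>F v\<close> is, up to sign, the real part of \<open>F\<close> at \<open>\<i> v\<close>.
\<close>

lemma cdual_zero_of_Re:
  assumes "\<And>c v. v \<in> S \<Longrightarrow> c *\<^sub>C v \<in> S" "\<And>v. v \<in> S \<Longrightarrow> Re (cdual_apply F v) = 0" "v \<in> S"
  shows "cdual_apply F v = 0"
  using assms(2)[OF assms(3)] assms(2)[OF assms(1)[OF assms(3), of \<i>]]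
  by (simp add: cdual_apply_linear complex_eq_iff)

text \<open>
  The variational solution yields equality of real parts, which is enough for complex-linear functionals.
\<close>

lemma riesz_representation: "\<exists>u. helmholtz 1 u = F"
proof -
  have "bounded_linear (\<lambda>v. Re (cdual_apply F (h1_cnj v)))"
  proof (rule bounded_linear_intro[where K = "norm F"])
    show "norm (Re (cdual_apply F (h1_cnj v))) \<le> norm v * norm F" for v
      using abs_Re_le_cmod[of "cdual_apply F (h1_cnj v)"] norm_cdual_apply[of F "h1_cnj v"]
      by (simp add: mult.commute)
  qed (simp_all add: h1_cnj_add h1_cnj_scaleR cdual_apply_linear)
  then obtain u where u: "\<And>v. u \<bullet> v = Re (cdual_apply F (h1_cnj v))"
    using variational_solution[OF subspace_UNIV] by (metis UNIV_I)
  have "Re (cdual_apply (helmholtz 1 u - F) v) = 0" for v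
    using u[of "h1_cnj v"] by (simp add: inner_h1_eq)
  hence "cdual_apply (helmholtz 1 u - F) v = 0" for v
    using cdual_zero_of_Re[of UNIV] by blast
  hence "helmholtz 1 u - F = 0" by (intro cdual_eqI) simp
  thus ?thesis by auto
qed

text \<open>
  A Hahn-Banach argument made explicit by the Riesz representation: the representative of a functional is
  projected onto the closure of the representatives of the range, and the conjugate of the residual
  annihilates the range.
\<close>

lemma dense_if_annihilator_trivial:
  assumes add: "\<And>u v. P (u + v) = P u + P v" and scale: "\<And>c u. P (c *\<^sub>C u) = c *\<^sub>C P (u :: h1)"
    and ann: "\<And>v. (\<And>u. cdual_apply (P u) v = 0) \<Longrightarrow> v = 0"
  shows "closure (range P) = (UNIV :: hm1 set)"
proof -
  define S where "S = {w. helmholtz 1 w \<in> range P}"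
  have S_scaleC: "c *\<^sub>C w \<in> S" if "w \<in> S" for c w
    using that scale by (auto simp: S_def helmholtz_linear image_iff) metis
  have "helmholtz 1 0 = 0" "P 0 = 0"
    using helmholtz_linear(1)[of 1 0 0] add[of 0 0] by simp_all
  hence "0 \<in> S" unfolding S_def by (metis mem_Collect_eq rangeI)
  moreover have "v + w \<in> S" if "v \<in> S" "w \<in> S" for v w
    using that add by (auto simp: S_def helmholtz_linear image_iff) metis
  ultimately have S: "subspace S"
    using S_scaleC by (auto simp: subspace_def scaleR_eq_scaleC)
  have "F \<in> closure (range P)" for F
  proof -
    obtain w where w: "helmholtz 1 w = F" using riesz_representation by blast
    obtain p where p: "p \<in> closure S" "\<And>s. s \<in> S \<Longrightarrow> p \<bullet> s = w \<bullet> s"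
      using variational_solution[OF S bounded_linear_inner_right[of w]] by blast
    define v where "v = h1_cnj (w - p)"
    have "Re (cdual_apply (helmholtz 1 v) s) = 0" if "s \<in> S" for s
    proof -
      have "s \<bullet> (w - p) = 0"
        using p(2)[OF that] by (simp add: inner_diff_right inner_commute)
      thus ?thesis unfolding inner_h1_eq v_def[symmetric] by (simp only: helmholtz_commute)
    qed
    hence "cdual_apply (helmholtz 1 v) s = 0" if "s \<in> S" for s
      using cdual_zero_of_Re[of S] S_scaleC that by blast
    hence "cdual_apply (P u) v = 0" for u
      using riesz_representation[of "P u"] by (metis S_def helmholtz_commute mem_Collect_eq rangeI)
    hence "v = 0" by (rule ann)
    hence "w = p" by (metis h1_cnj_cnj h1_eqI h1_fun_cnj h1_fun_zero complex_cnj_zero v_def eq_iff_diff_eq_0)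
    then obtain X where X: "\<And>n. X n \<in> S" "X \<longlonglongrightarrow> w"
      using p(1) by (auto simp: closure_sequential)
    have "(\<lambda>n. helmholtz 1 (X n)) \<longlonglongrightarrow> F"
      using tendsto_helmholtz[OF X(2), of 1] w by simp
    moreover have "helmholtz 1 (X n) \<in> range P" for n
      using X(1)[of n] by (simp add: S_def)
    ultimately show ?thesis
      unfolding closure_sequential by (intro exI[of _ "\<lambda>n. helmholtz 1 (X n)"]) simp
  qed
  thus ?thesis by blast
qed

text \<open>
  Multiplication by \<open>cnj s\<close> turns the coefficients \<open>s\<^sup>2\<close> and 1 of the form into \<open>(norm s)\<^sup>2 s\<close> and \<open>cnj s\<close>, both of
  positive real part. The constant is the lower bound that results.
\<close>

definition coercivity_constant :: "complex \<Rightarrow> real" where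
  "coercivity_constant s = Re s * min 1 ((norm s)\<^sup>2) / norm s"

lemma helmholtz_coercive:
  assumes s: "Re s > 0"
  shows "coercivity_constant s * norm u \<le> norm (helmholtz (s\<^sup>2) u)"
proof -
  define a b where "a = (LINT x|lborel. (norm (h1_fun u x))\<^sup>2)" and "b = (LINT x|lborel. (norm (h1_deriv u x))\<^sup>2)"
  have ab: "a \<ge> 0" "b \<ge> 0" "(norm u)\<^sup>2 = a + b"
    by (auto simp: a_def b_def norm_h1_def)
  have "s \<noteq> 0" using s by auto
  have "cnj s * cdual_apply (helmholtz (s\<^sup>2) u) (h1_cnj u) = (cnj s * s) * s * a + cnj s * b"
    by (simp add: helmholtz_cnj a_def b_def power2_eq_square algebra_simps)
  also have "cnj s * s = complex_of_real ((norm s)\<^sup>2)"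
    by (simp add: complex_norm_square[symmetric] mult.commute[of "cnj s"])
  also have "Re (complex_of_real ((norm s)\<^sup>2) * s * a + cnj s * b) = Re s * ((norm s)\<^sup>2 * a + b)"
    by (simp add: algebra_simps)
  finally have eq: "Re (cnj s * cdual_apply (helmholtz (s\<^sup>2) u) (h1_cnj u)) = Re s * ((norm s)\<^sup>2 * a + b)" .
  have "Re s * (min 1 ((norm s)\<^sup>2) * (norm u)\<^sup>2) \<le> Re s * ((norm s)\<^sup>2 * a + b)"
  proof (rule mult_left_mono)
    have "min 1 ((norm s)\<^sup>2) * a \<le> (norm s)\<^sup>2 * a" "min 1 ((norm s)\<^sup>2) * b \<le> 1 * b"
      using ab by (intro mult_right_mono; simp)+
    thus "min 1 ((norm s)\<^sup>2) * (norm u)\<^sup>2 \<le> (norm s)\<^sup>2 * a + b"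
      by (simp add: ab distrib_left)
  qed (use s in simp)
  also have "\<dots> \<le> norm (cnj s * cdual_apply (helmholtz (s\<^sup>2) u) (h1_cnj u))"
    unfolding eq[symmetric] by (rule complex_Re_le_cmod)
  also have "\<dots> \<le> norm s * (norm (helmholtz (s\<^sup>2) u) * norm u)"
    using norm_cdual_apply[of "helmholtz (s\<^sup>2) u" "h1_cnj u"] by (simp add: norm_mult mult_left_mono)
  finally have "(coercivity_constant s * norm u) * norm u \<le> norm (helmholtz (s\<^sup>2) u) * norm u"
    using \<open>s \<noteq> 0\<close> by (simp add: coercivity_constant_def field_simps power2_eq_square)
  thus ?thesis
    by (cases "u = 0") (auto dest: mult_right_le_imp_le)
qed

lemma coercivity_constant_pos: "Re s > 0 \<Longrightarrow> coercivity_constant s > 0"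
  by (auto simp: coercivity_constant_def intro!: divide_pos_pos mult_pos_pos)

lemma helmholtz_inj: "Re s > 0 \<Longrightarrow> helmholtz (s\<^sup>2) u = 0 \<Longrightarrow> u = 0"
  using helmholtz_coercive[of s u] coercivity_constant_pos[of s] by (simp add: mult_le_0_iff)

text \<open>
  Coercivity makes the range closed. It is dense because the operator is symmetric and injective.
\<close>

lemma helmholtz_surj:
  assumes s: "Re s > 0"
  obtains u where "helmholtz (s\<^sup>2) u = F"
proof -
  have "closure (range (helmholtz (s\<^sup>2))) = UNIV"
  proof (rule dense_if_annihilator_trivial)
    fix v assume "\<And>u. cdual_apply (helmholtz (s\<^sup>2) u) v = 0"
    hence "helmholtz (s\<^sup>2) v = 0"
      by (intro cdual_eqI) (simp add: helmholtz_commute[of _ v])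
    thus "v = 0" by (rule helmholtz_inj[OF s])
  qed (rule helmholtz_linear)+
  hence "F \<in> closure (range (helmholtz (s\<^sup>2)))" by simp
  then obtain Y where "\<And>n. Y n \<in> range (helmholtz (s\<^sup>2))" and Y: "Y \<longlonglongrightarrow> F"
    unfolding closure_sequential by metis
  then obtain X where X: "\<And>n. Y n = helmholtz (s\<^sup>2) (X n)"
    unfolding image_iff by metis
  have "Cauchy X"
  proof (rule metric_CauchyI)
    fix e :: real assume "e > 0"
    hence "e * coercivity_constant s > 0" using coercivity_constant_pos[OF s] by simp
    then obtain M where M: "\<forall>m\<ge>M. \<forall>n\<ge>M. norm (Y m - Y n) < e * coercivity_constant s"
      using metric_CauchyD[OF LIMSEQ_imp_Cauchy[OF Y]] by (metis dist_norm)
    have "dist (X m) (X n) < e" if "m \<ge> M" "n \<ge> M" for m n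
    proof -
      have "coercivity_constant s * norm (X m - X n) < coercivity_constant s * e"
        using helmholtz_coercive[OF s, of "X m - X n"] M that
        by (simp add: helmholtz_linear X mult.commute) (meson order_le_less_trans)
      thus ?thesis using coercivity_constant_pos[OF s] by (simp add: dist_norm)
    qed
    thus "\<exists>M. \<forall>m\<ge>M. \<forall>n\<ge>M. dist (X m) (X n) < e" by blast
  qed
  then obtain u where "X \<longlonglongrightarrow> u"
    by (auto simp: Cauchy_convergent_iff convergent_def)
  hence "Y \<longlonglongrightarrow> helmholtz (s\<^sup>2) u"
    using tendsto_helmholtz[of X u "s\<^sup>2"] by (simp only: X[symmetric])
  with Y have "helmholtz (s\<^sup>2) u = F" by (intro LIMSEQ_unique)
  thus ?thesis by (rule that)
qed

section \<open>Piecewise smooth functions and integration by parts\<close>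

lemma test_functionE:
  assumes "test_function \<phi>"
  obtains R where "R > 0" "\<And>x. (\<phi> has_real_derivative deriv \<phi> x) (at x)"
    "continuous_on UNIV (deriv \<phi>)" "\<And>x. x \<notin> {-R..R} \<Longrightarrow> \<phi> x = 0 \<and> deriv \<phi> x = 0"
    "\<phi> R = 0" "\<phi> (- R) = 0"
proof -
  obtain D where D: "\<And>x. (\<phi> has_vector_derivative D x) (at x)" "continuous_on UNIV D"
    using assms unfolding test_function_def C1_differentiable_on_def by blast
  have D': "(\<phi> has_real_derivative D x) (at x)" for x
    using D(1)[of x] by (simp only: has_real_derivative_iff_has_vector_derivative)
  hence deriv: "deriv \<phi> = D"
    by (intro ext DERIV_imp_deriv)
  obtain r where r: "r > 0" "\<And>x. x \<in> closure {x. \<phi> x \<noteq> 0} \<Longrightarrow> norm x \<le> r"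
    using assms unfolding test_function_def
    by (meson bounded_pos compact_imp_bounded)
  have out: "\<phi> x = 0" if "\<bar>x\<bar> > r" for x
    using r(2)[of x] that closure_subset[of "{x. \<phi> x \<noteq> 0}"] by fastforce
  have out': "deriv \<phi> x = 0" if "\<bar>x\<bar> > r" for x
  proof -
    have "(\<phi> has_real_derivative 0) (at x)"
    proof (rule has_field_derivative_transform_within_open)
      show "open {x :: real. \<bar>x\<bar> > r}" by (intro open_Collect_less continuous_intros)
    qed (use that out in auto)
    thus ?thesis by (rule DERIV_imp_deriv)
  qed
  show ?thesis
    by (rule that[of "r + 1"]) (use r(1) D D' deriv out out' in auto)
qed

text \<open>
  The fundamental theorem tolerates finitely many exceptional points, so the derivative of \<open>\<phi> u\<close> integrates
  to the vanishing boundary values.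
\<close>

lemma weak_derivative_of_piecewise:
  assumes "finite S" and u: "continuous_on UNIV u" "u \<in> square_integrable" and g: "g \<in> square_integrable"
    and D: "\<And>x. x \<notin> S \<Longrightarrow> (u has_vector_derivative g x) (at x)"
  shows "has_weak_derivative u g"
  unfolding has_weak_derivative_def
proof (intro allI impI)
  fix \<phi> assume \<phi>: "test_function \<phi>"
  then obtain R where R: "R > 0" "\<And>x. (\<phi> has_real_derivative deriv \<phi> x) (at x)"
    "\<And>x. x \<notin> {-R..R} \<Longrightarrow> \<phi> x = 0 \<and> deriv \<phi> x = 0" "\<phi> R = 0" "\<phi> (- R) = 0"
    by (rule test_functionE) blast
  let ?f = "\<lambda>x. \<phi> x *\<^sub>R g x + deriv \<phi> x *\<^sub>R u x"
  have "(?f has_integral (\<phi> R *\<^sub>R u R - \<phi> (- R) *\<^sub>R u (- R))) {-R..R}"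
  proof (rule fundamental_theorem_of_calculus_interior_strong[OF \<open>finite S\<close>])
    show "((\<lambda>x. \<phi> x *\<^sub>R u x) has_vector_derivative ?f x) (at x)" if "x \<in> {-R<..<R} - S" for x
      using that R(2) D by (intro has_vector_derivative_scaleR) auto
    have "continuous_on UNIV \<phi>"
      by (intro continuous_at_imp_continuous_on ballI DERIV_isCont[OF R(2)])
    thus "continuous_on {-R..R} (\<lambda>x. \<phi> x *\<^sub>R u x)"
      using u(1) by (intro continuous_intros) (auto intro: continuous_on_subset)
  qed (use R in auto)
  hence "(?f has_integral 0) {-R..R}"
    using R by simp
  hence "(?f has_integral 0) UNIV"
    by (rule has_integral_on_superset) (use R(3) in auto)
  moreover have "(?f has_integral (LINT x|lborel. ?f x)) UNIV"
    by (intro has_integral_integral_lborel Bochner_Integration.integrable_add test_function_integrable \<phi> u g)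
  ultimately have "(LINT x|lborel. ?f x) = 0"
    by (rule has_integral_unique[symmetric])
  moreover have "(LINT x|lborel. ?f x) = (LINT x|lborel. \<phi> x *\<^sub>R g x) + (LINT x|lborel. deriv \<phi> x *\<^sub>R u x)"
    by (intro Bochner_Integration.integral_add test_function_integrable \<phi> u g)
  ultimately show "(LINT x|lborel. deriv \<phi> x *\<^sub>R u x) = - (LINT x|lborel. \<phi> x *\<^sub>R g x)"
    by (simp add: add_eq_0_iff)
qed

lemma sq_int_bounded_mult:
  assumes "f \<in> square_integrable" "\<psi> \<in> borel_measurable borel" "\<And>x. norm (\<psi> x :: complex) \<le> K"
  shows "(\<lambda>x. \<psi> x * f x) \<in> square_integrable"
proof -
  note [measurable] = sq_int_measurable[OF assms(1)] assms(2)
  have "integrable lborel (\<lambda>x. (norm (\<psi> x * f x))\<^sup>2)"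
  proof (rule Bochner_Integration.integrable_bound)
    show "integrable lborel (\<lambda>x. K\<^sup>2 * (norm (f x))\<^sup>2)"
      by (intro integrable_mult_right sq_int_integrable assms)
    show "AE x in lborel. norm ((norm (\<psi> x * f x))\<^sup>2) \<le> norm (K\<^sup>2 * (norm (f x))\<^sup>2)"
      using assms(3) by (intro AE_I2) (auto simp: norm_mult power_mult_distrib intro!: mult_right_mono power_mono)
  qed measurable
  thus ?thesis by (simp add: square_integrable_def)
qed

lemma sq_int_bounded_support:
  assumes "f \<in> borel_measurable borel" "\<And>x. norm (f x :: complex) \<le> K" "\<And>x. x \<notin> {l..r} \<Longrightarrow> f x = 0"
  shows "f \<in> square_integrable"
proof -
  have "f = (\<lambda>x. f x * indicator {l..r} x)"
    using assms(3) by (auto simp: indicator_def fun_eq_iff)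
  thus ?thesis
    using sq_int_bounded_mult[OF sq_int_indicator assms(1,2)] by metis
qed

lemma test_function_mult:
  assumes "test_function \<phi>" and D: "\<And>x. (\<psi> has_real_derivative \<psi>' x) (at x)" "continuous_on UNIV \<psi>'"
  shows "test_function (\<lambda>x. \<phi> x * \<psi> x)" "deriv (\<lambda>x. \<phi> x * \<psi> x) x = deriv \<phi> x * \<psi> x + \<phi> x * \<psi>' x"
proof -
  have R: "\<And>x. (\<phi> has_real_derivative deriv \<phi> x) (at x)" "continuous_on UNIV (deriv \<phi>)"
    by (rule test_functionE[OF assms(1)], assumption)+
  have D2: "((\<lambda>x. \<phi> x * \<psi> x) has_real_derivative deriv \<phi> x * \<psi> x + \<phi> x * \<psi>' x) (at x)" for x
    by (rule DERIV_cong[OF DERIV_mult[OF R(1) D(1)]]) (simp add: algebra_simps)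
  show "deriv (\<lambda>x. \<phi> x * \<psi> x) x = deriv \<phi> x * \<psi> x + \<phi> x * \<psi>' x"
    by (rule DERIV_imp_deriv[OF D2])
  have cont: "continuous_on UNIV \<phi>" "continuous_on UNIV \<psi>"
    by (intro continuous_at_imp_continuous_on ballI DERIV_isCont[OF R(1)] DERIV_isCont[OF D(1)])+
  have "continuous_on UNIV (\<lambda>x. deriv \<phi> x * \<psi> x + \<phi> x * \<psi>' x)"
    by (intro continuous_intros R cont D)
  hence "(\<lambda>x. \<phi> x * \<psi> x) C1_differentiable_on UNIV"
    unfolding C1_differentiable_on_def
    using D2[unfolded has_real_derivative_iff_has_vector_derivative]
    by (intro exI[of _ "\<lambda>x. deriv \<phi> x * \<psi> x + \<phi> x * \<psi>' x"]) simp
  moreover have "closure {x. \<phi> x * \<psi> x \<noteq> 0} \<subseteq> closure {x. \<phi> x \<noteq> 0}"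
    by (intro closure_mono) auto
  hence "compact (closure {x. \<phi> x * \<psi> x \<noteq> 0})"
    using assms(1) unfolding test_function_def
    by (meson bounded_subset closed_closure compact_eq_bounded_closed)
  ultimately show "test_function (\<lambda>x. \<phi> x * \<psi> x)" by (simp add: test_function_def)
qed

text \<open>
  The product rule holds because \<open>\<phi> \<psi>\<close> is a test function whenever \<open>\<phi>\<close> is one.
\<close>

lemma has_weak_derivative_mult_real:
  assumes w: "has_weak_derivative u g" and u: "u \<in> square_integrable" and g: "g \<in> square_integrable"
    and D: "\<And>x. (\<psi> has_real_derivative \<psi>' x) (at x)" "continuous_on UNIV \<psi>'"
    and bound: "\<And>x. \<bar>\<psi> x\<bar> \<le> K" "\<And>x. \<bar>\<psi>' x\<bar> \<le> K"
  shows "(\<lambda>x. of_real (\<psi> x) * u x) \<in> square_integrable"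
    "(\<lambda>x. of_real (\<psi>' x) * u x + of_real (\<psi> x) * g x) \<in> square_integrable"
    "has_weak_derivative (\<lambda>x. of_real (\<psi> x) * u x) (\<lambda>x. of_real (\<psi>' x) * u x + of_real (\<psi> x) * g x)"
proof -
  have cont: "continuous_on UNIV \<psi>"
    by (intro continuous_at_imp_continuous_on ballI DERIV_isCont[OF D(1)])
  have sq: "(\<lambda>x. of_real (f x) * v x) \<in> square_integrable"
    if "continuous_on UNIV f" "\<And>x. \<bar>f x\<bar> \<le> K" "v \<in> square_integrable" for f v
    by (rule sq_int_bounded_mult[OF that(3), of _ K])
       (use that in \<open>auto intro!: borel_measurable_continuous_onI continuous_intros\<close>)
  show 1: "(\<lambda>x. of_real (\<psi> x) * u x) \<in> square_integrable"
    by (intro sq cont bound u)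
  have 2: "(\<lambda>x. of_real (\<psi>' x) * u x) \<in> square_integrable" "(\<lambda>x. of_real (\<psi> x) * g x) \<in> square_integrable"
    by (intro sq cont D(2) bound u g)+
  show "(\<lambda>x. of_real (\<psi>' x) * u x + of_real (\<psi> x) * g x) \<in> square_integrable"
    by (intro sq_int_add 2)
  show "has_weak_derivative (\<lambda>x. of_real (\<psi> x) * u x) (\<lambda>x. of_real (\<psi>' x) * u x + of_real (\<psi> x) * g x)"
    unfolding has_weak_derivative_def
  proof (intro allI impI)
    fix \<phi> assume \<phi>: "test_function \<phi>"
    note \<phi>\<psi> = test_function_mult[OF \<phi> D]
    have "(LINT x|lborel. deriv \<phi> x *\<^sub>R (of_real (\<psi> x) * u x) + \<phi> x *\<^sub>R (of_real (\<psi>' x) * u x)) =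
        (LINT x|lborel. deriv (\<lambda>x. \<phi> x * \<psi> x) x *\<^sub>R u x)"
      unfolding \<phi>\<psi>(2) by (simp add: scaleR_conv_of_real algebra_simps)
    also have "\<dots> = - (LINT x|lborel. (\<phi> x * \<psi> x) *\<^sub>R g x)"
      using w \<phi>\<psi>(1) by (simp add: has_weak_derivative_def)
    also have "(LINT x|lborel. (\<phi> x * \<psi> x) *\<^sub>R g x) = (LINT x|lborel. \<phi> x *\<^sub>R (of_real (\<psi> x) * g x))"
      by (simp add: scaleR_conv_of_real algebra_simps)
    finally have "(LINT x|lborel. deriv \<phi> x *\<^sub>R (of_real (\<psi> x) * u x)) + (LINT x|lborel. \<phi> x *\<^sub>R (of_real (\<psi>' x) * u x))
        = - (LINT x|lborel. \<phi> x *\<^sub>R (of_real (\<psi> x) * g x))"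
      by (subst (asm) Bochner_Integration.integral_add) (intro test_function_integrable \<phi> 1 2)+
    moreover have "(LINT x|lborel. \<phi> x *\<^sub>R (of_real (\<psi>' x) * u x + of_real (\<psi> x) * g x)) =
        (LINT x|lborel. \<phi> x *\<^sub>R (of_real (\<psi>' x) * u x)) + (LINT x|lborel. \<phi> x *\<^sub>R (of_real (\<psi> x) * g x))"
      unfolding scaleR_add_right by (intro Bochner_Integration.integral_add test_function_integrable \<phi> 2)
    ultimately show "(LINT x|lborel. deriv \<phi> x *\<^sub>R (of_real (\<psi> x) * u x)) =
        - (LINT x|lborel. \<phi> x *\<^sub>R (of_real (\<psi>' x) * u x + of_real (\<psi> x) * g x))"
      by (simp add: add_eq_0_iff algebra_simps)
  qed
qed

text \<open>
  Multiplying \<open>\<psi>\<close> by a cutoff that equals 1 on \<open>{a..b}\<close> makes it bounded, so that the product with \<open>u\<close> lies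
  in \<open>H\<^sup>1\<close> and the fundamental theorem for weak derivatives applies to it.
\<close>

lemma integration_by_parts_real:
  assumes D: "\<And>x. (\<psi> has_real_derivative \<psi>' x) (at x)" "continuous_on UNIV \<psi>'" and ab: "a \<le> b"
  shows "integrable lborel (\<lambda>x. indicator {a<..b} x *\<^sub>R (of_real (\<psi>' x) * h1_fun u x + of_real (\<psi> x) * h1_deriv u x))"
    "(LINT x|lborel. indicator {a<..b} x *\<^sub>R (of_real (\<psi>' x) * h1_fun u x + of_real (\<psi> x) * h1_deriv u x)) =
      of_real (\<psi> b) * h1_fun u b - of_real (\<psi> a) * h1_fun u a"
proof -
  \<comment> \<open>Both steps have width 2, so the cutoff rises to the left of \<open>a\<close> and falls to the right of \<open>b\<close>.\<close>
  define \<theta> \<theta>' where "\<theta> x = pstep 1 (x - (a - 3)) - pstep 1 (x - (b + 1))"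
    and "\<theta>' x = ptent 1 (x - (a - 3)) - ptent 1 (x - (b + 1))" for x
  have \<theta>: "(\<theta> has_real_derivative \<theta>' x) (at x)" for x
    unfolding \<theta>_def \<theta>'_def by (intro DERIV_diff DERIV_pstep_shift) auto
  have \<theta>_ab: "\<theta> x = 1" "\<theta>' x = 0" if "x \<in> {a..b}" for x
    using that by (auto simp: \<theta>_def \<theta>'_def pstep_left pstep_right ptent_outside)
  have \<theta>_out: "\<theta> x = 0" "\<theta>' x = 0" if "x \<notin> {a - 3..b + 3}" for x
    using that ab by (auto simp: \<theta>_def \<theta>'_def pstep_left pstep_right ptent_outside)
  have cont: "continuous_on UNIV \<psi>" "continuous_on UNIV \<theta>"
    by (intro continuous_at_imp_continuous_on ballI DERIV_isCont[OF \<theta>] DERIV_isCont[OF D(1)])+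
  have cont': "continuous_on UNIV \<theta>'"
    unfolding \<theta>'_def by (intro continuous_intros continuous_ptent)
  define \<eta> \<eta>' where "\<eta> x = \<psi> x * \<theta> x" and "\<eta>' x = \<psi>' x * \<theta> x + \<psi> x * \<theta>' x" for x
  have \<eta>: "(\<eta> has_real_derivative \<eta>' x) (at x)" for x
    unfolding \<eta>_def \<eta>'_def by (rule DERIV_cong[OF DERIV_mult[OF D(1) \<theta>]]) (simp add: algebra_simps)
  have cont_\<eta>: "continuous_on UNIV \<eta>" "continuous_on UNIV \<eta>'"
    unfolding \<eta>_def \<eta>'_def by (intro continuous_intros cont cont' D)+
  have bounded: "\<exists>K. \<forall>x. \<bar>f x\<bar> \<le> K" if f: "continuous_on UNIV f" "\<And>x. x \<notin> {a - 3..b + 3} \<Longrightarrow> f x = 0" for f :: "real \<Rightarrow> real"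
  proof -
    have "bounded (f ` {a - 3..b + 3})"
      by (intro compact_imp_bounded compact_continuous_image continuous_on_subset[OF f(1)]) auto
    then obtain K where K: "\<And>x. x \<in> {a - 3..b + 3} \<Longrightarrow> \<bar>f x\<bar> \<le> K"
      unfolding bounded_iff by (simp del: atLeastAtMost_iff) blast
    hence "\<bar>f x\<bar> \<le> max K 0" for x
      using f(2)[of x] by (cases "x \<in> {a - 3..b + 3}") (auto simp: le_max_iff_disj)
    thus ?thesis by blast
  qed
  obtain K1 K2 where K: "\<And>x. \<bar>\<eta> x\<bar> \<le> K1" "\<And>x. \<bar>\<eta>' x\<bar> \<le> K2"
    using bounded[OF cont_\<eta>(1)] bounded[OF cont_\<eta>(2)] \<theta>_out unfolding \<eta>_def \<eta>'_def
    by (metis add.right_neutral mult_zero_right)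
  have K': "\<bar>\<eta> x\<bar> \<le> max K1 K2" "\<bar>\<eta>' x\<bar> \<le> max K1 K2" for x
    using K(1)[of x] K(2)[of x] by auto
  note * = has_weak_derivative_mult_real[OF h1_deriv_weak[of u] h1_square_integrable h1_deriv_square_integrable
      \<eta> cont_\<eta>(2) K']
  have eq: "indicator {a<..b} x *\<^sub>R (of_real (\<eta>' x) * h1_fun u x + of_real (\<eta> x) * h1_deriv u x) =
      indicator {a<..b} x *\<^sub>R (of_real (\<psi>' x) * h1_fun u x + of_real (\<psi> x) * h1_deriv u x)" for x
    using \<theta>_ab[of x] by (auto simp: indicator_def \<eta>_def \<eta>'_def)
  have "integrable lborel (\<lambda>x. indicator {a<..b} x *\<^sub>R (indicator {a..b} x *\<^sub>R
      (of_real (\<eta>' x) * h1_fun u x + of_real (\<eta> x) * h1_deriv u x)))"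
    by (intro integrable_mult_indicator sq_int_integrable_on_Icc *) simp
  also have "(\<lambda>x. indicator {a<..b} x *\<^sub>R (indicator {a..b} x *\<^sub>R
      (of_real (\<eta>' x) * h1_fun u x + of_real (\<eta> x) * h1_deriv u x))) =
      (\<lambda>x. indicator {a<..b} x *\<^sub>R (of_real (\<eta>' x) * h1_fun u x + of_real (\<eta> x) * h1_deriv u x))"
    by (auto simp: indicator_def)
  finally show "integrable lborel (\<lambda>x. indicator {a<..b} x *\<^sub>R (of_real (\<psi>' x) * h1_fun u x + of_real (\<psi> x) * h1_deriv u x))"
    by (simp only: eq)
  have "of_real (\<eta> b) * h1_fun u b - of_real (\<eta> a) * h1_fun u a = (LINT x|lborel. indicator {a<..b} x *\<^sub>R
      (of_real (\<eta>' x) * h1_fun u x + of_real (\<eta> x) * h1_deriv u x))"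
    by (rule weak_derivative_FTC[OF _ *(2,3) ab]) (intro continuous_intros cont_\<eta> h1_continuous)
  thus "(LINT x|lborel. indicator {a<..b} x *\<^sub>R (of_real (\<psi>' x) * h1_fun u x + of_real (\<psi> x) * h1_deriv u x)) =
      of_real (\<psi> b) * h1_fun u b - of_real (\<psi> a) * h1_fun u a"
    using ab \<theta>_ab[of a] \<theta>_ab[of b] by (simp only: eq) (simp add: \<eta>_def)
qed

lemma integration_by_parts:
  assumes D: "\<And>x. (\<psi> has_vector_derivative \<psi>' x) (at x)" "continuous_on UNIV \<psi>'" and ab: "a \<le> b"
  shows "(LINT x|lborel. indicator {a<..b} x *\<^sub>R (\<psi>' x * h1_fun u x + \<psi> x * h1_deriv u x)) =
      \<psi> b * h1_fun u b - \<psi> a * h1_fun u a" (is "_ = ?R")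
proof -
  have Re: "((\<lambda>x. Re (\<psi> x)) has_real_derivative Re (\<psi>' x)) (at x)"
    and Im: "((\<lambda>x. Im (\<psi> x)) has_real_derivative Im (\<psi>' x)) (at x)" for x
    using bounded_linear.has_vector_derivative[OF bounded_linear_Re D(1)]
      bounded_linear.has_vector_derivative[OF bounded_linear_Im D(1)]
    by (simp_all add: has_real_derivative_iff_has_vector_derivative)
  have cont: "continuous_on UNIV (\<lambda>x. Re (\<psi>' x))" "continuous_on UNIV (\<lambda>x. Im (\<psi>' x))"
    by (intro continuous_intros D)+
  note R = integration_by_parts_real[OF Re cont(1) ab, of u] and I = integration_by_parts_real[OF Im cont(2) ab, of u]
  have "(LINT x|lborel. indicator {a<..b} x *\<^sub>R (\<psi>' x * h1_fun u x + \<psi> x * h1_deriv u x)) =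
      (LINT x|lborel. indicator {a<..b} x *\<^sub>R (of_real (Re (\<psi>' x)) * h1_fun u x + of_real (Re (\<psi> x)) * h1_deriv u x)
       + \<i> * (indicator {a<..b} x *\<^sub>R (of_real (Im (\<psi>' x)) * h1_fun u x + of_real (Im (\<psi> x)) * h1_deriv u x)))"
  proof (rule Bochner_Integration.integral_cong[OF refl])
    fix x
    have "\<psi>' x * h1_fun u x + \<psi> x * h1_deriv u x =
       (of_real (Re (\<psi>' x)) + \<i> * of_real (Im (\<psi>' x))) * h1_fun u x +
       (of_real (Re (\<psi> x)) + \<i> * of_real (Im (\<psi> x))) * h1_deriv u x"
      by (simp only: complex_eq[symmetric])
    thus "indicator {a<..b} x *\<^sub>R (\<psi>' x * h1_fun u x + \<psi> x * h1_deriv u x) =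
      indicator {a<..b} x *\<^sub>R (of_real (Re (\<psi>' x)) * h1_fun u x + of_real (Re (\<psi> x)) * h1_deriv u x)
       + \<i> * (indicator {a<..b} x *\<^sub>R (of_real (Im (\<psi>' x)) * h1_fun u x + of_real (Im (\<psi> x)) * h1_deriv u x))"
      by (simp add: scaleR_conv_of_real algebra_simps)
  qed
  also have "\<dots> = (of_real (Re (\<psi> b)) * h1_fun u b - of_real (Re (\<psi> a)) * h1_fun u a) +
      \<i> * (of_real (Im (\<psi> b)) * h1_fun u b - of_real (Im (\<psi> a)) * h1_fun u a)"
    by (subst Bochner_Integration.integral_add[OF R(1) integrable_mult_right[OF I(1)]])
       (simp only: R(2) I(2) integral_mult_right_zero)
  also have "\<dots> = (of_real (Re (\<psi> b)) + \<i> * of_real (Im (\<psi> b))) * h1_fun u b -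
      (of_real (Re (\<psi> a)) + \<i> * of_real (Im (\<psi> a))) * h1_fun u a"
    by (simp add: algebra_simps)
  also have "\<dots> = ?R" by (simp only: complex_eq[symmetric])
  finally show ?thesis .
qed

lemma h1_of_piecewise:
  assumes "finite S" and u: "continuous_on UNIV u" "u \<in> square_integrable" and g: "g \<in> square_integrable"
    and D: "\<And>x. x \<notin> S \<Longrightarrow> (u has_vector_derivative g x) (at x)"
  shows "h1_fun (Abs_h1 u) = u" "AE x in lborel. h1_deriv (Abs_h1 u) x = g x"
proof -
  have w: "has_weak_derivative u g"
    by (rule weak_derivative_of_piecewise[OF assms])
  show eq: "h1_fun (Abs_h1 u) = u"
    by (rule Abs_h1_inverse) (use u g w in auto)
  show "AE x in lborel. h1_deriv (Abs_h1 u) x = g x"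
    by (rule h1_deriv_AE_eq[OF g]) (simp add: eq w)
qed

text \<open>
  The function chosen by \<open>h1_deriv\<close> may be replaced by an explicit representative of the weak derivative.
\<close>

lemma helmholtz_apply_AE:
  assumes "AE x in lborel. h1_deriv u x = g x" "g \<in> square_integrable"
  shows "integrable lborel (\<lambda>x. z * h1_fun u x * h1_fun v x + g x * h1_deriv v x)"
    "cdual_apply (helmholtz z u) v = (LINT x|lborel. z * h1_fun u x * h1_fun v x + g x * h1_deriv v x)"
proof -
  have i: "integrable lborel (\<lambda>x. z * (h1_fun u x * h1_fun v x))" "integrable lborel (\<lambda>x. g x * h1_deriv v x)"
    by (intro integrable_mult_right sq_int_mult h1_square_integrable h1_deriv_square_integrable assms)+
  show "integrable lborel (\<lambda>x. z * h1_fun u x * h1_fun v x + g x * h1_deriv v x)"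
    using Bochner_Integration.integrable_add[OF i] by (simp add: mult.assoc)
  note [measurable] = sq_int_measurable[OF assms(2)]
  have "(LINT x|lborel. h1_deriv u x * h1_deriv v x) = (LINT x|lborel. g x * h1_deriv v x)"
    using assms(1) by (intro integral_cong_AE) (measurable, auto)
  thus "cdual_apply (helmholtz z u) v = (LINT x|lborel. z * h1_fun u x * h1_fun v x + g x * h1_deriv v x)"
    using Bochner_Integration.integral_add[OF i] by (simp add: helmholtz_apply mult.assoc)
qed

section \<open>The Green function\<close>

lemma integral_symmetric_exhaustion:
  fixes F :: "real \<Rightarrow> complex"
  assumes "integrable lborel F"
  shows "(\<lambda>n. LINT x|lborel. indicator {a - real n<..a + real n} x *\<^sub>R F x) \<longlonglongrightarrow> (LINT x|lborel. F x)"
proof (rule integral_dominated_convergence)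
  note [measurable] = borel_measurable_integrable[OF assms]
  show "F \<in> borel_measurable lborel" "(\<lambda>x. indicator {a - real n<..a + real n} x *\<^sub>R F x) \<in> borel_measurable lborel" for n
    by measurable
  show "integrable lborel (\<lambda>x. norm (F x))" using assms by simp
  show "AE x in lborel. norm (indicator {a - real n<..a + real n} x *\<^sub>R F x) \<le> norm (F x)" for n
    by (intro AE_I2) (auto simp: indicator_def)
  show "AE x in lborel. (\<lambda>n. indicator {a - real n<..a + real n} x *\<^sub>R F x) \<longlonglongrightarrow> F x"
  proof (intro AE_I2 tendsto_eventually)
    fix x :: real
    have "\<forall>\<^sub>F n :: nat in sequentially. real n > \<bar>x - a\<bar>"
      using filterlim_real_sequentially by (auto simp: filterlim_at_top_dense)
    thus "\<forall>\<^sub>F n :: nat in sequentially. indicator {a - real n<..a + real n} x *\<^sub>R F x = F x"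
      by eventually_elim (auto simp: indicator_def)
  qed
qed

lemma exp_affine_has_vector_derivative:
  "((\<lambda>x. exp (c * complex_of_real (x - a))) has_vector_derivative c * exp (c * complex_of_real (x - a))) (at x)"
proof -
  have "((\<lambda>z. exp (c * (z - complex_of_real a))) has_field_derivative
      c * exp (c * (complex_of_real x - complex_of_real a))) (at (complex_of_real x))"
    by (auto intro!: derivative_eq_intros)
  from has_vector_derivative_real_field[OF this] show ?thesis by simp
qed

lemma integrable_exp_abs:
  fixes c a :: real
  assumes "c > 0"
  shows "integrable lborel (\<lambda>x. exp (- c * \<bar>x - a\<bar>))"
proof -
  have "(\<integral>\<^sup>+x. ennreal (exp (- c * x)) * indicator {0::real..} x \<partial>lborel) = ennreal (0 - (- exp (- c * 0) / c))"
  proof (rule nn_integral_FTC_atLeast)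
    show "((\<lambda>x. - exp (- c * x) / c) \<longlongrightarrow> 0) at_top"
      using assms by real_asymp
  qed (use assms in \<open>auto intro!: derivative_eq_intros\<close>)
  hence "integrable lborel (\<lambda>x. exp (- c * x) * indicat_real {0..} x)"
    by (intro integrableI_nonneg) (auto simp: ennreal_mult ennreal_indicator)
  note * = lborel_integrable_real_affine[OF this, of 1 "-a"] lborel_integrable_real_affine[OF this, of "-1" a]
  show ?thesis
  proof (rule Bochner_Integration.integrable_bound[OF Bochner_Integration.integrable_add[OF *]])
    show "AE x in lborel. norm (exp (- c * \<bar>x - a\<bar>)) \<le> norm (exp (- c * (- a + 1 * x)) * indicator {0..} (- a + 1 * x) +
        exp (- c * (a + - 1 * x)) * indicat_real {0..} (a + - 1 * x))"
      by (intro AE_I2) (auto simp: indicator_def abs_if algebra_simps)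
  qed auto
qed

text \<open>
  The decaying fundamental solution of \<open>s\<^sup>2 u - u'' = \<delta>\<^sub>a\<close>.
\<close>

definition green :: "complex \<Rightarrow> real \<Rightarrow> h1" where
  "green s a = Abs_h1 (\<lambda>x. exp (- s * complex_of_real \<bar>x - a\<bar>) / (2 * s))"

context
  fixes s :: complex and a :: real
  assumes s: "Re s > 0"
begin

\<comment> \<open>The derivative of the Green function; its value at \<open>a\<close> fits the half-open interval \<open>{a - n<..a}\<close>.\<close>
private definition dgreen where
  "dgreen x = (if x \<le> a then exp (s * complex_of_real (x - a)) / 2 else - exp (- s * complex_of_real (x - a)) / 2)"

lemma exp_abs_sq_int: "(\<lambda>x. exp (- s * complex_of_real \<bar>x - a\<bar>)) \<in> square_integrable"
proof -
  have "integrable lborel (\<lambda>x. exp (- (2 * Re s) * \<bar>x - a\<bar>))"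
    using s by (intro integrable_exp_abs) simp
  also have "(\<lambda>x. exp (- (2 * Re s) * \<bar>x - a\<bar>)) = (\<lambda>x. (norm (exp (- s * complex_of_real \<bar>x - a\<bar>)))\<^sup>2)"
    by (simp add: exp_double[symmetric] mult.assoc)
  finally show ?thesis
    by (simp add: square_integrable_def)
qed

lemma dgreen_sq_int: "dgreen \<in> square_integrable"
proof -
  have "(\<lambda>x. (if x \<le> a then 1 / 2 else - 1 / 2) * exp (- s * complex_of_real \<bar>x - a\<bar>)) \<in> square_integrable"
    by (rule sq_int_bounded_mult[OF exp_abs_sq_int, of _ "1 / 2"]) (auto simp: norm_divide)
  also have "(\<lambda>x. (if x \<le> a then 1 / 2 else - 1 / 2) * exp (- s * complex_of_real \<bar>x - a\<bar>)) = dgreen"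
    by (auto simp: dgreen_def fun_eq_iff abs_if algebra_simps)
  finally show ?thesis .
qed

lemma green_fun: "h1_fun (green s a) x = exp (- s * complex_of_real \<bar>x - a\<bar>) / (2 * s)"
  and green_deriv: "AE x in lborel. h1_deriv (green s a) x = dgreen x"
proof -
  have [simp]: "s \<noteq> 0" using s by auto
  let ?u = "\<lambda>x. exp (- s * complex_of_real \<bar>x - a\<bar>) / (2 * s)"
  have cont: "continuous_on UNIV ?u"
    by (intro continuous_intros) simp
  have sq: "?u \<in> square_integrable"
    using sq_int_cmult[OF exp_abs_sq_int, of "1 / (2 * s)"] by simp
  have D: "(?u has_vector_derivative dgreen x) (at x)" if "x \<notin> {a}" for x
  proof (cases "x < a")
    case True
    have "((\<lambda>x. exp (s * complex_of_real (x - a)) / (2 * s)) has_vector_derivative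
        s * exp (s * complex_of_real (x - a)) / (2 * s)) (at x)"
      by (intro has_vector_derivative_divide exp_affine_has_vector_derivative)
    hence "((\<lambda>x. exp (s * complex_of_real (x - a)) / (2 * s)) has_vector_derivative dgreen x) (at x)"
      using True by (simp add: dgreen_def)
    thus ?thesis
      by (rule has_vector_derivative_transform_within_open[where S = "{..<a}"])
         (use True in \<open>auto simp: algebra_simps\<close>)
  next
    case False
    have "((\<lambda>x. exp (- s * complex_of_real (x - a)) / (2 * s)) has_vector_derivative
        - s * exp (- s * complex_of_real (x - a)) / (2 * s)) (at x)"
      by (intro has_vector_derivative_divide exp_affine_has_vector_derivative)
    hence "((\<lambda>x. exp (- s * complex_of_real (x - a)) / (2 * s)) has_vector_derivative dgreen x) (at x)"
      using False that by (simp add: dgreen_def)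
    thus ?thesis
      by (rule has_vector_derivative_transform_within_open[where S = "{a<..}"])
         (use False that in auto)
  qed
  note * = h1_of_piecewise[OF _ cont sq dgreen_sq_int D, folded green_def, of "{a}"]
  show "h1_fun (green s a) x = ?u x" "AE x in lborel. h1_deriv (green s a) x = dgreen x"
    using * by (simp_all del: of_real_diff)
qed

text \<open>
  On either side of \<open>a\<close> the Green function satisfies \<open>s\<^sup>2 G = G''\<close>. Integration by parts therefore leaves the
  jump of \<open>G'\<close> at \<open>a\<close>, which is \<open>-1\<close>, and boundary terms that decay.
\<close>

lemma helmholtz_green: "helmholtz (s\<^sup>2) (green s a) = dirac a"
proof (rule cdual_eqI)
  fix v
  have [simp]: "s \<noteq> 0" using s by auto
  let ?F = "\<lambda>x. s\<^sup>2 * h1_fun (green s a) x * h1_fun v x + dgreen x * h1_deriv v x"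
  note F = helmholtz_apply_AE[OF green_deriv dgreen_sq_int, of "s\<^sup>2" v]
  define l r where "l x = exp (s * complex_of_real (x - a)) / 2"
    and "r x = - exp (- s * complex_of_real (x - a)) / 2" for x
  have l: "(l has_vector_derivative s * l x) (at x)" for x
    using has_vector_derivative_divide[OF exp_affine_has_vector_derivative, of s a 2 x]
    by (simp add: l_def[abs_def])
  have r: "(r has_vector_derivative - s * r x) (at x)" for x
    using has_vector_derivative_divide[OF exp_affine_has_vector_derivative, of "-s" a "-2" x]
    by (simp add: r_def[abs_def])
  have cont: "continuous_on UNIV (\<lambda>x. s * l x)" "continuous_on UNIV (\<lambda>x. - s * r x)"
    unfolding l_def r_def by (intro continuous_intros; simp)+
  have eq: "indicator {a - real n<..a + real n} x *\<^sub>R ?F x =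
      indicator {a - real n<..a} x *\<^sub>R (s * l x * h1_fun v x + l x * h1_deriv v x) +
      indicator {a<..a + real n} x *\<^sub>R (- s * r x * h1_fun v x + r x * h1_deriv v x)" for n x
    by (auto simp: indicator_def green_fun dgreen_def l_def r_def abs_if power2_eq_square algebra_simps)
  have int: "integrable lborel (\<lambda>x. indicator A x *\<^sub>R ?F x)" if "A \<in> sets borel" for A
    using F(1) that by (intro integrable_mult_indicator) auto
  have i: "integrable lborel (\<lambda>x. indicator {a - real n<..a} x *\<^sub>R (s * l x * h1_fun v x + l x * h1_deriv v x))"
    "integrable lborel (\<lambda>x. indicator {a<..a + real n} x *\<^sub>R (- s * r x * h1_fun v x + r x * h1_deriv v x))" for n
  proof -
    have "(\<lambda>x. indicator {a - real n<..a} x *\<^sub>R (s * l x * h1_fun v x + l x * h1_deriv v x)) =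
      (\<lambda>x. indicator {a - real n<..a} x *\<^sub>R ?F x)"
      by (auto simp: fun_eq_iff indicator_def green_fun dgreen_def l_def abs_if power2_eq_square algebra_simps)
    thus "integrable lborel (\<lambda>x. indicator {a - real n<..a} x *\<^sub>R (s * l x * h1_fun v x + l x * h1_deriv v x))"
      using int[of "{a - real n<..a}"] by simp
    have "(\<lambda>x. indicator {a<..a + real n} x *\<^sub>R (- s * r x * h1_fun v x + r x * h1_deriv v x)) =
      (\<lambda>x. indicator {a<..a + real n} x *\<^sub>R ?F x)"
      by (auto simp: fun_eq_iff indicator_def green_fun dgreen_def r_def abs_if power2_eq_square algebra_simps)
    thus "integrable lborel (\<lambda>x. indicator {a<..a + real n} x *\<^sub>R (- s * r x * h1_fun v x + r x * h1_deriv v x))"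
      using int[of "{a<..a + real n}"] by simp
  qed
  have val: "(LINT x|lborel. indicator {a - real n<..a + real n} x *\<^sub>R ?F x) =
      h1_fun v a + (r (a + real n) * h1_fun v (a + real n) - l (a - real n) * h1_fun v (a - real n))" for n
  proof -
    have "(LINT x|lborel. indicator {a - real n<..a + real n} x *\<^sub>R ?F x) =
        (l a * h1_fun v a - l (a - real n) * h1_fun v (a - real n)) +
        (r (a + real n) * h1_fun v (a + real n) - r a * h1_fun v a)"
      unfolding eq Bochner_Integration.integral_add[OF i]
      by (intro arg_cong2[where f = "(+)"] integration_by_parts l r cont) auto
    thus ?thesis by (simp add: l_def r_def algebra_simps)
  qed
  have "(\<lambda>n. r (a + real n) * h1_fun v (a + real n) - l (a - real n) * h1_fun v (a - real n)) \<longlonglongrightarrow> 0"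
  proof (rule Lim_null_comparison[OF always_eventually], rule allI)
    fix n
    have "norm (r (a + real n)) = exp (- (Re s * real n)) / 2" "norm (l (a - real n)) = exp (- (Re s * real n)) / 2"
      by (simp_all add: l_def r_def norm_divide)
    hence "norm (r (a + real n) * h1_fun v (a + real n)) \<le> exp (- (Re s * real n)) / 2 * (2 * norm v)"
      "norm (l (a - real n) * h1_fun v (a - real n)) \<le> exp (- (Re s * real n)) / 2 * (2 * norm v)"
      unfolding norm_mult by (simp_all only:) (intro mult_left_mono sobolev_pointwise; simp)+
    thus "norm (r (a + real n) * h1_fun v (a + real n) - l (a - real n) * h1_fun v (a - real n))
        \<le> 2 * norm v * exp (- (Re s * real n))"
      by (intro order_trans[OF norm_triangle_ineq4]) (simp add: algebra_simps)
  next
    have "(\<lambda>n. exp (- (Re s * real n))) \<longlonglongrightarrow> 0"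
      using s by real_asymp
    from tendsto_mult_left[OF this, of "2 * norm v"]
    show "(\<lambda>n. 2 * norm v * exp (- (Re s * real n))) \<longlonglongrightarrow> 0" by simp
  qed
  from tendsto_add[OF tendsto_const this, of "h1_fun v a"]
  have "(\<lambda>n. LINT x|lborel. indicator {a - real n<..a + real n} x *\<^sub>R ?F x) \<longlonglongrightarrow> h1_fun v a"
    by (simp only: val) simp
  with integral_symmetric_exhaustion[OF F(1), of a]
  show "cdual_apply (helmholtz (s\<^sup>2) (green s a)) v = cdual_apply (dirac a) v"
    unfolding F(2) dirac_apply by (rule LIMSEQ_unique)
qed

end

section \<open>Oscillating solutions are not square-integrable\<close>

text \<open>
  The integrals of \<open>(norm f)\<^sup>2\<close> over successive periods are equal, and they tend to 0 by dominated convergence.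
\<close>

lemma periodic_modulus_sq_int_zero:
  assumes f: "f \<in> square_integrable" "continuous_on UNIV f" and "T > 0"
    and per: "\<And>x. x \<ge> 0 \<Longrightarrow> norm (f (x + T)) = norm (f x)" and "y \<ge> 0"
  shows "f y = 0"
proof -
  define I where "I n = (LINT x|lborel. indicator {real n * T<..real (Suc n) * T} x * (norm (f x))\<^sup>2)" for n
  note sq = sq_int_integrable[OF f(1)]
  note [measurable] = sq_int_measurable[OF f(1)]
  have per_n: "norm (f (x + real n * T)) = norm (f x)" if "x \<ge> 0" for x n
  proof (induction n)
    case (Suc n)
    have "norm (f (x + real (Suc n) * T)) = norm (f ((x + real n * T) + T))"
      by (simp add: algebra_simps)
    also have "\<dots> = norm (f (x + real n * T))"
      using that \<open>T > 0\<close> by (intro per) simp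
    finally show ?case using Suc.IH by simp
  qed simp
  have I_const: "I n = I 0" for n
  proof -
    have "I n = (LINT x|lborel. indicator {real n * T<..real (Suc n) * T} (real n * T + 1 * x) *
        (norm (f (real n * T + 1 * x)))\<^sup>2)"
      unfolding I_def by (subst lborel_integral_real_affine[where c = 1 and t = "real n * T"]) simp_all
    also have "\<dots> = I 0"
      unfolding I_def
    proof (rule Bochner_Integration.integral_cong[OF refl])
      fix x
      show "indicator {real n * T<..real (Suc n) * T} (real n * T + 1 * x) * (norm (f (real n * T + 1 * x)))\<^sup>2 =
          indicator {real 0 * T<..real (Suc 0) * T} x * (norm (f x))\<^sup>2"
        using per_n[of x n] by (auto simp: indicator_def algebra_simps)
    qed
    finally show ?thesis .
  qed
  have "I \<longlonglongrightarrow> (LINT x|(lborel :: real measure). 0)"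
    unfolding I_def
  proof (rule integral_dominated_convergence)
    show "integrable lborel (\<lambda>x. (norm (f x))\<^sup>2)" by (rule sq)
    show "AE x in lborel. norm (indicator {real n * T<..real (Suc n) * T} x * (norm (f x))\<^sup>2) \<le> (norm (f x))\<^sup>2" for n
      by (intro AE_I2) (auto simp: indicator_def)
    show "AE x in lborel. (\<lambda>n. indicator {real n * T<..real (Suc n) * T} x * (norm (f x))\<^sup>2) \<longlonglongrightarrow> 0"
    proof (intro AE_I2 tendsto_eventually)
      fix x :: real
      have "\<forall>\<^sub>F n :: nat in sequentially. real n > x / T"
        using filterlim_real_sequentially by (auto simp: filterlim_at_top_dense)
      thus "\<forall>\<^sub>F n :: nat in sequentially. indicator {real n * T<..real (Suc n) * T} x * (norm (f x))\<^sup>2 = 0"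
        by eventually_elim (use \<open>T > 0\<close> in \<open>auto simp: indicator_def field_simps\<close>)
    qed
  qed measurable
  moreover have "I \<longlonglongrightarrow> I 0"
    by (rule tendsto_eventually) (intro always_eventually allI I_const)
  ultimately have "I 0 = 0"
    by (simp add: LIMSEQ_unique)
  have i: "integrable lborel (\<lambda>x. indicator {0<..T} x * (norm (f x))\<^sup>2)"
    using integrable_mult_indicator[OF _ sq, of "{0<..T}"] by simp
  have "(LINT x|lborel. indicator {0<..T} x * (norm (f x))\<^sup>2) = 0"
    using \<open>I 0 = 0\<close> by (simp add: I_def)
  hence "AE x in lborel. indicator {0<..T} x * (norm (f x))\<^sup>2 = 0"
    by (subst (asm) integral_nonneg_eq_0_iff_AE[OF i]) auto
  hence ae: "AE x in lborel. x \<in> {0<..<T} \<longrightarrow> f x = 0"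
    by eventually_elim (auto simp: indicator_def split: if_splits)
  define Z where "Z = {0<..<T} \<inter> {x. f x \<noteq> 0}"
  have "open Z"
    unfolding Z_def by (intro open_Int open_Collect_neq f(2) continuous_on_const) simp
  moreover have "AE x in lborel. x \<notin> Z"
    using ae by eventually_elim (auto simp: Z_def)
  ultimately have "Z \<in> null_sets lborel"
    by (subst AE_iff_null_sets) auto
  hence "negligible Z"
    by (simp add: negligible_iff_null_sets null_sets_completionI)
  hence "Z = {}"
    using open_not_negligible[OF \<open>open Z\<close>] by blast
  hence zero: "f x = 0" if "x \<in> {0<..<T}" for x
    using that by (auto simp: Z_def)
  have "f x = 0" if "x \<in> {0..T}" for x
  proof (rule continuous_constant_on_closure[of "{0<..<T}"])
    show "continuous_on (closure {0<..<T}) f" by (rule continuous_on_subset[OF f(2)]) simp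
    show "x \<in> closure {0<..<T}" using that \<open>T > 0\<close> by simp
  qed (rule zero)
  moreover define n where "n = nat \<lfloor>y / T\<rfloor>"
  have "real n = of_int \<lfloor>y / T\<rfloor>"
    using \<open>y \<ge> 0\<close> \<open>T > 0\<close> by (simp add: n_def)
  hence "real n \<le> y / T" "y / T < real n + 1" by linarith+
  hence "y - real n * T \<in> {0..T}"
    using \<open>T > 0\<close> by (auto simp: field_simps)
  ultimately have "f (y - real n * T) = 0" by blast
  thus ?thesis
    using per_n[of "y - real n * T" n] \<open>y - real n * T \<in> {0..T}\<close> by simp
qed

text \<open>
  If \<open>k > 0\<close>, the step \<open>h = pi / (2 * k)\<close> makes the cosine vanish, and the modulus of \<open>f\<close> has period \<open>2 * h\<close>.
  If \<open>k = 0\<close>, the values of \<open>f\<close> along a unit step form an arithmetic progression; being bounded, it is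
  constant.
\<close>

lemma cosine_recurrence_sq_int_zero:
  fixes k K :: real
  assumes f: "f \<in> square_integrable" "continuous_on UNIV f" and bound: "\<And>x. norm (f x) \<le> K" and "k \<ge> 0"
    and rec: "\<And>h x. h > 0 \<Longrightarrow> x \<ge> 0 \<Longrightarrow> f (x + 2 * h) + f x = 2 * of_real (cos (k * h)) * f (x + h)"
    and "y \<ge> 0"
  shows "f y = 0"
proof (cases "k = 0")
  case False
  define h where "h = pi / (2 * k)"
  have "h > 0" and kh: "k * h = pi / 2" using False \<open>k \<ge> 0\<close> by (auto simp: h_def)
  hence "f (x + 2 * h) = - f x" if "x \<ge> 0" for x
    using rec[of h x, unfolded kh] that \<open>h > 0\<close> by (simp add: add_eq_0_iff2)
  thus ?thesis
    using \<open>h > 0\<close> \<open>y \<ge> 0\<close> by (intro periodic_modulus_sq_int_zero[OF f, of "2 * h"]) auto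
next
  case True
  have "f (x + 1) = f x" if "x \<ge> 0" for x
  proof (rule ccontr)
    define d where "d = f (x + 1) - f x"
    assume "f (x + 1) \<noteq> f x"
    hence "norm d > 0" by (simp add: d_def)
    have step: "f (x + real n + 1) - f (x + real n) = d" for n
    proof (induction n)
      case (Suc n)
      have "f (x + real n + 2 * 1) + f (x + real n) = 2 * f (x + real n + 1)"
        using rec[of 1 "x + real n"] True that by simp
      with Suc.IH show ?case by (simp add: algebra_simps)
    qed (simp add: d_def)
    have "f (x + real n) = f x + of_nat n * d" for n
    proof (induction n)
      case (Suc n)
      thus ?case using step[of n] by (simp add: algebra_simps)
    qed simp
    hence "real n * norm d \<le> 2 * K" for n
      using norm_triangle_ineq4[of "f (x + real n)" "f x"] bound[of x] bound[of "x + real n"]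
      by (simp add: norm_mult)
    moreover obtain n :: nat where "2 * K / norm d < real n" using reals_Archimedean2 by blast
    ultimately show False
      using \<open>norm d > 0\<close> by (metis not_less pos_divide_less_eq)
  qed
  thus ?thesis using \<open>y \<ge> 0\<close> by (intro periodic_modulus_sq_int_zero[OF f, of 1]) auto
qed

text \<open>
  The tent consists of two solutions of \<open>\<phi>'' = - k\<^sup>2 \<phi>\<close> that vanish at \<open>q - h\<close> and \<open>q + h\<close> and meet at \<open>q\<close>. Integration
  by parts on both halves leaves only the values of \<open>v\<close> at these three points.
\<close>

lemma harmonic_tent:
  fixes k h q :: real
  assumes "k \<ge> 0" "h > 0"
  obtains \<phi> :: h1 where "\<And>x. \<bar>x - q\<bar> \<ge> h \<Longrightarrow> h1_fun \<phi> x = 0"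
    "\<And>v. cdual_apply (helmholtz (- of_real (k\<^sup>2)) \<phi>) v =
       2 * of_real (cos (k * h)) * h1_fun v q - h1_fun v (q - h) - h1_fun v (q + h)"
proof -
  \<comment> \<open>Normalised so that \<open>sn' = cos\<close> also in the limit \<open>k = 0\<close>, which gives the piecewise linear tent.\<close>
  define sn where "sn x = (if k = 0 then x else sin (k * x) / k)" for x
  define cs where "cs x = cos (k * x)" for x
  have sn': "(sn has_real_derivative cs x) (at x)" for x
    unfolding sn_def[abs_def] cs_def by (cases "k = 0") (auto intro!: derivative_eq_intros)
  have cs': "(cs has_real_derivative - (k\<^sup>2 * sn x)) (at x)" for x
    unfolding cs_def[abs_def] sn_def
    by (cases "k = 0") (auto intro!: derivative_eq_intros simp: power2_eq_square)
  have cont: "continuous_on UNIV sn" "continuous_on UNIV cs"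
    by (intro continuous_at_imp_continuous_on ballI DERIV_isCont[OF sn'] DERIV_isCont[OF cs'])+
  have sn_le: "\<bar>sn x\<bar> \<le> \<bar>x\<bar>" for x
    using abs_sin_x_le_abs_x[of "k * x"] \<open>k \<ge> 0\<close> by (auto simp: sn_def abs_mult field_simps)
  have [simp]: "sn 0 = 0" by (simp add: sn_def)
  define u where "u x = complex_of_real (sn (max 0 (h - \<bar>x - q\<bar>)))" for x
  define g where "g x = (if x \<in> {q - h<..q} then complex_of_real (cs (x - q + h))
    else if x \<in> {q<..q + h} then - complex_of_real (cs (q + h - x)) else 0)" for x
  have u_cont: "continuous_on UNIV u"
    unfolding u_def by (intro continuous_intros continuous_on_compose2[OF cont(1)]) auto
  have u_out: "u x = 0" if "\<bar>x - q\<bar> \<ge> h" for x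
    using that by (simp add: u_def)
  have u_sq: "u \<in> square_integrable"
  proof (rule sq_int_bounded_support)
    show "norm (u x) \<le> h" for x
      using sn_le[of "max 0 (h - \<bar>x - q\<bar>)"] \<open>h > 0\<close> by (simp add: u_def)
    show "u x = 0" if "x \<notin> {q - h..q + h}" for x
      using that by (intro u_out) auto
  qed (rule borel_measurable_continuous_onI[OF u_cont])
  have [measurable]: "cs \<in> borel_measurable borel"
    by (rule borel_measurable_continuous_onI[OF cont(2)])
  have g_sq: "g \<in> square_integrable"
  proof (rule sq_int_bounded_support)
    show "g \<in> borel_measurable borel"
      unfolding g_def[abs_def] by measurable
    show "norm (g x) \<le> 1" for x
      by (auto simp: g_def cs_def)
    show "g x = 0" if "x \<notin> {q - h..q + h}" for x
      using that \<open>h > 0\<close> by (auto simp: g_def)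
  qed
  have D: "(u has_vector_derivative g x) (at x)" if "x \<notin> {q - h, q, q + h}" for x
  proof -
    consider "x \<in> {q - h<..<q}" | "x \<in> {q<..<q + h}" | "\<bar>x - q\<bar> > h"
      using \<open>x \<notin> {q - h, q, q + h}\<close> \<open>h > 0\<close> by fastforce
    thus ?thesis
    proof cases
      case 1
      have "((\<lambda>x. sn (x - q + h)) has_real_derivative cs (x - q + h) * 1) (at x)"
        by (rule DERIV_chain2[OF sn']) (auto intro!: derivative_eq_intros)
      hence "((\<lambda>x. complex_of_real (sn (x - q + h))) has_vector_derivative g x) (at x)"
        using 1 by (auto simp: g_def intro!: has_vector_derivative_of_real simp: has_real_derivative_iff_has_vector_derivative)
      thus ?thesis
        by (rule has_vector_derivative_transform_within_open[where S = "{q - h<..<q}"])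
           (use 1 in \<open>auto simp: u_def max_def abs_if algebra_simps\<close>)
    next
      case 2
      have "((\<lambda>x. sn (q + h - x)) has_real_derivative cs (q + h - x) * (-1)) (at x)"
        by (rule DERIV_chain2[OF sn']) (auto intro!: derivative_eq_intros)
      hence "((\<lambda>x. complex_of_real (sn (q + h - x))) has_vector_derivative complex_of_real (- cs (q + h - x))) (at x)"
        by (intro has_vector_derivative_of_real) (simp add: has_real_derivative_iff_has_vector_derivative)
      hence "((\<lambda>x. complex_of_real (sn (q + h - x))) has_vector_derivative g x) (at x)"
        using 2 by (simp add: g_def)
      thus ?thesis
        by (rule has_vector_derivative_transform_within_open[where S = "{q<..<q + h}"])
           (use 2 in \<open>auto simp: u_def max_def abs_if algebra_simps\<close>)
    next
      case 3
      have "((\<lambda>x. 0 :: complex) has_vector_derivative g x) (at x)"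
        using 3 by (auto simp: g_def)
      thus ?thesis
      proof (rule has_vector_derivative_transform_within_open)
        show "open {x. h < \<bar>x - q\<bar>}" by (intro open_Collect_less continuous_intros)
      qed (use 3 u_out in auto)
    qed
  qed
  define \<phi> where "\<phi> = Abs_h1 u"
  note \<phi> = h1_of_piecewise[OF _ u_cont u_sq g_sq D, of "{q - h, q, q + h}", folded \<phi>_def]
  show ?thesis
  proof (rule that[of \<phi>])
    show "h1_fun \<phi> x = 0" if "\<bar>x - q\<bar> \<ge> h" for x
      using \<phi>(1) u_out[OF that] by simp
    fix v
    let ?z = "- complex_of_real (k\<^sup>2)"
    have "((\<lambda>x. cs (x - q + h)) has_real_derivative - (k\<^sup>2 * sn (x - q + h)) * 1) (at x)" for x
      by (rule DERIV_chain2[OF cs']) (auto intro!: derivative_eq_intros)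
    hence L: "((\<lambda>x. cs (x - q + h)) has_real_derivative - (k\<^sup>2 * sn (x - q + h))) (at x)" for x
      by simp
    have "((\<lambda>x. cs (q + h - x)) has_real_derivative - (k\<^sup>2 * sn (q + h - x)) * (-1)) (at x)" for x
      by (rule DERIV_chain2[OF cs']) (auto intro!: derivative_eq_intros)
    hence R: "((\<lambda>x. - cs (q + h - x)) has_real_derivative - (k\<^sup>2 * sn (q + h - x))) (at x)" for x
      by (auto intro!: derivative_eq_intros)
    have cL: "continuous_on UNIV (\<lambda>x. - (k\<^sup>2 * sn (x - q + h)))"
      and cR: "continuous_on UNIV (\<lambda>x. - (k\<^sup>2 * sn (q + h - x)))"
      by (intro continuous_intros continuous_on_compose2[OF cont(1)]; simp)+
    have le: "q - h \<le> q" "q \<le> q + h" using \<open>h > 0\<close> by auto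
    note pL = integration_by_parts_real[OF L cL le(1), of v] and pR = integration_by_parts_real[OF R cR le(2), of v]
    have "cdual_apply (helmholtz ?z \<phi>) v = (LINT x|lborel. ?z * u x * h1_fun v x + g x * h1_deriv v x)"
      using helmholtz_apply_AE(2)[OF \<phi>(2) g_sq] \<phi>(1) by simp
    also have "\<dots> = (LINT x|lborel.
        indicator {q - h<..q} x *\<^sub>R (of_real (- (k\<^sup>2 * sn (x - q + h))) * h1_fun v x + of_real (cs (x - q + h)) * h1_deriv v x) +
        indicator {q<..q + h} x *\<^sub>R (of_real (- (k\<^sup>2 * sn (q + h - x))) * h1_fun v x + of_real (- cs (q + h - x)) * h1_deriv v x))"
      by (rule Bochner_Integration.integral_cong[OF refl])
         (auto simp: indicator_def u_def g_def max_def abs_if algebra_simps)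
    also have "\<dots> = (of_real (cs (q - q + h)) * h1_fun v q - of_real (cs (q - h - q + h)) * h1_fun v (q - h)) +
        (of_real (- cs (q + h - (q + h))) * h1_fun v (q + h) - of_real (- cs (q + h - q)) * h1_fun v q)"
      by (subst Bochner_Integration.integral_add[OF pL(1) pR(1)]) (simp only: pL(2) pR(2))
    also have "\<dots> = 2 * of_real (cos (k * h)) * h1_fun v q - h1_fun v (q - h) - h1_fun v (q + h)"
      by (simp add: cs_def algebra_simps)
    finally show "cdual_apply (helmholtz ?z \<phi>) v =
       2 * of_real (cos (k * h)) * h1_fun v q - h1_fun v (q - h) - h1_fun v (q + h)" .
  qed
qed

text \<open>
  Testing with tents that vanish at \<open>a\<close> shows that \<open>w\<close> satisfies the cosine recurrence on either side of \<open>a\<close>. This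
  single fact excludes eigenvalues on the half-line, makes \<open>\<delta>\<^sub>0\<close> unattainable there, and excludes
  annihilators of the range.
\<close>

lemma no_solution_nonpositive:
  assumes "k \<ge> 0" and eq: "helmholtz (- of_real (k\<^sup>2)) w = c *\<^sub>C dirac a"
  shows "w = 0"
proof (rule h1_eqI)
  fix x
  \<comment> \<open>\<open>\<sigma>\<close> selects the side of \<open>a\<close> on which \<open>x\<close> lies.\<close>
  define \<sigma> :: real where "\<sigma> = (if x \<ge> a then 1 else -1)"
  have \<sigma>: "\<sigma> * \<sigma> = 1" "\<sigma> \<noteq> 0" "\<sigma> = 1 \<or> \<sigma> = -1" by (auto simp: \<sigma>_def)
  define f where "f y = h1_fun w (a + \<sigma> * y)" for y
  have "f \<bar>x - a\<bar> = 0"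
  proof (rule cosine_recurrence_sq_int_zero[OF _ _ _ \<open>k \<ge> 0\<close>])
    have "integrable lborel (\<lambda>y. (norm (h1_fun w (a + \<sigma> * y)))\<^sup>2)"
      by (rule lborel_integrable_real_affine[OF sq_int_integrable[OF h1_square_integrable] \<sigma>(2)])
    moreover show cont: "continuous_on UNIV f"
      unfolding f_def by (intro continuous_on_compose2[OF h1_continuous] continuous_intros) auto
    ultimately show "f \<in> square_integrable"
      using borel_measurable_continuous_onI[OF cont] by (simp add: square_integrable_def f_def)
    show "norm (f y) \<le> 2 * norm w" for y
      unfolding f_def by (rule sobolev_pointwise)
    fix h y :: real assume hy: "h > 0" "y \<ge> 0"
    define q where "q = a + \<sigma> * (y + h)"
    obtain \<phi> where \<phi>: "\<And>x. \<bar>x - q\<bar> \<ge> h \<Longrightarrow> h1_fun \<phi> x = 0"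
      "\<And>v. cdual_apply (helmholtz (- of_real (k\<^sup>2)) \<phi>) v =
       2 * of_real (cos (k * h)) * h1_fun v q - h1_fun v (q - h) - h1_fun v (q + h)"
      using harmonic_tent[OF \<open>k \<ge> 0\<close> hy(1), of q] by blast
    have "h1_fun \<phi> a = 0"
      using hy \<sigma>(3) by (intro \<phi>(1)) (auto simp: q_def)
    hence "cdual_apply (helmholtz (- of_real (k\<^sup>2)) \<phi>) w = 0"
      using eq by (simp add: helmholtz_commute[of _ \<phi>] dirac_apply)
    hence *: "2 * of_real (cos (k * h)) * h1_fun w q - h1_fun w (q - h) - h1_fun w (q + h) = 0"
      by (simp only: \<phi>(2))
    have "f (y + 2 * h) + f y = h1_fun w (q - h) + h1_fun w (q + h)"
      using \<sigma>(3) by (auto simp: f_def q_def algebra_simps)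
    also have "\<dots> = 2 * of_real (cos (k * h)) * f (y + h)"
      using * by (simp add: f_def q_def algebra_simps)
    finally show "f (y + 2 * h) + f y = 2 * of_real (cos (k * h)) * f (y + h)" .
  qed simp
  thus "h1_fun w x = h1_fun 0 x"
    by (simp add: f_def \<sigma>_def abs_if split: if_splits)
qed

section \<open>The spectrum in terms of a scalar equation\<close>

text \<open>
  The operator \<open>z - (- A\<^sub>\<beta>)\<close> as a map on \<open>H\<^sup>1\<close>, without the embedding into the dual space.
\<close>

definition pencil :: "real \<Rightarrow> real \<Rightarrow> complex \<Rightarrow> h1 \<Rightarrow> hm1" where
  "pencil x0 \<beta> z u = helmholtz z u + (complex_of_real \<beta> * h1_fun u x0) *\<^sub>C dirac 0"

lemma scaleC_zero [simp]: "0 *\<^sub>C (F :: hm1) = 0"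
  by (rule cdual_eqI) simp

lemma pencil_linear:
  "pencil x0 \<beta> z (u + v) = pencil x0 \<beta> z u + pencil x0 \<beta> z v"
  "pencil x0 \<beta> z (c *\<^sub>C u) = c *\<^sub>C pencil x0 \<beta> z u"
  by (rule cdual_eqI, simp add: pencil_def helmholtz_linear algebra_simps)+

lemma pencil_eq: "pencil x0 \<beta> z u = z *\<^sub>C h1_embed u - (- A_op x0 \<beta> u)"
  by (simp add: pencil_def helmholtz_def A_op_def)

lemma pencil_neg_A: "(x, y) \<in> neg_A x0 \<beta> \<longleftrightarrow> (\<exists>u. x = h1_embed u \<and> z *\<^sub>C x - y = pencil x0 \<beta> z u)"
proof -
  have "z *\<^sub>C h1_embed u - y = z *\<^sub>C h1_embed u - (- A_op x0 \<beta> u) \<longleftrightarrow> y = - A_op x0 \<beta> u" for u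
    by (metis add_diff_cancel_left' diff_add_cancel diff_diff_eq2)
  thus ?thesis unfolding neg_A_def pencil_eq by auto
qed

lemma range_pencil: "{z *\<^sub>C x - y | x y. (x, y) \<in> neg_A x0 \<beta>} = range (pencil x0 \<beta> z)"
  unfolding neg_A_def pencil_eq by blast

lemma point_spectrum_pencil:
  "z \<in> point_spectrum (neg_A x0 \<beta>) \<longleftrightarrow> (\<exists>u. h1_embed u \<noteq> 0 \<and> pencil x0 \<beta> z u = 0)"
  by (auto simp: point_spectrum_def pencil_neg_A[of _ _ _ _ z])

lemma h1_embed_zero [simp]: "h1_embed 0 = 0"
  using norm_h1_embed_le[of 0] by simp

lemma dirac_nonzero: "dirac a \<noteq> 0"
proof
  assume "dirac a = 0"
  hence "h1_fun (green 1 a) a = 0"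
    by (metis cdual_apply_simps(1) dirac_apply)
  thus False by (simp add: green_fun)
qed

lemma nonpositive_real_cases:
  assumes "z \<in> complex_of_real ` {..0}"
  obtains k where "k \<ge> 0" "z = - complex_of_real (k\<^sup>2)"
proof -
  obtain t where t: "t \<le> 0" "z = complex_of_real t" using assms by auto
  have "z = - complex_of_real ((sqrt (- t))\<^sup>2)"
    using t by (simp del: of_real_power)
  thus ?thesis using that[of "sqrt (- t)"] t by simp
qed

lemma nonpositive_pencil_eq_dirac:
  assumes "z \<in> complex_of_real ` {..0}" "pencil x0 \<beta> z u = c *\<^sub>C dirac 0"
  shows "u = 0"
proof -
  obtain k where k: "k \<ge> 0" "z = - complex_of_real (k\<^sup>2)"
    using assms(1) by (rule nonpositive_real_cases)
  have "helmholtz z u = (c - complex_of_real \<beta> * h1_fun u x0) *\<^sub>C dirac 0"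
  proof (rule cdual_eqI)
    fix v
    have "cdual_apply (pencil x0 \<beta> z u) v = cdual_apply (c *\<^sub>C dirac 0) v"
      by (simp only: assms(2))
    thus "cdual_apply (helmholtz z u) v = cdual_apply ((c - complex_of_real \<beta> * h1_fun u x0) *\<^sub>C dirac 0) v"
      by (simp add: pencil_def algebra_simps)
  qed
  thus ?thesis using no_solution_nonpositive k by blast
qed

lemma nonpositive_not_eigenvalue:
  "z \<in> complex_of_real ` {..0} \<Longrightarrow> z \<notin> point_spectrum (neg_A x0 \<beta>)"
  using nonpositive_pencil_eq_dirac[of z x0 \<beta> _ 0] unfolding point_spectrum_pencil by fastforce

text \<open>
  The functional \<open>\<delta>\<^sub>0\<close> is not attained: the perturbation contributes a multiple of \<open>\<delta>\<^sub>0\<close> as well, so a preimage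
  would solve an equation whose only solution is 0.
\<close>

lemma nonpositive_in_spectrum:
  assumes "z \<in> complex_of_real ` {..0}"
  shows "z \<in> spectrum (neg_A x0 \<beta>)"
proof -
  have "dirac 0 \<notin> range (pencil x0 \<beta> z)"
  proof
    assume "dirac 0 \<in> range (pencil x0 \<beta> z)"
    then obtain u where u: "pencil x0 \<beta> z u = dirac 0" by auto
    hence "pencil x0 \<beta> z u = 1 *\<^sub>C dirac 0"
      by (simp add: cdual_eqI)
    hence "u = 0" using assms nonpositive_pencil_eq_dirac by blast
    moreover have "pencil x0 \<beta> z 0 = 0"
      using pencil_linear(1)[of x0 \<beta> z 0 0] by simp
    ultimately show False using u dirac_nonzero[of 0] by simp
  qed
  thus ?thesis
    unfolding spectrum_def resolvent_set_def range_pencil by blast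
qed

text \<open>
  An annihilator of the range solves the adjoint equation, in which \<open>\<delta>\<^sub>0\<close> and \<open>\<delta>\<close> at \<open>x0\<close> have exchanged their
  roles, and therefore vanishes.
\<close>

lemma nonpositive_dense_range:
  assumes "z \<in> complex_of_real ` {..0}"
  shows "closure (range (pencil x0 \<beta> z)) = UNIV"
proof (rule dense_if_annihilator_trivial)
  fix v assume v: "\<And>u. cdual_apply (pencil x0 \<beta> z u) v = 0"
  obtain k where k: "k \<ge> 0" "z = - complex_of_real (k\<^sup>2)"
    using assms(1) by (rule nonpositive_real_cases)
  have "helmholtz z v = (- complex_of_real \<beta> * h1_fun v 0) *\<^sub>C dirac x0"
  proof (rule cdual_eqI)
    show "cdual_apply (helmholtz z v) u = cdual_apply ((- complex_of_real \<beta> * h1_fun v 0) *\<^sub>C dirac x0) u" for u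
      using v[of u] by (simp add: pencil_def dirac_apply helmholtz_commute[of z v] add_eq_0_iff mult_ac)
  qed
  thus "v = 0" using no_solution_nonpositive k by blast
qed (rule pencil_linear)+

lemma slit_plane_square:
  assumes "z \<notin> complex_of_real ` {..0}"
  obtains s where "Re s > 0" "z = s\<^sup>2"
proof (rule that[of "csqrt z"])
  show "Re (csqrt z) > 0"
  proof (rule ccontr)
    assume "\<not> Re (csqrt z) > 0"
    hence "Re (csqrt z) = 0" using csqrt_principal[of z] by auto
    hence "csqrt z = \<i> * complex_of_real (Im (csqrt z))" by (simp add: complex_eq_iff)
    hence "(csqrt z)\<^sup>2 = complex_of_real (- (Im (csqrt z))\<^sup>2)"
      by (metis i_squared minus_mult_left mult_1 of_real_minus of_real_power power_mult_distrib power2_i)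
    hence "z = complex_of_real (- (Im (csqrt z))\<^sup>2)" by simp
    thus False using assms by (metis atMost_iff image_eqI neg_le_0_iff_le zero_le_power2)
  qed
qed simp

text \<open>
  Up to the factor \<open>2 * s\<close> this is \<open>1 + \<beta> G(x0)\<close>, where \<open>G\<close> is the Green function at 0; its zeros are the
  parameters for which the rank-one perturbation destroys invertibility.
\<close>

definition char_fun :: "real \<Rightarrow> real \<Rightarrow> complex \<Rightarrow> complex" where
  "char_fun x0 \<beta> s = 2 * s + complex_of_real \<beta> * exp (- s * complex_of_real x0)"

context
  fixes x0 \<beta> :: real and s :: complex
  assumes x0: "x0 > 0" and s: "Re s > 0"
begin

lemma green_at_x0: "1 + complex_of_real \<beta> * h1_fun (green s 0) x0 = char_fun x0 \<beta> s / (2 * s)"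
proof -
  have "s \<noteq> 0" using s by auto
  thus ?thesis using x0 s by (simp add: green_fun char_fun_def field_simps)
qed

text \<open>
  The Green function absorbs the rank-one term.
\<close>

lemma pencil_eq_iff:
  "pencil x0 \<beta> (s\<^sup>2) u = F \<longleftrightarrow> helmholtz (s\<^sup>2) (u + (complex_of_real \<beta> * h1_fun u x0) *\<^sub>C green s 0) = F"
  by (simp add: helmholtz_linear helmholtz_green[OF s] pencil_def)

text \<open>
  A kernel vector of the pencil is a multiple of the Green function, and evaluation at \<open>x0\<close> yields the scalar
  equation. Conversely, the equation makes the Green function itself a kernel vector.
\<close>

lemma eigenvalue_iff: "s\<^sup>2 \<in> point_spectrum (neg_A x0 \<beta>) \<longleftrightarrow> char_fun x0 \<beta> s = 0"
proof
  assume "s\<^sup>2 \<in> point_spectrum (neg_A x0 \<beta>)"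
  then obtain u where u: "h1_embed u \<noteq> 0" "pencil x0 \<beta> (s\<^sup>2) u = 0"
    unfolding point_spectrum_pencil by blast
  hence *: "u + (complex_of_real \<beta> * h1_fun u x0) *\<^sub>C green s 0 = 0"
    using helmholtz_inj[OF s] unfolding pencil_eq_iff by blast
  have "h1_fun u x0 * (1 + complex_of_real \<beta> * h1_fun (green s 0) x0) = 0"
    using arg_cong[OF *, of "\<lambda>v. h1_fun v x0"] by (simp add: algebra_simps)
  moreover have "h1_fun u x0 \<noteq> 0"
  proof
    assume "h1_fun u x0 = 0"
    hence "h1_fun u x = h1_fun 0 x" for x
      using arg_cong[OF *, of "\<lambda>v. h1_fun v x"] by simp
    hence "u = 0" by (rule h1_eqI)
    thus False using u(1) by simp
  qed
  ultimately show "char_fun x0 \<beta> s = 0"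
    using s unfolding green_at_x0 by auto
next
  assume "char_fun x0 \<beta> s = 0"
  hence *: "1 + complex_of_real \<beta> * h1_fun (green s 0) x0 = 0"
    unfolding green_at_x0 by simp
  have "pencil x0 \<beta> (s\<^sup>2) (green s 0) = 0"
  proof (rule cdual_eqI)
    fix v
    have "cdual_apply (pencil x0 \<beta> (s\<^sup>2) (green s 0)) v =
        (1 + complex_of_real \<beta> * h1_fun (green s 0) x0) * h1_fun v 0"
      by (simp add: pencil_def helmholtz_green[OF s] dirac_apply algebra_simps)
    thus "cdual_apply (pencil x0 \<beta> (s\<^sup>2) (green s 0)) v = cdual_apply 0 v"
      by (simp only: * ) simp
  qed
  moreover have "h1_embed (green s 0) \<noteq> 0"
  proof
    assume 0: "h1_embed (green s 0) = 0"
    \<comment> \<open>On a vector that embeds to 0 the operator ignores \<open>s\<close>, so the Green functions for \<open>s\<close> and \<open>s + 1\<close> would agree.\<close>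
    have s1: "Re (s + 1) > 0" using s by simp
    have "helmholtz ((s + 1)\<^sup>2) (green s 0) = helmholtz (s\<^sup>2) (green s 0)"
      unfolding helmholtz_def 0 by (intro cdual_eqI) simp
    also have "\<dots> = helmholtz ((s + 1)\<^sup>2) (green (s + 1) 0)"
      by (simp only: helmholtz_green[OF s] helmholtz_green[OF s1])
    finally have "green s 0 = green (s + 1) 0"
      using helmholtz_inj[OF s1, of "green s 0 - green (s + 1) 0"] by (simp add: helmholtz_linear)
    hence "1 / (2 * s) = 1 / (2 * (s + 1))"
      using green_fun[OF s, of 0 0] green_fun[OF s1, of 0 0] by simp
    moreover have "s \<noteq> 0" "s + 1 \<noteq> 0" using s s1 by (metis less_irrefl zero_complex.sel(1))+
    ultimately show False by (simp add: field_simps)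
  qed
  ultimately show "s\<^sup>2 \<in> point_spectrum (neg_A x0 \<beta>)"
    unfolding point_spectrum_pencil by blast
qed

text \<open>
  The substitution \<open>w\<close> turns the pencil into the coercive operator. It is inverted by first recovering \<open>u(x0)\<close>
  from \<open>w(x0) = D u(x0)\<close>.
\<close>

lemma resolvent_of_char_fun:
  assumes "char_fun x0 \<beta> s \<noteq> 0"
  shows "s\<^sup>2 \<in> resolvent_set (neg_A x0 \<beta>)"
proof -
  define D where "D = 1 + complex_of_real \<beta> * h1_fun (green s 0) x0"
  have "s \<noteq> 0" using s by auto
  hence D: "D \<noteq> 0" using assms unfolding D_def green_at_x0 by simp
  define w where "w u = u + (complex_of_real \<beta> * h1_fun u x0) *\<^sub>C green s 0" for u
  have w_x0: "h1_fun (w u) x0 = h1_fun u x0 * D" for u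
    by (simp add: w_def D_def algebra_simps)
  have "\<exists>u. pencil x0 \<beta> (s\<^sup>2) u = F" for F
  proof -
    obtain v where v: "helmholtz (s\<^sup>2) v = F" by (rule helmholtz_surj[OF s])
    define u where "u = v - (complex_of_real \<beta> * (h1_fun v x0 / D)) *\<^sub>C green s 0"
    have "h1_fun u x0 = h1_fun v x0 - (h1_fun v x0 / D) * (D - 1)"
      by (simp add: u_def D_def algebra_simps)
    also have "\<dots> = h1_fun v x0 / D" using D by (simp add: field_simps)
    finally have "w u = v" by (simp add: w_def u_def)
    thus ?thesis using v unfolding pencil_eq_iff w_def[symmetric] by blast
  qed
  hence surj: "range (pencil x0 \<beta> (s\<^sup>2)) = UNIV"
    by (metis UNIV_eq_I rangeI)
  define M where "M = 1 + \<bar>\<beta>\<bar> * (2 / norm D) * norm (green s 0)"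
  have est: "norm (h1_embed u) \<le> M / coercivity_constant s * norm (pencil x0 \<beta> (s\<^sup>2) u)" for u
  proof -
    have "coercivity_constant s * norm (w u) \<le> norm (helmholtz (s\<^sup>2) (w u))"
      by (rule helmholtz_coercive[OF s])
    also have "helmholtz (s\<^sup>2) (w u) = pencil x0 \<beta> (s\<^sup>2) u"
      using pencil_eq_iff unfolding w_def[symmetric] by metis
    finally have nw: "norm (w u) \<le> norm (pencil x0 \<beta> (s\<^sup>2) u) / coercivity_constant s"
      using coercivity_constant_pos[OF s] by (simp add: field_simps)
    have "norm (h1_fun u x0) * norm D \<le> 2 * norm (w u)"
      using sobolev_pointwise[of "w u" x0] by (simp add: w_x0 norm_mult)
    hence "norm (h1_fun u x0) \<le> 2 / norm D * norm (w u)"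
      using D by (simp add: field_simps)
    hence "norm ((complex_of_real \<beta> * h1_fun u x0) *\<^sub>C green s 0) \<le> \<bar>\<beta>\<bar> * (2 / norm D * norm (w u)) * norm (green s 0)"
      unfolding norm_scaleC norm_mult by (intro mult_mono) auto
    moreover have "norm u \<le> norm (w u) + norm ((complex_of_real \<beta> * h1_fun u x0) *\<^sub>C green s 0)"
      using norm_triangle_ineq4[of "w u" "(complex_of_real \<beta> * h1_fun u x0) *\<^sub>C green s 0"] by (simp add: w_def)
    ultimately have "norm u \<le> M * norm (w u)"
      by (simp add: M_def algebra_simps)
    also have "\<dots> \<le> M * (norm (pencil x0 \<beta> (s\<^sup>2) u) / coercivity_constant s)"
      using nw by (intro mult_left_mono) (auto simp: M_def)
    finally show ?thesis using norm_h1_embed_le[of u] by simp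
  qed
  show ?thesis
    unfolding resolvent_set_def range_pencil
  proof (intro CollectI conjI surj exI ballI, clarify)
    fix x y assume "(x, y) \<in> neg_A x0 \<beta>"
    then obtain u where "x = h1_embed u" "s\<^sup>2 *\<^sub>C x - y = pencil x0 \<beta> (s\<^sup>2) u"
      unfolding pencil_neg_A[of _ _ _ _ "s\<^sup>2"] by blast
    thus "norm x \<le> M / coercivity_constant s * norm (s\<^sup>2 *\<^sub>C x - y)" using est by simp
  qed
qed

end

lemma point_spectrum_in_spectrum: "point_spectrum T \<subseteq> spectrum T"
proof
  fix z assume "z \<in> point_spectrum T"
  then obtain x where x: "x \<noteq> 0" "(x, z *\<^sub>C x) \<in> T" by (auto simp: point_spectrum_def)
  have "\<not> norm x \<le> C * norm (z *\<^sub>C x - z *\<^sub>C x)" for C using x(1) by simp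
  thus "z \<in> spectrum T"
    using x(2) unfolding spectrum_def resolvent_set_def by blast
qed

lemma point_spectrum_eq:
  assumes "x0 > 0"
  shows "point_spectrum (neg_A x0 \<beta>) = {s\<^sup>2 | s. Re s > 0 \<and> char_fun x0 \<beta> s = 0}"
proof (intro set_eqI iffI)
  fix z assume z: "z \<in> point_spectrum (neg_A x0 \<beta>)"
  hence "z \<notin> complex_of_real ` {..0}" using nonpositive_not_eigenvalue by blast
  then obtain s where "Re s > 0" "z = s\<^sup>2" by (rule slit_plane_square)
  thus "z \<in> {s\<^sup>2 | s. Re s > 0 \<and> char_fun x0 \<beta> s = 0}"
    using z eigenvalue_iff[OF assms] by blast
qed (use eigenvalue_iff[OF assms] in blast)

lemma spectrum_eq:
  assumes "x0 > 0"
  shows "spectrum (neg_A x0 \<beta>) = complex_of_real ` {..0} \<union> point_spectrum (neg_A x0 \<beta>)"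
proof (intro set_eqI iffI)
  fix z assume z: "z \<in> spectrum (neg_A x0 \<beta>)"
  show "z \<in> complex_of_real ` {..0} \<union> point_spectrum (neg_A x0 \<beta>)"
  proof (rule ccontr)
    assume not: "z \<notin> complex_of_real ` {..0} \<union> point_spectrum (neg_A x0 \<beta>)"
    then obtain s where s: "Re s > 0" "z = s\<^sup>2" using slit_plane_square[of z] by blast
    hence "char_fun x0 \<beta> s \<noteq> 0" using not eigenvalue_iff[OF assms s(1)] by blast
    hence "z \<in> resolvent_set (neg_A x0 \<beta>)" using resolvent_of_char_fun[OF assms s(1)] s(2) by blast
    thus False using z by (simp add: spectrum_def)
  qed
qed (use nonpositive_in_spectrum point_spectrum_in_spectrum in blast)

lemma continuous_spectrum_eq:
  assumes "x0 > 0"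
  shows "continuous_spectrum (neg_A x0 \<beta>) = complex_of_real ` {..0}"
  unfolding continuous_spectrum_def range_pencil spectrum_eq[OF assms]
  using nonpositive_not_eigenvalue nonpositive_dense_range by blast

section \<open>Branches of the scalar equation\<close>

text \<open>
  The \<open>k\<close>-th component of the set where \<open>q > 0\<close>, \<open>sin q > 0\<close> and \<open>cos q < 0\<close>.
\<close>

definition branch_interval :: "nat \<Rightarrow> real set" where
  "branch_interval k = {(2 * real k + 1 / 2) * pi<..<(2 * real k + 1) * pi}"

text \<open>
  For \<open>t = p + \<i> q\<close> the real and imaginary parts of \<open>2 t + b exp (- t) = 0\<close> determine \<open>p\<close> and \<open>b\<close> from \<open>q\<close>: the
  quotient of the two gives \<open>p = - q cot q\<close>, and then \<open>b\<close> is the coupling below.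
\<close>

definition coupling :: "real \<Rightarrow> real" where
  "coupling q = 2 * q / sin q * exp (- (q * cos q / sin q))"

definition char_root :: "real \<Rightarrow> complex" where
  "char_root q = Complex (- (q * cos q / sin q)) q"

lemma trig_shift:
  "sin q = sin (q - 2 * real k * pi)" "cos q = cos (q - 2 * real k * pi)"
  by (simp_all add: sin_diff cos_diff)

lemma branch_closed_trig:
  assumes "(2 * real k + 1 / 2) * pi \<le> q" "q < (2 * real k + 1) * pi"
  shows "q > 0" "sin q > 0" "cos q \<le> 0" "(2 * real k + 1 / 2) * pi < q \<Longrightarrow> cos q < 0"
proof -
  define r where "r = q - 2 * real k * pi"
  have r: "pi / 2 \<le> r" "r < pi" using assms by (auto simp: r_def algebra_simps)
  have "0 < (2 * real k + 1 / 2) * pi" by (intro mult_pos_pos) auto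
  thus "q > 0" using assms by linarith
  show "sin q > 0" unfolding trig_shift(1)[of q k] r_def[symmetric]
    using r pi_gt_zero by (intro sin_gt_zero) linarith+
  have neg: "cos r = - sin (r - pi / 2)" by (simp add: sin_diff)
  show "cos q \<le> 0" unfolding trig_shift(2)[of q k] r_def[symmetric] neg
    using r pi_gt_zero by (simp add: sin_ge_zero)
  show "cos q < 0" if "(2 * real k + 1 / 2) * pi < q"
    unfolding trig_shift(2)[of q k] r_def[symmetric] neg
    using r pi_gt_zero that by (simp add: r_def algebra_simps sin_gt_zero)
qed

lemma branch_interval_trig:
  assumes "q \<in> branch_interval k"
  shows "q > 0" "sin q > 0" "cos q < 0"
  using branch_closed_trig[of k q] assms by (auto simp: branch_interval_def)

lemma branch_interval_index:
  assumes "q \<in> branch_interval k" shows "k = nat \<lfloor>q / (2 * pi)\<rfloor>"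
proof -
  have "real k \<le> q / (2 * pi)" "q / (2 * pi) < real k + 1"
    using assms pi_gt_zero by (auto simp: branch_interval_def field_simps)
  hence "\<lfloor>q / (2 * pi)\<rfloor> = int k" by (simp add: floor_eq_iff)
  thus ?thesis by simp
qed

lemma branch_interval_of_signs:
  assumes "q > 0" "sin q > 0" "cos q < 0"
  obtains k where "q \<in> branch_interval k"
proof -
  define k where "k = nat \<lfloor>q / (2 * pi)\<rfloor>"
  define r where "r = q - 2 * real k * pi"
  have "real k = of_int \<lfloor>q / (2 * pi)\<rfloor>" using assms(1) by (simp add: k_def)
  hence "real k \<le> q / (2 * pi)" "q / (2 * pi) < real k + 1" by linarith+
  hence r: "0 \<le> r" "r < 2 * pi" by (auto simp: r_def field_simps)
  have "sin r > 0" "cos r < 0" using assms trig_shift[of q k] by (auto simp: r_def)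
  have "r < pi"
  proof (rule ccontr)
    assume "\<not> r < pi"
    hence "sin (r - pi) \<ge> 0" using r by (intro sin_ge_zero) auto
    thus False using \<open>sin r > 0\<close> by (simp add: sin_diff)
  qed
  moreover have "r > pi / 2"
  proof (rule ccontr)
    assume "\<not> r > pi / 2"
    hence "cos r \<ge> 0" using r by (intro cos_ge_zero) auto
    thus False using \<open>cos r < 0\<close> by simp
  qed
  ultimately have "q \<in> branch_interval k"
    by (auto simp: branch_interval_def r_def algebra_simps)
  thus ?thesis by (rule that)
qed

lemma coupling_left: "coupling ((2 * real k + 1 / 2) * pi) = (4 * real k + 1) * pi"
proof -
  have e: "(2 * real k + 1 / 2) * pi - 2 * real k * pi = pi / 2" by (simp add: algebra_simps)
  have "sin ((2 * real k + 1 / 2) * pi) = 1" "cos ((2 * real k + 1 / 2) * pi) = 0"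
    unfolding trig_shift[of "(2 * real k + 1 / 2) * pi" k] e by simp_all
  thus ?thesis by (simp add: coupling_def algebra_simps)
qed

lemma coupling_three_quarters:
  "coupling ((2 * real k + 3 / 4) * pi) = 2 * sqrt 2 * ((2 * real k + 3 / 4) * pi) * exp ((2 * real k + 3 / 4) * pi)"
  (is "coupling ?q = _")
proof -
  have e: "?q - 2 * real k * pi = pi - pi / 4" by (simp add: algebra_simps)
  have "sin ?q = sqrt 2 / 2" "cos ?q = - (sqrt 2 / 2)"
    unfolding trig_shift[of ?q k] e by (simp_all only: sin_pi_minus cos_pi_minus sin_45 cos_45)
  hence "coupling ?q = 2 * ?q / (sqrt 2 / 2) * exp ?q"
    unfolding coupling_def by (simp only:) simp
  also have "2 * ?q / (sqrt 2 / 2) = 2 / (sqrt 2 / 2) * ?q" by simp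
  also have "2 / (sqrt 2 / 2) = 2 * sqrt 2" by (simp add: field_simps)
  finally show ?thesis .
qed

text \<open>
  The logarithmic derivative \<open>1 / q - 2 cot q + q / (sin q)\<^sup>2\<close> is positive because \<open>cot q \<le> 0\<close>.
\<close>

lemma coupling_strict_mono:
  assumes "(2 * real k + 1 / 2) * pi \<le> x" "x < y" "y < (2 * real k + 1) * pi"
  shows "coupling x < coupling y"
proof (rule DERIV_pos_imp_increasing[OF assms(2)])
  fix q assume "x \<le> q" "q \<le> y"
  hence q: "q > 0" "sin q > 0" "cos q \<le> 0"
    using branch_closed_trig[of k q] assms by auto
  let ?c = "q * cos q / sin q"
  have "(coupling has_real_derivative
      (2 * sin q - 2 * q * cos q) / (sin q)\<^sup>2 * exp (- ?c) +
      2 * q / sin q * (exp (- ?c) * ((q - cos q * sin q) / (sin q)\<^sup>2))) (at q)"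
    unfolding coupling_def[abs_def] using q
    by (auto intro!: derivative_eq_intros simp: field_simps power2_eq_square)
       (use sin_cos_squared_add[of q] in algebra)
  moreover have "(2 * sin q - 2 * q * cos q) / (sin q)\<^sup>2 * exp (- ?c) > 0"
    using q mult_nonneg_nonpos[of q "cos q"] by (intro mult_pos_pos divide_pos_pos) auto
  moreover have "2 * q / sin q * (exp (- ?c) * ((q - cos q * sin q) / (sin q)\<^sup>2)) \<ge> 0"
    using q mult_nonpos_nonneg[of "cos q" "sin q"] by (intro mult_nonneg_nonneg divide_nonneg_nonneg) auto
  ultimately show "\<exists>d. (coupling has_real_derivative d) (at q) \<and> 0 < d"
    by (metis add_pos_nonneg)
qed

lemma coupling_gt_threshold:
  "q \<in> branch_interval k \<Longrightarrow> (4 * real k + 1) * pi < coupling q"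
  using coupling_strict_mono[of k "(2 * real k + 1 / 2) * pi" q] unfolding coupling_left
  by (auto simp: branch_interval_def)

lemma coupling_inj:
  assumes "q \<in> branch_interval k" "q' \<in> branch_interval k" "coupling q = coupling q'"
  shows "q = q'"
  using coupling_strict_mono[of k q q'] coupling_strict_mono[of k q' q] assms
  by (cases q q' rule: linorder_cases) (auto simp: branch_interval_def)

lemma coupling_less_iff:
  assumes "q \<in> branch_interval k" "q' \<in> branch_interval k"
  shows "coupling q < coupling q' \<longleftrightarrow> q < q'"
  using coupling_strict_mono[of k q q'] coupling_strict_mono[of k q' q] assms
  by (cases q q' rule: linorder_cases) (auto simp: branch_interval_def)

text \<open>
  Towards the right end of the interval the sine tends to 0 while the exponential factor stays at least 1,
  so the coupling exceeds any bound, and the intermediate value theorem applies.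
\<close>

lemma coupling_surj:
  assumes "b > (4 * real k + 1) * pi"
  obtains q where "q \<in> branch_interval k" "coupling q = b"
proof -
  have "(4 * real k + 1) * pi > 0" by (intro mult_pos_pos) auto
  hence "b > 0" using assms by linarith
  define l where "l = (2 * real k + 1 / 2) * pi"
  \<comment> \<open>At distance \<open>\<delta>\<close> from the right end, \<open>sin y \<le> \<delta> \<le> 1 / b\<close>.\<close>
  define \<delta> where "\<delta> = min (pi / 4) (1 / b)"
  have \<delta>: "0 < \<delta>" "\<delta> \<le> pi / 4" "\<delta> * b \<le> 1"
    using \<open>b > 0\<close> by (auto simp: \<delta>_def min_def field_simps)
  define y where "y = (2 * real k + 1) * pi - \<delta>"
  have y: "l \<le> y" "y < (2 * real k + 1) * pi"
    using \<delta> pi_gt_zero by (auto simp: y_def l_def algebra_simps)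
  note t = branch_closed_trig[of k y, OF y[unfolded l_def]]
  have "y - 2 * real k * pi = pi - \<delta>" by (simp add: y_def algebra_simps)
  hence "sin y = sin \<delta>" using trig_shift(1)[of y k] by simp
  hence sin_le: "sin y \<le> \<delta>" using \<delta> sin_x_le_x[of \<delta>] by simp
  have "y \<ge> 1"
  proof -
    have "2 \<le> pi * (4 * real k + 1)" using mult_mono[of 2 pi 1 "4 * real k + 1"] pi_ge_two by simp
    thus ?thesis using y(1) by (simp add: l_def algebra_simps)
  qed
  have "b \<le> 1 / \<delta>" using \<delta> by (simp add: field_simps)
  also have "\<dots> \<le> 2 * y / sin y"
    using sin_le t \<open>y \<ge> 1\<close> \<delta> by (intro frac_le) auto
  also have "\<dots> * 1 \<le> coupling y"
    unfolding coupling_def using t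
    by (intro mult_left_mono) (auto simp: divide_nonpos_pos mult_nonneg_nonpos)
  finally have "b \<le> coupling y" by simp
  moreover have "coupling l \<le> b" using assms by (simp add: l_def coupling_left)
  moreover have "continuous_on {l..y} coupling"
    unfolding coupling_def
  proof (intro continuous_intros ballI)
    fix x assume "x \<in> {l..y}"
    thus "sin x \<noteq> 0" "sin x \<noteq> 0" using branch_closed_trig(2)[of k x] y by (auto simp: l_def)
  qed
  ultimately obtain q where q: "l \<le> q" "q \<le> y" "coupling q = b"
    using IVT'[of coupling l b y] y(1) by auto
  moreover have "q \<noteq> l" using q assms by (auto simp: l_def coupling_left)
  ultimately have "q \<in> branch_interval k"
    using y by (auto simp: branch_interval_def l_def)
  thus ?thesis using that q(3) by blast
qed

text \<open>
  The inverse of the coupling on the \<open>k\<close>-th interval.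
\<close>

definition branch :: "nat \<Rightarrow> real \<Rightarrow> real" where
  "branch k b = (THE q. q \<in> branch_interval k \<and> coupling q = b)"

lemma branch_works:
  assumes "b > (4 * real k + 1) * pi"
  shows "branch k b \<in> branch_interval k" "coupling (branch k b) = b"
proof -
  have "\<exists>!q. q \<in> branch_interval k \<and> coupling q = b"
    using coupling_surj[OF assms] coupling_inj by metis
  from theI'[OF this] show "branch k b \<in> branch_interval k" "coupling (branch k b) = b"
    unfolding branch_def by auto
qed

lemma branch_coupling:
  assumes "q \<in> branch_interval k" shows "branch k (coupling q) = q"
  using branch_works[OF coupling_gt_threshold[OF assms]] by (intro coupling_inj[OF _ assms])

lemma branch_continuous: "continuous_on {(4 * real k + 1) * pi<..} (branch k)"
proof (rule continuous_onI_mono)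
  have "branch k ` {(4 * real k + 1) * pi<..} = branch_interval k"
    using branch_works branch_coupling coupling_gt_threshold by (force simp: image_iff)
  thus "open (branch k ` {(4 * real k + 1) * pi<..})"
    by (simp add: branch_interval_def)
  fix b b' assume b: "b \<in> {(4 * real k + 1) * pi<..}" "b' \<in> {(4 * real k + 1) * pi<..}" "b \<le> b'"
  thus "branch k b \<le> branch k b'"
    using coupling_less_iff[of "branch k b'" k "branch k b"] branch_works[of k b] branch_works[of k b'] by force
qed

lemma branch_at_threshold:
  "(branch k \<longlongrightarrow> (2 * real k + 1 / 2) * pi) (at_right ((4 * real k + 1) * pi))" (is "(_ \<longlongrightarrow> ?l) (at_right ?b)")
proof (rule order_tendstoI)
  have right: "\<forall>\<^sub>F b in at_right ?b. b > ?b" by (simp add: eventually_at_right_less)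
  show "\<forall>\<^sub>F b in at_right ?b. u < branch k b" if "u < ?l" for u
    using right by eventually_elim (use branch_works(1)[of k] that in \<open>force simp: branch_interval_def\<close>)
  show "\<forall>\<^sub>F b in at_right ?b. branch k b < u" if "u > ?l" for u
  proof -
    have "?l < min u ((2 * real k + 1) * pi)" using that by (simp add: algebra_simps)
    then obtain q where "?l < q" "q < min u ((2 * real k + 1) * pi)" using dense by blast
    hence q: "q \<in> branch_interval k" "q < u" by (auto simp: branch_interval_def)
    have "\<forall>\<^sub>F b in at_right ?b. b \<in> {?b<..<coupling q}"
      by (rule eventually_at_right_field[THEN iffD2]) (use coupling_gt_threshold[OF q(1)] in auto)
    thus ?thesis
    proof eventually_elim
      case (elim b)
      hence "branch k b < q"
        using coupling_less_iff[of "branch k b" k q] branch_works[of k b] q(1) by auto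
      thus ?case using q(2) by simp
    qed
  qed
qed

lemma char_fun_real_imag:
  "char_fun 1 b t = 0 \<longleftrightarrow>
     2 * Re t + b * exp (- Re t) * cos (Im t) = 0 \<and> 2 * Im t = b * exp (- Re t) * sin (Im t)"
  by (auto simp: char_fun_def complex_eq_iff Re_exp Im_exp)

lemma char_fun_scale:
  assumes "x0 \<noteq> 0"
  shows "char_fun x0 \<beta> (t / of_real x0) = 0 \<longleftrightarrow> char_fun 1 (\<beta> * x0) t = 0"
proof -
  have "char_fun x0 \<beta> (t / of_real x0) * of_real x0 = char_fun 1 (\<beta> * x0) t"
    using assms by (simp add: char_fun_def field_simps)
  thus ?thesis using assms by (metis mult_eq_0_iff of_real_eq_0_iff)
qed

lemma char_fun_root:
  assumes "q \<in> branch_interval k"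
  shows "char_fun 1 (coupling q) (char_root q) = 0" "Re (char_root q) > 0"
proof -
  note q = branch_interval_trig[OF assms]
  have "exp (- (q * cos q / sin q)) * exp (q * cos q / sin q) = 1"
    by (simp add: exp_minus)
  hence "coupling q * exp (- Re (char_root q)) = 2 * q / sin q"
    by (simp add: coupling_def char_root_def)
  thus "char_fun 1 (coupling q) (char_root q) = 0"
    unfolding char_fun_real_imag using q by (simp add: char_root_def field_simps)
  show "Re (char_root q) > 0"
    using q by (simp add: char_root_def divide_neg_pos mult_pos_neg)
qed

text \<open>
  The two real equations force \<open>sin q > 0\<close> and \<open>cos q < 0\<close>, which places \<open>q\<close> in a branch interval, and they can
  then be solved for \<open>p\<close> and \<open>b\<close>.
\<close>

lemma char_fun_rootE:
  assumes "b > 0" "Re t > 0" "Im t > 0" "char_fun 1 b t = 0"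
  obtains k where "Im t \<in> branch_interval k" "t = char_root (Im t)" "b = coupling (Im t)"
proof -
  define p q where "p = Re t" and "q = Im t"
  have eq: "2 * p + b * exp (- p) * cos q = 0" "2 * q = b * exp (- p) * sin q"
    using assms(4) unfolding char_fun_real_imag p_def q_def by auto
  have pos: "b * exp (- p) > 0" "p > 0" "q > 0" using assms by (auto simp: p_def q_def)
  have "b * exp (- p) * cos q < 0" "b * exp (- p) * sin q > 0" using eq pos by linarith+
  hence sc: "cos q < 0" "sin q > 0"
    using pos(1) by (auto simp: mult_less_0_iff zero_less_mult_iff)
  have be: "b * exp (- p) = 2 * q / sin q" using eq(2) sc by (simp add: field_simps)
  have p: "p = - (q * cos q / sin q)" using eq(1) unfolding be by (simp add: field_simps)
  have "b = 2 * q / sin q * exp p"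
    unfolding be[symmetric] by (simp add: exp_minus)
  hence "b = coupling q" unfolding p coupling_def .
  moreover have "t = char_root q"
    using p by (simp add: char_root_def complex_eq_iff p_def q_def)
  moreover obtain k where "q \<in> branch_interval k" using branch_interval_of_signs pos sc by blast
  ultimately show ?thesis using that unfolding q_def by blast
qed

lemma char_fun_real_pos: "b \<ge> 0 \<Longrightarrow> Re t > 0 \<Longrightarrow> Im t = 0 \<Longrightarrow> char_fun 1 b t \<noteq> 0"
  unfolding char_fun_real_imag by (simp add: add_pos_nonneg less_imp_neq[symmetric])

lemma char_fun_cnj: "char_fun x0 b (cnj t) = cnj (char_fun x0 b t)"
  by (simp add: char_fun_def exp_cnj)

section \<open>Motion of the eigenvalues\<close>

text \<open>
  The \<open>k\<close>-th pair emerges from the half-line at the coupling that belongs to the left end of its branch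
  interval. It meets the imaginary axis where \<open>p = q\<close>, that is \<open>cot q = -1\<close>, at three quarters of the half
  period that contains the interval.
\<close>

definition threshold :: "real \<Rightarrow> nat \<Rightarrow> real" where
  "threshold x0 k = (4 * real k + 1) * pi / x0"

definition crossing :: "real \<Rightarrow> nat \<Rightarrow> real" where
  "crossing x0 k = coupling ((2 * real k + 3 / 4) * pi) / x0"

definition eigen_branch :: "real \<Rightarrow> nat \<Rightarrow> real \<Rightarrow> complex" where
  "eigen_branch x0 k \<beta> = (char_root (branch k (\<beta> * x0)) / of_real x0)\<^sup>2"

lemma char_root_re_im [simp]: "Im (char_root q) = q" "Re (char_root q) = - (q * cos q / sin q)"
  by (simp_all add: char_root_def)

text \<open>
  On a branch \<open>p - q = - (q / sin q) * (sin q + cos q)\<close>, so this sign decides on which side of the imaginary axis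
  \<open>(p + \<i> q)\<^sup>2\<close> lies.
\<close>

lemma sin_plus_cos_sign:
  assumes "q \<in> branch_interval k"
  shows "sgn (sin q + cos q) = sgn ((2 * real k + 3 / 4) * pi - q)"
proof -
  define r where "r = (2 * real k + 3 / 4) * pi - q"
  have r: "- pi < r" "r < pi" using assms pi_gt_zero by (auto simp: branch_interval_def r_def algebra_simps)
  have "sin (q - 2 * real k * pi) + cos (q - 2 * real k * pi) = sqrt 2 * sin r"
  proof -
    have q: "q - 2 * real k * pi = (pi - pi / 4) - r" by (simp add: r_def algebra_simps)
    have "sin (q - 2 * real k * pi) + cos (q - 2 * real k * pi) =
        sin (pi - pi / 4) * cos r - cos (pi - pi / 4) * sin r + (cos (pi - pi / 4) * cos r + sin (pi - pi / 4) * sin r)"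
      unfolding q by (simp only: sin_diff[of "pi - pi / 4" r] cos_diff[of "pi - pi / 4" r])
    also have "\<dots> = sqrt 2 * sin r"
      unfolding sin_pi_minus cos_pi_minus sin_45 cos_45 by (simp add: field_simps)
    finally show ?thesis .
  qed
  hence "sgn (sin q + cos q) = sgn (sin r)"
    using trig_shift[of q k] by (simp add: sgn_mult)
  also have "\<dots> = sgn r"
  proof (cases r "0 :: real" rule: linorder_cases)
    case less
    hence "sin (- r) > 0" using r by (intro sin_gt_zero) auto
    thus ?thesis using less by simp
  next
    case greater
    hence "sin r > 0" using r by (intro sin_gt_zero) auto
    thus ?thesis using greater by simp
  qed simp
  finally show ?thesis by (simp add: r_def)
qed

context
  fixes x0 :: real
  assumes x0: "x0 > 0"
begin

lemma threshold_less_iff: "threshold x0 k < \<beta> \<longleftrightarrow> (4 * real k + 1) * pi < \<beta> * x0"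
  using x0 by (simp add: threshold_def field_simps)

lemma threshold_strict_mono: "strict_mono (threshold x0)"
  using x0 by (auto simp: strict_mono_def threshold_def intro!: divide_strict_right_mono)

lemma threshold_unbounded: "filterlim (threshold x0) at_top sequentially"
  unfolding threshold_def using x0 by real_asymp

lemma finite_active: "finite {k. threshold x0 k < \<beta>}"
proof -
  have "\<forall>\<^sub>F k in sequentially. \<beta> \<le> threshold x0 k"
    using threshold_unbounded by (simp add: filterlim_at_top)
  then obtain N where "\<And>k. k \<ge> N \<Longrightarrow> \<beta> \<le> threshold x0 k"
    by (auto simp: eventually_sequentially)
  hence "{k. threshold x0 k < \<beta>} \<subseteq> {..<N}" by (force simp: not_le[symmetric])
  thus ?thesis by (rule finite_subset) simp
qed

lemma three_quarters_in: "(2 * real k + 3 / 4) * pi \<in> branch_interval k"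
  using pi_gt_zero by (simp add: branch_interval_def)

lemma threshold_less_crossing: "threshold x0 k < crossing x0 k"
  unfolding threshold_def crossing_def
  by (intro divide_strict_right_mono coupling_gt_threshold three_quarters_in x0)

lemma crossing_strict_mono: "strict_mono (crossing x0)"
proof -
  have "coupling ((2 * real k + 3 / 4) * pi) < coupling ((2 * real l + 3 / 4) * pi)" if "k < l" for k l
  proof -
    let ?a = "(2 * real k + 3 / 4) * pi" and ?b = "(2 * real l + 3 / 4) * pi"
    have pos: "0 < ?a" "0 < ?b"
      by (rule branch_interval_trig(1)[OF three_quarters_in])+
    have "?a < ?b"
      using that by (intro mult_strict_right_mono) auto
    hence "exp ?a < exp ?b" by (simp only: exp_less_cancel_iff)
    with \<open>?a < ?b\<close> have "?a * exp ?a < ?b * exp ?b"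
      by (rule mult_strict_mono) (use pos in simp_all)
    thus ?thesis unfolding coupling_three_quarters by (simp add: mult.assoc)
  qed
  thus ?thesis using x0 by (auto simp: strict_mono_def crossing_def intro!: divide_strict_right_mono)
qed

context
  fixes k :: nat and \<beta> :: real
  assumes \<beta>: "threshold x0 k < \<beta>"
begin

lemma branch_active: "branch k (\<beta> * x0) \<in> branch_interval k" "coupling (branch k (\<beta> * x0)) = \<beta> * x0"
  using branch_works \<beta> by (auto simp: threshold_less_iff)

lemma eigen_branch_Im:
  "Im (eigen_branch x0 k \<beta>) = 2 * Re (char_root (branch k (\<beta> * x0))) * branch k (\<beta> * x0) / x0\<^sup>2"
  by (simp add: eigen_branch_def Im_power2 Re_divide_of_real Im_divide_of_real power2_eq_square)

lemma eigen_branch_Im_pos: "Im (eigen_branch x0 k \<beta>) > 0"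
  unfolding eigen_branch_Im
  using x0 char_fun_root(2)[OF branch_active(1)] branch_interval_trig(1)[OF branch_active(1)]
  by (intro divide_pos_pos mult_pos_pos) auto

lemma eigen_branch_Re:
  "Re (eigen_branch x0 k \<beta>) = ((Re (char_root (branch k (\<beta> * x0))))\<^sup>2 - (branch k (\<beta> * x0))\<^sup>2) / x0\<^sup>2"
  by (simp add: eigen_branch_def Re_power2 Re_divide_of_real Im_divide_of_real power_divide diff_divide_distrib)

text \<open>
  The real part has the sign of \<open>p - q\<close>, hence of \<open>q - (2 * k + 3 / 4) * pi\<close>, and the coupling is increasing
  along the branch.
\<close>

lemma eigen_branch_Re_sign: "sgn (Re (eigen_branch x0 k \<beta>)) = sgn (\<beta> - crossing x0 k)"
proof -
  define q where "q = branch k (\<beta> * x0)"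
  have q: "q \<in> branch_interval k" "coupling q = \<beta> * x0" using branch_active by (auto simp: q_def)
  note t = branch_interval_trig[OF q(1)]
  define p where "p = Re (char_root q)"
  have "p > 0" using char_fun_root(2)[OF q(1)] by (simp add: p_def)
  have "(p\<^sup>2 - q\<^sup>2) / x0\<^sup>2 = (p - q) * ((p + q) / x0\<^sup>2)"
    by (simp add: power2_eq_square algebra_simps diff_divide_distrib add_divide_distrib)
  moreover have "p - q = - (q / sin q) * (sin q + cos q)"
    using t by (simp add: p_def field_simps)
  moreover define m where "m = (q / sin q) * ((p + q) / x0\<^sup>2)"
  ultimately have "Re (eigen_branch x0 k \<beta>) = - (m * (sin q + cos q))"
    unfolding eigen_branch_Re q_def[symmetric] p_def[symmetric] by simp
  moreover have "m > 0"
    unfolding m_def using t x0 \<open>p > 0\<close> by (intro mult_pos_pos divide_pos_pos) auto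
  ultimately have "sgn (Re (eigen_branch x0 k \<beta>)) = - sgn (sin q + cos q)"
    by (simp add: sgn_mult)
  also have "\<dots> = sgn (q - (2 * real k + 3 / 4) * pi)"
    unfolding sin_plus_cos_sign[OF q(1)] by (simp flip: sgn_minus)
  also have "\<dots> = sgn (coupling q - coupling ((2 * real k + 3 / 4) * pi))"
    using coupling_less_iff[OF q(1) three_quarters_in] coupling_less_iff[OF three_quarters_in q(1)]
    by (cases q "(2 * real k + 3 / 4) * pi" rule: linorder_cases) auto
  also have "\<dots> = sgn (\<beta> - crossing x0 k)"
  proof -
    have "coupling q - coupling ((2 * real k + 3 / 4) * pi) = (\<beta> - crossing x0 k) * x0"
      using x0 by (simp add: q(2) crossing_def field_simps)
    thus ?thesis using x0 by (simp add: sgn_mult)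
  qed
  finally show ?thesis .
qed

text \<open>
  Beyond the crossing \<open>p \<ge> q \<ge> 1\<close>, which keeps the eigenvalue away from the positive real axis.
\<close>

lemma eigen_branch_Im_ge:
  assumes "crossing x0 k \<le> \<beta>"
  shows "Im (eigen_branch x0 k \<beta>) \<ge> 2 / x0\<^sup>2"
proof -
  define q where "q = branch k (\<beta> * x0)"
  define p where "p = Re (char_root q)"
  have "p > 0" using char_fun_root(2)[OF branch_active(1)] by (simp add: p_def q_def)
  have "q > 0" using branch_interval_trig(1)[OF branch_active(1)] by (simp add: q_def)
  have "Re (eigen_branch x0 k \<beta>) \<ge> 0"
    using eigen_branch_Re_sign assms by (auto simp: sgn_if split: if_splits)
  hence "q\<^sup>2 \<le> p\<^sup>2"
    using x0 unfolding eigen_branch_Re q_def[symmetric] p_def[symmetric] by (simp add: zero_le_divide_iff)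
  hence "q \<le> p" using \<open>p > 0\<close> power2_le_imp_le[of q p] by simp
  moreover have "q \<ge> 1"
  proof -
    have "2 \<le> pi * (4 * real k + 1)" using mult_mono[of 2 pi 1 "4 * real k + 1"] pi_ge_two by simp
    thus ?thesis using branch_active(1) by (simp add: q_def[symmetric] branch_interval_def algebra_simps)
  qed
  ultimately have "1 * 1 \<le> p * q" by (intro mult_mono) auto
  thus ?thesis
    unfolding eigen_branch_Im q_def[symmetric] p_def[symmetric] using x0 by (intro divide_right_mono) auto
qed

end

lemma eigen_branch_inj: "inj_on (\<lambda>k. eigen_branch x0 k \<beta>) {k. threshold x0 k < \<beta>}"
proof (rule inj_onI)
  fix k l assume "k \<in> {k. threshold x0 k < \<beta>}" "l \<in> {k. threshold x0 k < \<beta>}"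
    and eq: "eigen_branch x0 k \<beta> = eigen_branch x0 l \<beta>"
  hence kl: "branch k (\<beta> * x0) \<in> branch_interval k" "branch l (\<beta> * x0) \<in> branch_interval l"
    using branch_active by auto
  have "(char_root (branch k (\<beta> * x0)))\<^sup>2 = (char_root (branch l (\<beta> * x0)))\<^sup>2"
    using eq x0 by (simp add: eigen_branch_def power_divide)
  hence "char_root (branch k (\<beta> * x0)) = char_root (branch l (\<beta> * x0)) \<or>
      char_root (branch k (\<beta> * x0)) = - char_root (branch l (\<beta> * x0))"
    by (simp only: power2_eq_iff)
  hence "char_root (branch k (\<beta> * x0)) = char_root (branch l (\<beta> * x0))"
    using branch_interval_trig(1)[OF kl(1)] branch_interval_trig(1)[OF kl(2)]
    by (auto dest: arg_cong[of _ _ Im])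
  hence "branch k (\<beta> * x0) = branch l (\<beta> * x0)"
    using char_root_re_im(1) by metis
  thus "k = l" using branch_interval_index kl by metis
qed

text \<open>
  Zeros of the characteristic function in the upper half-plane lie on the branches, those in the lower
  half-plane are their conjugates, and for \<open>\<beta> \<ge> 0\<close> the function is positive on the positive real axis.
\<close>

lemma point_spectrum_branches:
  assumes "\<beta> \<ge> 0"
  shows "point_spectrum (neg_A x0 \<beta>) =
    (\<Union>k \<in> {k. threshold x0 k < \<beta>}. {eigen_branch x0 k \<beta>, cnj (eigen_branch x0 k \<beta>)})"
    (is "_ = ?B")
proof (intro equalityI subsetI)
  have upper: "s\<^sup>2 \<in> (\<lambda>k. eigen_branch x0 k \<beta>) ` {k. threshold x0 k < \<beta>}"
    if "Re s > 0" "Im s > 0" "char_fun x0 \<beta> s = 0" for s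
  proof -
    define t where "t = s * of_real x0"
    have s_eq: "s = t / of_real x0" using x0 by (simp add: t_def)
    have t: "Re t > 0" "Im t > 0" "char_fun 1 (\<beta> * x0) t = 0"
      using that x0 char_fun_scale[of x0 \<beta> t] unfolding s_eq[symmetric] by (auto simp: t_def)
    have "\<beta> \<noteq> 0"
    proof
      assume "\<beta> = 0"
      hence "s = 0" using that(3) by (simp add: char_fun_def)
      thus False using that(1) by simp
    qed
    hence "\<beta> * x0 > 0" using assms x0 by simp
    then obtain k where k: "Im t \<in> branch_interval k" "t = char_root (Im t)" "\<beta> * x0 = coupling (Im t)"
      using char_fun_rootE t by metis
    have "branch k (\<beta> * x0) = Im t" using branch_coupling[OF k(1)] k(3) by simp
    hence "eigen_branch x0 k \<beta> = s\<^sup>2"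
      unfolding eigen_branch_def s_eq using k(2) by simp
    moreover have "threshold x0 k < \<beta>"
      using coupling_gt_threshold[OF k(1)] by (simp add: threshold_less_iff k(3))
    ultimately show ?thesis by (metis imageI mem_Collect_eq)
  qed
  fix z assume "z \<in> point_spectrum (neg_A x0 \<beta>)"
  then obtain s where s: "z = s\<^sup>2" "Re s > 0" "char_fun x0 \<beta> s = 0"
    unfolding point_spectrum_eq[OF x0] by blast
  consider "Im s > 0" | "Im s < 0" | "Im s = 0" by linarith
  thus "z \<in> ?B"
  proof cases
    case 1
    thus ?thesis using upper[OF s(2) _ s(3)] s(1) by auto
  next
    case 2
    have "char_fun x0 \<beta> (cnj s) = 0" using s(3) by (simp add: char_fun_cnj)
    hence "(cnj s)\<^sup>2 \<in> (\<lambda>k. eigen_branch x0 k \<beta>) ` {k. threshold x0 k < \<beta>}"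
      using upper[of "cnj s"] s(2) 2 by simp
    then obtain k where "threshold x0 k < \<beta>" "(cnj s)\<^sup>2 = eigen_branch x0 k \<beta>" by auto
    moreover from this(2) have "z = cnj (eigen_branch x0 k \<beta>)" using s(1) by (metis complex_cnj_cnj complex_cnj_power)
    ultimately show ?thesis by auto
  next
    case 3
    have "char_fun 1 (\<beta> * x0) (s * of_real x0) = 0"
      using s(3) char_fun_scale[of x0 \<beta> "s * of_real x0"] x0 by simp
    moreover have "char_fun 1 (\<beta> * x0) (s * of_real x0) \<noteq> 0"
      using 3 s(2) x0 assms by (intro char_fun_real_pos) auto
    ultimately show ?thesis by blast
  qed
next
  fix z assume "z \<in> ?B"
  then obtain k where k: "threshold x0 k < \<beta>" "z = eigen_branch x0 k \<beta> \<or> z = cnj (eigen_branch x0 k \<beta>)" by auto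
  define s where "s = char_root (branch k (\<beta> * x0)) / of_real x0"
  have s: "Re s > 0" "char_fun x0 \<beta> s = 0"
    using char_fun_root[OF branch_active(1)[OF k(1)]] x0 char_fun_scale[of x0 \<beta>]
    by (simp_all add: s_def branch_active(2)[OF k(1)] Re_divide_of_real del: char_root_re_im)
  hence s': "Re (cnj s) > 0" "char_fun x0 \<beta> (cnj s) = 0" by (simp_all add: char_fun_cnj)
  have "z = s\<^sup>2 \<or> z = (cnj s)\<^sup>2" using k(2) by (simp add: eigen_branch_def s_def)
  thus "z \<in> point_spectrum (neg_A x0 \<beta>)"
    unfolding point_spectrum_eq[OF x0] using s s' by blast
qed

lemma point_spectrum_finite: "\<beta> \<ge> 0 \<Longrightarrow> finite (point_spectrum (neg_A x0 \<beta>))"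
  unfolding point_spectrum_branches by (intro finite_UN_I finite_active) auto

lemma point_spectrum_empty: "0 \<le> \<beta> \<Longrightarrow> \<beta> \<le> threshold x0 0 \<Longrightarrow> point_spectrum (neg_A x0 \<beta>) = {}"
proof -
  assume \<beta>: "0 \<le> \<beta>" "\<beta> \<le> threshold x0 0"
  have "\<not> threshold x0 k < \<beta>" for k
    using strict_mono_less_eq[OF threshold_strict_mono, of 0 k] \<beta>(2) by simp
  thus ?thesis using \<beta>(1) by (simp add: point_spectrum_branches)
qed

text \<open>
  For fixed \<open>s\<close> the characteristic function is affine in \<open>\<beta>\<close> with nonzero slope, so two different couplings
  have no eigenvalue in common.
\<close>

lemma point_spectrum_determines_coupling:
  assumes "point_spectrum (neg_A x0 \<beta>) = point_spectrum (neg_A x0 \<beta>')" "point_spectrum (neg_A x0 \<beta>) \<noteq> {}"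
  shows "\<beta> = \<beta>'"
proof -
  obtain z where z: "z \<in> point_spectrum (neg_A x0 \<beta>)" "z \<in> point_spectrum (neg_A x0 \<beta>')" using assms by blast
  then obtain s where s: "Re s > 0" "z = s\<^sup>2" "char_fun x0 \<beta> s = 0"
    unfolding point_spectrum_eq[OF x0] by blast
  have "char_fun x0 \<beta>' s = 0" using z(2) s(2) eigenvalue_iff[OF x0 s(1)] by blast
  hence "(complex_of_real \<beta> - complex_of_real \<beta>') * exp (- s * complex_of_real x0) = 0"
    using s(3) by (simp add: char_fun_def algebra_simps add_eq_0_iff2)
  thus ?thesis by (simp flip: of_real_diff)
qed

lemma eigenvalue_isolated:
  assumes "\<beta> \<ge> 0" "z \<in> point_spectrum (neg_A x0 \<beta>)"
  shows "z isolated_in spectrum (neg_A x0 \<beta>)"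
proof -
  define N where "N = complex_of_real ` {..0}"
  have "closed N"
  proof -
    have "N = {z. Im z = 0 \<and> Re z \<le> 0}"
      by (auto simp: N_def image_iff complex_eq_iff intro!: exI[of _ "Re _"])
    thus ?thesis by (auto intro!: closed_Collect_conj closed_Collect_eq closed_Collect_le continuous_intros)
  qed
  have fin: "finite (point_spectrum (neg_A x0 \<beta>) - {z})"
    using point_spectrum_finite[OF assms(1)] by simp
  show ?thesis
  proof (rule isolated_inI)
    show "z \<in> spectrum (neg_A x0 \<beta>)" using assms(2) point_spectrum_in_spectrum by blast
    show "open (- (N \<union> (point_spectrum (neg_A x0 \<beta>) - {z})))"
      using \<open>closed N\<close> finite_imp_closed[OF fin] by (intro open_Compl closed_Un)
    have "z \<notin> N" using assms(2) nonpositive_not_eigenvalue unfolding N_def by blast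
    thus "- (N \<union> (point_spectrum (neg_A x0 \<beta>) - {z})) \<inter> spectrum (neg_A x0 \<beta>) = {z}"
      using assms(2) unfolding spectrum_eq[OF x0] N_def[symmetric] by auto
  qed
qed

lemma eigen_branch_continuous: "continuous_on {threshold x0 k<..} (eigen_branch x0 k)"
proof -
  have "continuous_on {threshold x0 k<..} (\<lambda>\<beta>. branch k (\<beta> * x0))"
    by (intro continuous_on_compose2[OF branch_continuous] continuous_intros) (auto simp: threshold_less_iff)
  moreover have "sin (branch k (\<beta> * x0)) \<noteq> 0" if "\<beta> \<in> {threshold x0 k<..}" for \<beta>
    using branch_interval_trig(2)[OF branch_active(1)] that by fastforce
  ultimately show ?thesis
    unfolding eigen_branch_def[abs_def] char_root_def Complex_eq using x0
    by (intro continuous_intros) auto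
qed

text \<open>
  At the left end of the branch interval the cosine vanishes, so \<open>p\<close> tends to 0 and the eigenvalue to \<open>- (q / x0)\<^sup>2\<close>.
\<close>

lemma eigen_branch_at_threshold:
  "(eigen_branch x0 k \<longlongrightarrow> complex_of_real (- ((2 * real k + 1 / 2) * pi / x0)\<^sup>2)) (at_right (threshold x0 k))"
proof -
  let ?l = "(2 * real k + 1 / 2) * pi"
  have e: "?l - 2 * real k * pi = pi / 2" by (simp add: algebra_simps)
  have trig: "sin ?l = 1" "cos ?l = 0"
    unfolding trig_shift[of ?l k] e by simp_all
  have "filterlim (\<lambda>\<beta>. \<beta> * x0) (at_right ((4 * real k + 1) * pi)) (at_right (threshold x0 k))"
    unfolding filterlim_at
  proof
    have "((\<lambda>\<beta>. \<beta> * x0) \<longlongrightarrow> threshold x0 k * x0) (at_right (threshold x0 k))"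
      by (intro tendsto_intros)
    thus "((\<lambda>\<beta>. \<beta> * x0) \<longlongrightarrow> (4 * real k + 1) * pi) (at_right (threshold x0 k))"
      using x0 by (simp add: threshold_def)
    have "\<forall>\<^sub>F \<beta> in at_right (threshold x0 k). threshold x0 k < \<beta>"
      by (simp add: eventually_at_right_less)
    thus "\<forall>\<^sub>F \<beta> in at_right (threshold x0 k). \<beta> * x0 \<in> {(4 * real k + 1) * pi<..} \<and> \<beta> * x0 \<noteq> (4 * real k + 1) * pi"
      by eventually_elim (auto simp: threshold_less_iff)
  qed
  from filterlim_compose[OF branch_at_threshold this]
  have lim: "((\<lambda>\<beta>. branch k (\<beta> * x0)) \<longlongrightarrow> ?l) (at_right (threshold x0 k))" .
  have "((\<lambda>\<beta>. char_root (branch k (\<beta> * x0))) \<longlongrightarrow> Complex (- (?l * cos ?l / sin ?l)) ?l) (at_right (threshold x0 k))"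
    unfolding char_root_def by (intro tendsto_intros lim) (simp add: trig)
  hence "(eigen_branch x0 k \<longlongrightarrow> (Complex (- (?l * cos ?l / sin ?l)) ?l / of_real x0)\<^sup>2) (at_right (threshold x0 k))"
    unfolding eigen_branch_def[abs_def] using x0 by (intro tendsto_intros) auto
  moreover have "(Complex (- (?l * cos ?l / sin ?l)) ?l / of_real x0)\<^sup>2 = complex_of_real (- (?l / x0)\<^sup>2)"
    unfolding trig by (simp add: complex_eq_iff Re_power2 Im_power2 Re_divide_of_real Im_divide_of_real)
  ultimately show ?thesis by simp
qed

end

theorem proposition2p5:
  fixes x0 \<beta>0 \<beta>1 :: real
  assumes "x0 > 0"
    and "\<beta>0 = pi / x0"
    and "\<beta>1 = 3 * pi / sqrt 2 * exp (3 * pi / 4) / x0"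
  shows "(\<forall>\<beta>. 0 \<le> \<beta> \<and> \<beta> < \<beta>0 \<longrightarrow>
           spectrum (neg_A x0 \<beta>) = complex_of_real ` {..0} \<and>
           continuous_spectrum (neg_A x0 \<beta>) = complex_of_real ` {..0} \<and>
           point_spectrum (neg_A x0 \<beta>) = {}) \<and>
    \<beta>0 < \<beta>1 \<and>
    (\<forall>\<beta>. \<beta>0 < \<beta> \<and> \<beta> < \<beta>1 \<longrightarrow>
           continuous_spectrum (neg_A x0 \<beta>) = complex_of_real ` {..0} \<and>
           finite (point_spectrum (neg_A x0 \<beta>)) \<and>
           point_spectrum (neg_A x0 \<beta>) \<noteq> {} \<and>
           (\<forall>z \<in> point_spectrum (neg_A x0 \<beta>).
              z \<notin> \<real> \<and> Re z < 0 \<and> cnj z \<in> point_spectrum (neg_A x0 \<beta>) \<and>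
              z isolated_in spectrum (neg_A x0 \<beta>))) \<and>
    inj_on (\<lambda>\<beta>. point_spectrum (neg_A x0 \<beta>)) {\<beta>0<..<\<beta>1} \<and>
    (\<exists>\<omega>>0. {z \<in> point_spectrum (neg_A x0 \<beta>1). Re z \<ge> 0} =
           {\<i> * complex_of_real \<omega>, - \<i> * complex_of_real \<omega>}) \<and>
    (\<forall>\<beta>>0. finite (point_spectrum (neg_A x0 \<beta>))) \<and>
    (\<exists>(b :: nat \<Rightarrow> real) (c :: nat \<Rightarrow> real) (\<Lambda> :: nat \<Rightarrow> real \<Rightarrow> complex).
           strict_mono b \<and> strict_mono c \<and> b 0 = \<beta>0 \<and> c 0 = \<beta>1 \<and> (\<forall>k. b k < c k) \<and>
           filterlim b at_top sequentially \<and>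
           (\<forall>\<beta>>\<beta>0.
              point_spectrum (neg_A x0 \<beta>) = (\<Union>k \<in> {k. b k < \<beta>}. {\<Lambda> k \<beta>, cnj (\<Lambda> k \<beta>)}) \<and>
              inj_on (\<lambda>k. \<Lambda> k \<beta>) {k. b k < \<beta>}) \<and>
           (\<forall>k. continuous_on {b k<..} (\<Lambda> k) \<and>
              (\<exists>r<0. complex_of_real r \<in> continuous_spectrum (neg_A x0 (b k)) \<and>
                 (\<Lambda> k \<longlongrightarrow> complex_of_real r) (at_right (b k))) \<and>
              (\<forall>\<beta>>b k. Im (\<Lambda> k \<beta>) > 0) \<and>
              (\<forall>\<beta>. b k < \<beta> \<and> \<beta> < c k \<longrightarrow> Re (\<Lambda> k \<beta>) < 0) \<and>
              Re (\<Lambda> k (c k)) = 0 \<and>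
              (\<forall>\<beta>>c k. Re (\<Lambda> k \<beta>) > 0) \<and>
              (\<exists>\<epsilon>>0. \<forall>\<beta>\<ge>c k. Im (\<Lambda> k \<beta>) \<ge> \<epsilon>)))"
proof -
  note x0 = assms(1)
  let ?b = "threshold x0" and ?c = "crossing x0" and ?L = "eigen_branch x0"
  note bc = threshold_less_crossing[OF x0] and b_mono = threshold_strict_mono[OF x0]
    and c_mono = crossing_strict_mono[OF x0]
  have b0: "?b 0 = \<beta>0" by (simp add: threshold_def assms(2))
  have c0: "?c 0 = \<beta>1"
  proof -
    have "2 * sqrt 2 * (3 / 4 * pi) = 3 * pi / sqrt 2"
      by (simp add: field_simps)
    thus ?thesis
      using coupling_three_quarters[of 0] by (simp add: crossing_def assms(3) mult.commute)
  qed
  have "\<beta>0 > 0" using assms by simp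
  have c_le: "\<beta>1 \<le> ?c k" "k \<noteq> 0 \<Longrightarrow> \<beta>1 < ?c k" for k
    using strict_mono_less_eq[OF c_mono, of 0 k] strict_mono_less[OF c_mono, of 0 k] c0 by auto
  note Im_pos = eigen_branch_Im_pos[OF x0] and sign = eigen_branch_Re_sign[OF x0]
  have neg: "Re (?L k \<beta>) < 0" if "?b k < \<beta>" "\<beta> < ?c k" for k \<beta>
    using sign[OF that(1)] that(2) by (simp add: sgn_if split: if_splits)
  have zero: "Re (?L k (?c k)) = 0" for k
    using sign[OF bc, of k] by (simp add: sgn_if split: if_splits)
  have pos: "Re (?L k \<beta>) > 0" if "?c k < \<beta>" for k \<beta>
    using sign[OF less_trans[OF bc that]] that by (simp add: sgn_if split: if_splits)
  have ps: "point_spectrum (neg_A x0 \<beta>) = (\<Union>k \<in> {k. ?b k < \<beta>}. {?L k \<beta>, cnj (?L k \<beta>)})" if "\<beta> \<ge> 0" for \<beta>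
    by (rule point_spectrum_branches[OF x0 that])
  have nonempty: "point_spectrum (neg_A x0 \<beta>) \<noteq> {}" if "\<beta>0 < \<beta>" for \<beta>
    using that \<open>\<beta>0 > 0\<close> b0 by (subst ps) auto
  have 1: "spectrum (neg_A x0 \<beta>) = complex_of_real ` {..0} \<and>
           continuous_spectrum (neg_A x0 \<beta>) = complex_of_real ` {..0} \<and>
           point_spectrum (neg_A x0 \<beta>) = {}" if "0 \<le> \<beta>" "\<beta> < \<beta>0" for \<beta>
    using point_spectrum_empty[OF x0 that(1)] that(2) b0
    by (simp add: spectrum_eq[OF x0] continuous_spectrum_eq[OF x0])
  have 2: "z \<notin> \<real> \<and> Re z < 0 \<and> cnj z \<in> point_spectrum (neg_A x0 \<beta>) \<and> z isolated_in spectrum (neg_A x0 \<beta>)"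
    if \<beta>: "\<beta>0 < \<beta>" "\<beta> < \<beta>1" and z: "z \<in> point_spectrum (neg_A x0 \<beta>)" for \<beta> z
  proof -
    have "\<beta> \<ge> 0" using \<beta> \<open>\<beta>0 > 0\<close> by simp
    then obtain k where k: "?b k < \<beta>" "z = ?L k \<beta> \<or> z = cnj (?L k \<beta>)" using z by (auto simp: ps)
    have "Re z < 0" using neg[OF k(1)] k(2) \<beta>(2) c_le(1)[of k] by auto
    moreover have "z \<notin> \<real>" using Im_pos[OF k(1)] k(2) by (auto simp: complex_is_Real_iff)
    moreover have "cnj z \<in> point_spectrum (neg_A x0 \<beta>)" using k by (auto simp: ps[OF \<open>\<beta> \<ge> 0\<close>])
    ultimately show ?thesis using eigenvalue_isolated[OF x0 \<open>\<beta> \<ge> 0\<close> z] by blast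
  qed
  have 3: "inj_on (\<lambda>\<beta>. point_spectrum (neg_A x0 \<beta>)) {\<beta>0<..<\<beta>1}"
    using point_spectrum_determines_coupling[OF x0] nonempty by (intro inj_onI) auto
  have 4: "\<exists>\<omega>>0. {z \<in> point_spectrum (neg_A x0 \<beta>1). Re z \<ge> 0} =
           {\<i> * complex_of_real \<omega>, - \<i> * complex_of_real \<omega>}"
  proof (intro exI conjI)
    have b1: "?b 0 < \<beta>1" using bc[of 0] c0 by simp
    show "Im (?L 0 \<beta>1) > 0" by (rule Im_pos[OF b1])
    have "\<beta>1 \<ge> 0" using b1 b0 \<open>\<beta>0 > 0\<close> by simp
    have L: "?L 0 \<beta>1 = \<i> * complex_of_real (Im (?L 0 \<beta>1))"
      using zero[of 0] c0 by (simp add: complex_eq_iff)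
    hence L': "cnj (?L 0 \<beta>1) = - \<i> * complex_of_real (Im (?L 0 \<beta>1))"
      using zero[of 0] c0 by (simp add: complex_eq_iff)
    have "Re (?L k \<beta>1) < 0" if "?b k < \<beta>1" "k \<noteq> 0" for k
      using neg that c_le(2) by blast
    hence "{z \<in> point_spectrum (neg_A x0 \<beta>1). Re z \<ge> 0} = {?L 0 \<beta>1, cnj (?L 0 \<beta>1)}"
      using b1 zero[of 0] c0 unfolding ps[OF \<open>\<beta>1 \<ge> 0\<close>] by fastforce
    thus "{z \<in> point_spectrum (neg_A x0 \<beta>1). Re z \<ge> 0} =
        {\<i> * complex_of_real (Im (?L 0 \<beta>1)), - \<i> * complex_of_real (Im (?L 0 \<beta>1))}"
      using L L' by metis
  qed
  have 5: "\<exists>r<0. complex_of_real r \<in> continuous_spectrum (neg_A x0 (?b k)) \<and>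
                 (?L k \<longlongrightarrow> complex_of_real r) (at_right (?b k))" for k
  proof (intro exI conjI)
    have "(2 * real k + 1 / 2) * pi / x0 > 0" using x0 by (intro divide_pos_pos mult_pos_pos) auto
    thus "- ((2 * real k + 1 / 2) * pi / x0)\<^sup>2 < 0" using x0 by simp
    thus "complex_of_real (- ((2 * real k + 1 / 2) * pi / x0)\<^sup>2) \<in> continuous_spectrum (neg_A x0 (?b k))"
      unfolding continuous_spectrum_eq[OF x0] by (intro imageI) simp
  qed (rule eigen_branch_at_threshold[OF x0])
  have 6: "\<exists>\<epsilon>>0. \<forall>\<beta>\<ge>?c k. Im (?L k \<beta>) \<ge> \<epsilon>" for k
  proof (intro exI conjI allI impI)
    show "2 / x0\<^sup>2 > 0" using x0 by simp
    show "2 / x0\<^sup>2 \<le> Im (?L k \<beta>)" if "?c k \<le> \<beta>" for \<beta>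
      by (rule eigen_branch_Im_ge[OF x0 less_le_trans[OF bc that] that])
  qed
  have 7: "\<exists>(b :: nat \<Rightarrow> real) (c :: nat \<Rightarrow> real) (\<Lambda> :: nat \<Rightarrow> real \<Rightarrow> complex).
           strict_mono b \<and> strict_mono c \<and> b 0 = \<beta>0 \<and> c 0 = \<beta>1 \<and> (\<forall>k. b k < c k) \<and>
           filterlim b at_top sequentially \<and>
           (\<forall>\<beta>>\<beta>0.
              point_spectrum (neg_A x0 \<beta>) = (\<Union>k \<in> {k. b k < \<beta>}. {\<Lambda> k \<beta>, cnj (\<Lambda> k \<beta>)}) \<and>
              inj_on (\<lambda>k. \<Lambda> k \<beta>) {k. b k < \<beta>}) \<and>
           (\<forall>k. continuous_on {b k<..} (\<Lambda> k) \<and>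
              (\<exists>r<0. complex_of_real r \<in> continuous_spectrum (neg_A x0 (b k)) \<and>
                 (\<Lambda> k \<longlongrightarrow> complex_of_real r) (at_right (b k))) \<and>
              (\<forall>\<beta>>b k. Im (\<Lambda> k \<beta>) > 0) \<and>
              (\<forall>\<beta>. b k < \<beta> \<and> \<beta> < c k \<longrightarrow> Re (\<Lambda> k \<beta>) < 0) \<and>
              Re (\<Lambda> k (c k)) = 0 \<and>
              (\<forall>\<beta>>c k. Re (\<Lambda> k \<beta>) > 0) \<and>
              (\<exists>\<epsilon>>0. \<forall>\<beta>\<ge>c k. Im (\<Lambda> k \<beta>) \<ge> \<epsilon>))"
  proof (rule exI[of _ ?b], rule exI[of _ ?c], rule exI[of _ ?L], intro conjI allI impI)
    show "point_spectrum (neg_A x0 \<beta>) = (\<Union>k \<in> {k. ?b k < \<beta>}. {?L k \<beta>, cnj (?L k \<beta>)})" if "\<beta>0 < \<beta>" for \<beta>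
      using that \<open>\<beta>0 > 0\<close> by (intro ps) simp
  qed (use b_mono c_mono b0 c0 bc threshold_unbounded[OF x0] eigen_branch_inj[OF x0]
      eigen_branch_continuous[OF x0] 5 Im_pos neg zero pos 6 in blast)+
  show ?thesis
    using 1 2 3 4 7 nonempty continuous_spectrum_eq[OF x0] point_spectrum_finite[OF x0] \<open>\<beta>0 > 0\<close> bc[of 0] b0 c0
    by (intro conjI allI impI ballI) auto
qed

end
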